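(* Let $X_1$ be a random vector in $\mathbb R^d$ such that $0\in\operatorname{int}\mathcal D_{\mathcal L}$. Let $\mathcal Y$ be a complete metric space and $F:BV[0,1]\to\mathcal Y$ a mapping that is continuous in $\rho_1'$ and uniformly continuous in $\rho_1'$ on $\{h\in BV[0,1]:\operatorname{Var}(h)\le R\}$ for every $R>0$. Then both sequences $(F(S_n(\cdot)/n))_{n\ge1}$ and $(F(S_{[n\cdot]}/n))_{n\ge1}$ satisfy the (standard) LDP in $\mathcal Y$ with speed $n$ and the tight rate function $\operatorname{cl}\tilde{\mathcal J}$, where $\tilde{\mathcal J}(y):=\inf_{h\in F^{-1}(y)}I_D(h)$ for $y\in\mathcal Y$.
   Context: $X_1,X_2,\dots$ are i.i.d. random vectors in $\mathbb R^d$, $S_0:=0$, $S_n:=X_1+\dots+X_n$. $\mathcal L(u):=\mathbb E e^{u\cdot X_1}$, $\mathcal D_{\mathcal L}:=\{u\in\mathbb R^d:\mathcal L(u)<\infty\}$, $K:=\log\mathcal L$, $I(v):=\sup_{u\in\mathbb R^d}(u\cdot v-K(u))$. $S_n(\cdot)$ is the continuous function on $[0,1]$ with $S_n(k/n)=S_k$ ($0\le k\le n$), linear on each $[(k-1)/n,k/n]$; $S_{[n\cdot]}$ is $t\mapsto S_{\lfloor nt\rfloor}$. $D[0,1]$ is the set of càdlàg functions $[0,1]\to\mathbb R^d$. For $h\in D[0,1]$ and a finite set $\mathbf t\subset(0,1]$, $h^{\mathbf t}$ is the continuous function on $[0,1]$ that is linear between consecutive points of $\mathbf t\cup\{0,1\}$,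 with $h^{\mathbf t}(0):=0$ and $h^{\mathbf t}(s):=h(s)$ for $s\in\mathbf t\cup\{1\}$. $\operatorname{Var}(h):=\sup_{\mathbf t}\int_0^1|(h^{\mathbf t})'(s)|ds$ and $I_D(h):=\sup_{\mathbf t}\int_0^1 I((h^{\mathbf t})'(s))ds$, suprema over finite $\mathbf t\subset(0,1]$; $BV[0,1]:=\{h\in D[0,1]:\operatorname{Var}(h)<\infty\}$. Metric $\rho_1'$: for $h\in D[0,1]$ put $h(0-):=0$ and let $h(t-)$ be the left limit for $t\in(0,1]$; $\Gamma'h:=\{(t,x)\in[0,1]\times\mathbb R^d: x\in[h(t-),h(t)]\}$ ($[a,b]$ the line segment); $\Pi'(h)$ is the set of continuous bijections $\gamma:[0,1]\to\Gamma'h$ with $\gamma(0)=(0,0)$; $\rho_1'(h_1,h_2):=\inf_{\gamma_i\in\Pi'(h_i)}\sup_{t\in[0,1]}|\gamma_1(t)-\gamma_2(t)|$. A sequence $(Y_n)$ satisfies the LDP in $\mathcal Y$ with tight rate function $\mathcal J$ (lower semi-continuous, $[0,\infty]$-valued, not $\equiv\infty$, with compact sub-level sets) and speed $n$ if for every Borel $A$: $-\inf_{\operatorname{int}A}\mathcal J\le\liminf\frac1n\log\mathbb P(Y_n\in A)\le\limsup\frac1n\log\mathbb P(Y_n\in A)\le-\inf_{\operatorname{cl}A}\mathcal J$. $\operatorname{cl}J$ is the lower semi-continuous regularization of $J$ (epigraph = closure of epigraph of $J$). *)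

theory Defs
  imports "HOL-Probability.Probability"
begin

definition Laplace_dom :: "'b measure \<Rightarrow> ('b \<Rightarrow> 'a::euclidean_space) \<Rightarrow> 'a set" where
  "Laplace_dom M Y = {u. (\<integral>\<^sup>+\<omega>. ennreal (exp (u \<bullet> Y \<omega>)) \<partial>M) < \<infinity>}"

definition cumulant :: "'b measure \<Rightarrow> ('b \<Rightarrow> 'a::euclidean_space) \<Rightarrow> 'a \<Rightarrow> ereal" where
  "cumulant M Y u =
     (if u \<in> Laplace_dom M Y
      then ereal (ln (enn2real (\<integral>\<^sup>+\<omega>. ennreal (exp (u \<bullet> Y \<omega>)) \<partial>M)))
      else \<infinity>)"

definition rate_I :: "'b measure \<Rightarrow> ('b \<Rightarrow> 'a::euclidean_space) \<Rightarrow> 'a \<Rightarrow> ereal" where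
  "rate_I M Y v = (SUP u. ereal (u \<bullet> v) - cumulant M Y u)"

definition D01 :: "(real \<Rightarrow> 'a::euclidean_space) set" where
  "D01 = {h. (\<forall>t\<in>{0..<1}. continuous (at_right t) h)
           \<and> (\<forall>t\<in>{0<..1}. \<exists>l. (h \<longlongrightarrow> l) (at_left t))
           \<and> (\<forall>t. t \<notin> {0..1} \<longrightarrow> h t = 0)}"

definition pl :: "(real \<Rightarrow> 'a::real_vector) \<Rightarrow> real set \<Rightarrow> real \<Rightarrow> 'a" where
  "pl h T s =
     (let g = (\<lambda>p. if p = 0 then 0 else h p); P = insert 0 (insert 1 T) in
      if s \<notin> {0..1} then 0
      else if s = 1 then h 1
      else (let a = Max {p\<in>P. p \<le> s}; b = Min {p\<in>P. s < p}
            in g a + ((s - a) / (b - a)) *\<^sub>R (g b - g a)))"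

definition partitions01 :: "real set set" where
  "partitions01 = {T. finite T \<and> T \<subseteq> {0<..1}}"

definition var01 :: "(real \<Rightarrow> 'a::euclidean_space) \<Rightarrow> ennreal" where
  "var01 h = (SUP T\<in>partitions01.
      \<integral>\<^sup>+ s\<in>{0..1}. ennreal (norm (vector_derivative (pl h T) (at s))) \<partial>lborel)"

definition BV01 :: "(real \<Rightarrow> 'a::euclidean_space) set" where
  "BV01 = {h\<in>D01. var01 h < \<infinity>}"

definition I_D :: "'b measure \<Rightarrow> ('b \<Rightarrow> 'a::euclidean_space) \<Rightarrow> (real \<Rightarrow> 'a) \<Rightarrow> ennreal" where
  "I_D M Y h = (SUP T\<in>partitions01.
      \<integral>\<^sup>+ s\<in>{0..1}. e2ennreal (rate_I M Y (vector_derivative (pl h T) (at s))) \<partial>lborel)"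

definition left_val :: "(real \<Rightarrow> 'a::euclidean_space) \<Rightarrow> real \<Rightarrow> 'a" where
  "left_val h t = (if t = 0 then 0 else Lim (at_left t) h)"

definition Gamma' :: "(real \<Rightarrow> 'a::euclidean_space) \<Rightarrow> (real \<times> 'a) set" where
  "Gamma' h = {(t, x). t \<in> {0..1} \<and> x \<in> closed_segment (left_val h t) (h t)}"

definition Pi' :: "(real \<Rightarrow> 'a::euclidean_space) \<Rightarrow> (real \<Rightarrow> real \<times> 'a) set" where
  "Pi' h = {\<gamma>. continuous_on {0..1} \<gamma> \<and> bij_betw \<gamma> {0..1} (Gamma' h) \<and> \<gamma> 0 = (0, 0)}"

definition rho1' :: "(real \<Rightarrow> 'a::euclidean_space) \<Rightarrow> (real \<Rightarrow> 'a) \<Rightarrow> real" where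
  "rho1' h1 h2 = Inf ((\<lambda>(\<gamma>1, \<gamma>2). Sup ((\<lambda>t. dist (\<gamma>1 t) (\<gamma>2 t)) ` {0..1}))
                      ` (Pi' h1 \<times> Pi' h2))"

text \<open>X 0, X 1, ... stand for X_1, X_2, ...; Ssum X k = S_k.\<close>
definition Ssum :: "(nat \<Rightarrow> 'b \<Rightarrow> 'a::real_vector) \<Rightarrow> nat \<Rightarrow> 'b \<Rightarrow> 'a" where
  "Ssum X k \<omega> = (\<Sum>i<k. X i \<omega>)"

definition poly_path :: "(nat \<Rightarrow> 'b \<Rightarrow> 'a::real_vector) \<Rightarrow> nat \<Rightarrow> 'b \<Rightarrow> real \<Rightarrow> 'a" where
  "poly_path X n \<omega> t =
     (if t \<in> {0..1}
      then (1 / real n) *\<^sub>R (Ssum X (nat \<lfloor>real n * t\<rfloor>) \<omega>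
             + (real n * t - of_int \<lfloor>real n * t\<rfloor>) *\<^sub>R X (nat \<lfloor>real n * t\<rfloor>) \<omega>)
      else 0)"

definition step_path :: "(nat \<Rightarrow> 'b \<Rightarrow> 'a::real_vector) \<Rightarrow> nat \<Rightarrow> 'b \<Rightarrow> real \<Rightarrow> 'a" where
  "step_path X n \<omega> t =
     (if t \<in> {0..1} then (1 / real n) *\<^sub>R Ssum X (nat \<lfloor>real n * t\<rfloor>) \<omega> else 0)"

text \<open>Lower semi-continuous regularization: epigraph = closure of epigraph of J.\<close>
definition lsc_reg :: "('y::topological_space \<Rightarrow> ereal) \<Rightarrow> 'y \<Rightarrow> ereal" where
  "lsc_reg J y = Inf {c. (y, c) \<in> closure {(z, c). J z \<le> c}}"

definition tight_rate_function :: "('y::topological_space \<Rightarrow> ereal) \<Rightarrow> bool" where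
  "tight_rate_function J \<longleftrightarrow>
     (\<forall>y. 0 \<le> J y) \<and> (\<exists>y. J y \<noteq> \<infinity>)
     \<and> (\<forall>c. closed {y. J y \<le> c})
     \<and> (\<forall>c::real. compact {y. J y \<le> ereal c})"

definition log_prob :: "real \<Rightarrow> ereal" where
  "log_prob p = (if p = 0 then - \<infinity> else ereal (ln p))"

definition LDP :: "'b measure \<Rightarrow> (nat \<Rightarrow> 'b \<Rightarrow> 'y::topological_space) \<Rightarrow> ('y \<Rightarrow> ereal) \<Rightarrow> bool" where
  "LDP M Y J \<longleftrightarrow> tight_rate_function J \<and>
     (\<forall>A\<in>sets borel.
        let r = (\<lambda>n. ereal (1 / real n) * log_prob (measure M {\<omega>\<in>space M. Y n \<omega> \<in> A}))
        in - (INF y\<in>interior A. J y) \<le> liminf r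
           \<and> liminf r \<le> limsup r
           \<and> limsup r \<le> - (INF y\<in>closure A. J y))"

definition J_tilde :: "'b measure \<Rightarrow> ('b \<Rightarrow> 'a::euclidean_space) \<Rightarrow> ((real \<Rightarrow> 'a) \<Rightarrow> 'y) \<Rightarrow> 'y \<Rightarrow> ereal" where
  "J_tilde M Y F y = (INF h\<in>{h\<in>BV01. F h = y}. enn2ereal (I_D M Y h))"

end

theory Submission
  imports Defs
begin

text \<open>Upper bound: up to a small error in \<open>rho1'\<close>, a random polygon of variation at most \<open>R\<close> is
  determined by its increments over a bounded number of groups of consecutive steps, so it falls into
  one of polynomially many cells. By supermultiplicativity, the probability of a cell is at most
  \<open>exp (- n * I_D h)\<close> for a suitable polygon \<open>h\<close> in that cell, and \<open>F h\<close> is close to the closed set in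
  question. The same discretization shows that \<open>F\<close> maps the polygons of variation at most \<open>R\<close> to a
  totally bounded set, which gives the tightness of the rate function.

  Lower bound: every \<open>h\<close> is a limit of its polygons \<open>pl h T\<close> in \<open>rho1'\<close>, which cost no more than \<open>h\<close>,
  and Cramer's lower bound, applied to consecutive blocks of a fixed length, keeps the random walk in a
  tube around such a polygon.\<close>

section \<open>Piecewise linear paths and their cost\<close>

text \<open>A group of steps may be as short as one step, so an asymptotic Cramer bound cannot be
  applied to the groups of a cell. The upper bound works because Chernoff's bound over a compact
  convex set holds for every number of steps without an extra factor; only the number of cells is
  then left to beat. Near 0 the moment generating function is finite, but the rate may grow only
  linearly: paths with jumps can have finite cost, and large single steps survive in the limit. The
  hypothesis yields two linear estimates, an exponential tail for the variation of the walk and a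
  bound on the variation of a path by its cost. Both confine the work to paths of variation at most
  some \<open>R\<close>, where \<open>F\<close> is uniformly continuous. Distances
  \<open>rho1'\<close> are bounded from above only, by exhibiting parametrizations; errors are added
  up in the target space after applying \<open>F\<close>. The room for all these errors is the
  positive distance between the compact part of the closed set and a sublevel set of the regularized
  rate function.\<close>

definition nodes :: "(nat \<Rightarrow> real) \<Rightarrow> nat \<Rightarrow> bool" where
  "nodes t N \<longleftrightarrow> t 0 = 0 \<and> t N = 1 \<and> (\<forall>j<N. t j < t (Suc j))"

definition ramp :: "(nat \<Rightarrow> real) \<Rightarrow> nat \<Rightarrow> real \<Rightarrow> real" where
  "ramp t j s = max 0 (min 1 ((s - t j) / (t (Suc j) - t j)))"

text \<open>Coded by increments rather than node values: variation and cost are read off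
  \<open>w\<close>, merging slots adds entries of \<open>w\<close>, and the path depends linearly on
  \<open>w\<close>. The value 0 outside the unit interval agrees with \<open>pl\<close> and
  \<open>D01\<close>.\<close>

definition pw_linear :: "(nat \<Rightarrow> real) \<Rightarrow> (nat \<Rightarrow> 'a::real_vector) \<Rightarrow> nat \<Rightarrow> real \<Rightarrow> 'a" where
  "pw_linear t w N s = (if s \<in> {0..1} then (\<Sum>j<N. ramp t j s *\<^sub>R w j) else 0)"

text \<open>\<open>pl\<close> overrides the value at 0 by 0, so a jump of \<open>h\<close> at time 0
  counts as part of the first increment.\<close>

definition start0 :: "(real \<Rightarrow> 'a::real_vector) \<Rightarrow> real \<Rightarrow> 'a" where
  "start0 h p = (if p = 0 then 0 else h p)"

lemma nodes_less:
  assumes "nodes t N" "i < j" "j \<le> N"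
  shows "t i < t j"
  using assms(2,3)
proof (induction j)
  case (Suc j)
  have "t j < t (Suc j)" using assms(1) Suc.prems by (auto simp: nodes_def)
  then show ?case using Suc by (cases "i = j") auto
qed simp

lemma nodes_le:
  assumes "nodes t N" "i \<le> j" "j \<le> N"
  shows "t i \<le> t j"
  using nodes_less[OF assms(1), of i j] assms by (cases "i = j") auto

lemma nodes_pos: "nodes t N \<Longrightarrow> 0 < N"
  by (cases N) (auto simp: nodes_def)

lemma nodes_range: "nodes t N \<Longrightarrow> i \<le> N \<Longrightarrow> 0 \<le> t i \<and> t i \<le> 1"
  using nodes_le[of t N 0 i] nodes_le[of t N i N] by (auto simp: nodes_def)

lemma nodes_slot:
  assumes "nodes t N" "0 \<le> s" "s < 1"
  obtains j where "j < N" "t j \<le> s" "s < t (Suc j)"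
proof -
  define j where "j = (LEAST i. s < t i)"
  have "s < t N" using assms by (auto simp: nodes_def)
  then have 1: "s < t j" and 2: "j \<le> N"
    unfolding j_def by (rule LeastI, rule Least_le)
  have "j \<noteq> 0" using 1 assms by (auto simp: nodes_def intro: ccontr)
  then obtain i where i: "j = Suc i" by (cases j) auto
  have "\<not> s < t i" using not_less_Least[of i "\<lambda>i. s < t i"] i j_def by auto
  then show ?thesis using that[of i] 1 2 i by auto
qed

lemma nodes_slot_closed:
  assumes "nodes t N" "0 \<le> s" "s \<le> 1"
  obtains j where "j < N" "t j \<le> s" "s \<le> t (Suc j)"
proof (cases "s < 1")
  case True
  then show ?thesis using nodes_slot[OF assms(1,2)] that by (metis less_imp_le)
next
  case False
  then show ?thesis
    using that[of "N - 1"] nodes_pos[OF assms(1)] assms nodes_le[OF assms(1), of "N - 1" N]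
    by (auto simp: nodes_def)
qed

lemma nodes_step: "nodes t N \<Longrightarrow> j < N \<Longrightarrow> t j < t (Suc j)"
  by (auto simp: nodes_def)

lemma ramp_bounds: "0 \<le> ramp t j s" "ramp t j s \<le> 1"
  by (auto simp: ramp_def)

lemma ramp_mono: "t j < t (Suc j) \<Longrightarrow> s \<le> s' \<Longrightarrow> ramp t j s \<le> ramp t j s'"
  unfolding ramp_def by (intro max.mono min.mono order.refl divide_right_mono) auto

lemma ramp_zero: "t j < t (Suc j) \<Longrightarrow> s \<le> t j \<Longrightarrow> ramp t j s = 0"
  by (auto simp: ramp_def max_def min_def divide_simps)

lemma ramp_one: "t j < t (Suc j) \<Longrightarrow> t (Suc j) \<le> s \<Longrightarrow> ramp t j s = 1"
  by (auto simp: ramp_def max_def min_def divide_simps)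

lemma ramp_slot: "t j \<le> s \<Longrightarrow> s \<le> t (Suc j) \<Longrightarrow> ramp t j s = (s - t j) / (t (Suc j) - t j)"
  by (auto simp: ramp_def max_def min_def divide_simps)

lemma continuous_on_ramp: "t j < t (Suc j) \<Longrightarrow> continuous_on A (ramp t j)"
  unfolding ramp_def[abs_def] by (intro continuous_intros) auto

text \<open>Inside slot \<open>j\<close> the earlier ramps are saturated at 1 and the later ones
  still vanish.\<close>

lemma sum_ramp_slot:
  fixes w :: "nat \<Rightarrow> 'a::real_vector"
  assumes "nodes t N" "j < N" "t j \<le> s" "s \<le> t (Suc j)"
  shows "(\<Sum>i<N. ramp t i s *\<^sub>R w i) = (\<Sum>i<j. w i) + ((s - t j) / (t (Suc j) - t j)) *\<^sub>R w j"
proof -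
  have "{..<N} = {..<j} \<union> {j} \<union> {j<..<N}" using assms(2) by auto
  then have "(\<Sum>i<N. ramp t i s *\<^sub>R w i)
      = (\<Sum>i<j. ramp t i s *\<^sub>R w i) + ramp t j s *\<^sub>R w j + (\<Sum>i\<in>{j<..<N}. ramp t i s *\<^sub>R w i)"
    by (subst \<open>{..<N} = _\<close>, subst sum.union_disjoint, simp, simp, force)
       (subst sum.union_disjoint, auto)
  moreover have "ramp t i s = 1" if "i < j" for i
    using that assms nodes_le[OF assms(1), of "Suc i" j] by (intro ramp_one nodes_step[OF assms(1)]) auto
  moreover have "ramp t i s = 0" if "i \<in> {j<..<N}" for i
    using that assms nodes_le[OF assms(1), of "Suc j" i] by (intro ramp_zero nodes_step[OF assms(1)]) auto
  ultimately show ?thesis using assms by (simp add: ramp_slot)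
qed

lemma pw_linear_slot:
  assumes "nodes t N" "j < N" "t j \<le> s" "s \<le> t (Suc j)"
  shows "pw_linear t w N s = (\<Sum>i<j. w i) + ((s - t j) / (t (Suc j) - t j)) *\<^sub>R w j"
  using assms nodes_range[OF assms(1), of j] nodes_range[OF assms(1), of "Suc j"]
  by (auto simp: pw_linear_def sum_ramp_slot)

lemma pw_linear_node:
  assumes "nodes t N" "j \<le> N"
  shows "pw_linear t w N (t j) = (\<Sum>i<j. w i)"
proof (cases "j < N")
  case True
  then show ?thesis using assms nodes_step[OF assms(1) True] by (subst pw_linear_slot[of t N j]) auto
next
  case False
  then obtain i where i: "N = Suc i" "j = Suc i" using assms nodes_pos[OF assms(1)] by (cases N) auto
  then show ?thesis using assms nodes_step[OF assms(1), of i] by (subst pw_linear_slot[of t N i]) auto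
qed

text \<open>The identity is the polygon whose increments are the slot lengths;
  \<open>I_D_pw_linear_le\<close> needs this to add up overlaps of slots.\<close>

lemma sum_ramp_length:
  assumes "nodes t N" "s \<in> {0..1}"
  shows "(\<Sum>j<N. (t (Suc j) - t j) * ramp t j s) = s"
proof -
  obtain j where j: "j < N" "t j \<le> s" "s \<le> t (Suc j)"
    using nodes_slot_closed[OF assms(1), of s] assms by auto
  have "(\<Sum>i<N. ramp t i s *\<^sub>R (t (Suc i) - t i)) = s"
    using nodes_step[OF assms(1) j(1)] assms(1)
    by (subst sum_ramp_slot[OF assms(1) j]) (auto simp: sum_lessThan_telescope nodes_def)
  then show ?thesis by (simp add: mult.commute)
qed

lemma continuous_on_pw_linear:
  fixes w :: "nat \<Rightarrow> 'a::real_normed_vector"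
  assumes "nodes t N"
  shows "continuous_on {0..1} (pw_linear t w N)"
proof -
  have "continuous_on {0..1} (\<lambda>s. \<Sum>j<N. ramp t j s *\<^sub>R w j)"
    using nodes_step[OF assms] by (intro continuous_intros continuous_on_ramp) auto
  then show ?thesis by (rule continuous_on_eq) (simp add: pw_linear_def)
qed

lemma pw_linear_0: "nodes t N \<Longrightarrow> pw_linear t w N 0 = 0"
  using pw_linear_node[of t N 0 w] by (simp add: nodes_def)

lemma pw_linear_dist:
  fixes w w' :: "nat \<Rightarrow> 'a::real_normed_vector"
  shows "dist (pw_linear t w N s) (pw_linear t w' N s) \<le> (\<Sum>j<N. norm (w j - w' j))"
proof -
  have "norm (\<Sum>j<N. ramp t j s *\<^sub>R (w j - w' j)) \<le> (\<Sum>j<N. norm (w j - w' j))"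
    by (rule order_trans[OF norm_sum], intro sum_mono)
       (auto simp: ramp_bounds abs_of_nonneg intro!: mult_left_le_one_le)
  then show ?thesis
    by (auto simp: pw_linear_def dist_norm scaleR_diff_right sum_subtractf sum_nonneg)
qed

section \<open>Finite partitions as node sequences; integrals along polygons\<close>

lemma finite_set_nodes:
  assumes "finite P" "P \<subseteq> {0..1}" "0 \<in> P" "1 \<in> P"
  obtains t N where "nodes t N" "t ` {..N} = P"
proof -
  define l where "l = sorted_list_of_set P"
  have l: "sorted_wrt (<) l" "set l = P" using assms by (auto simp: l_def)
  have ne: "length l > 0" using l assms by (cases l) auto
  define N where "N = length l - 1"
  have im: "(\<lambda>i. l ! i) ` {..N} = P"
  proof -
    have "{..N} = {..<length l}" using ne by (auto simp: N_def simp flip: less_Suc_eq_le)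
    then show ?thesis using l(2) by (auto simp: set_conv_nth)
  qed
  have lt: "l ! i < l ! j" if "i < j" "j \<le> N" for i j
    using l(1) that ne by (auto simp: N_def sorted_wrt_iff_nth_less)
  have "0 \<in> (\<lambda>i. l ! i) ` {..N}" "1 \<in> (\<lambda>i. l ! i) ` {..N}" using im assms by simp_all
  then obtain i k where i: "i \<le> N" "l ! i = 0" and k: "k \<le> N" "l ! k = 1" by (auto simp: image_iff)
  have r: "l ! j \<in> {0..1}" if "j \<le> N" for j using that im assms(2) by blast
  have "i = 0" using lt[of 0 i] i r[of 0] by (cases i) auto
  moreover have "k = N" using lt[of k N] k r[of N] by (cases "k = N") auto
  ultimately have "nodes (\<lambda>i. l ! i) N" using i k lt by (auto simp: nodes_def)
  then show ?thesis using that im by blast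
qed

lemma partition_nodes:
  assumes "T \<in> partitions01"
  obtains t N where "nodes t N" "t ` {..N} = insert 0 (insert 1 T)"
  by (rule finite_set_nodes[of "insert 0 (insert 1 T)"])
     (use assms in \<open>auto simp: partitions01_def\<close>)

text \<open>Bridge from the \<open>Max\<close>/\<open>Min\<close> description of \<open>pl\<close>
  to increments; later computations with \<open>pl\<close> go through it.\<close>

lemma pl_eq_pw_linear:
  assumes t: "nodes t N" "t ` {..N} = insert 0 (insert 1 T)"
  shows "pl h T = pw_linear t (\<lambda>j. start0 h (t (Suc j)) - start0 h (t j)) N"
proof
  fix s :: real
  let ?w = "\<lambda>j. start0 h (t (Suc j)) - start0 h (t j)"
  have tel: "(\<Sum>i<j. ?w i) = start0 h (t j)" for j
    using t sum_lessThan_telescope[of "\<lambda>i. start0 h (t i)" j] by (simp add: nodes_def start0_def)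
  consider "s \<notin> {0..1}" | "s = 1" | "0 \<le> s" "s < 1" by fastforce
  then show "pl h T s = pw_linear t ?w N s"
  proof cases
    case 1
    then show ?thesis by (auto simp: pl_def pw_linear_def)
  next
    case 2
    have "t N = 1" using t by (simp add: nodes_def)
    then have "pw_linear t ?w N s = start0 h 1" using pw_linear_node[OF t(1), of N ?w] 2 tel by simp
    then show ?thesis using 2 by (simp add: pl_def start0_def)
  next
    case 3
    then obtain j where j: "j < N" "t j \<le> s" "s < t (Suc j)" using nodes_slot[OF t(1)] by blast
    let ?P = "insert 0 (insert 1 T)"
    have fin: "finite ?P" unfolding t(2)[symmetric] by simp
    have "Max {p\<in>?P. p \<le> s} = t j"
    proof (rule Max_eqI)
      show "finite {p\<in>?P. p \<le> s}" by (rule finite_subset[of _ "t ` {..N}"]) (unfold t(2), use fin in auto)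
      show "t j \<in> {p\<in>?P. p \<le> s}" unfolding t(2)[symmetric] using j by auto
      fix y assume "y \<in> {p\<in>?P. p \<le> s}"
      then obtain i where "i \<le> N" "y = t i" "t i \<le> s" unfolding t(2)[symmetric] by auto
      then show "y \<le> t j" using nodes_le[OF t(1), of "Suc j" i] nodes_le[OF t(1), of i j] j
        by (cases "i \<le> j") auto
    qed
    moreover have "Min {p\<in>?P. s < p} = t (Suc j)"
    proof (rule Min_eqI)
      show "finite {p\<in>?P. s < p}" by (rule finite_subset[of _ "t ` {..N}"]) (unfold t(2), use fin in auto)
      show "t (Suc j) \<in> {p\<in>?P. s < p}" unfolding t(2)[symmetric] using j by auto
      fix y assume "y \<in> {p\<in>?P. s < p}"
      then obtain i where "i \<le> N" "y = t i" "s < t i" unfolding t(2)[symmetric] by auto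
      then show "t (Suc j) \<le> y" using nodes_le[OF t(1), of "Suc j" i] nodes_le[OF t(1), of i j] j
        by (cases "i \<le> j") auto
    qed
    ultimately show ?thesis using 3 j tel[of j]
      by (simp add: pl_def Let_def pw_linear_slot[OF t(1), of j] start0_def)
  qed
qed

lemma pw_linear_has_vector_derivative:
  fixes w :: "nat \<Rightarrow> 'a::real_normed_vector"
  assumes "nodes t N" "j < N" "t j < s" "s < t (Suc j)"
  shows "(pw_linear t w N has_vector_derivative (w j /\<^sub>R (t (Suc j) - t j))) (at s)"
proof -
  let ?f = "\<lambda>s. (\<Sum>i<j. w i) + ((s - t j) / (t (Suc j) - t j)) *\<^sub>R w j"
  have "(?f has_vector_derivative (w j /\<^sub>R (t (Suc j) - t j))) (at s)"
    by (auto intro!: derivative_eq_intros simp: divide_inverse)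
  then show ?thesis
    by (rule has_vector_derivative_transform_within_open[of _ _ _ "{t j<..<t (Suc j)}"])
       (use assms in \<open>auto simp: pw_linear_slot\<close>)
qed

text \<open>Off the nodes the integrand is a step function, so \<open>\<Phi>\<close> can be any
  function. The instances are the norm, which gives the variation, and the rate, which gives the
  cost.\<close>

lemma nn_integral_pw_linear_deriv:
  fixes w :: "nat \<Rightarrow> 'a::real_normed_vector" and \<Phi> :: "'a \<Rightarrow> ennreal"
  assumes "nodes t N"
  shows "(\<integral>\<^sup>+ s\<in>{0..1}. \<Phi> (vector_derivative (pw_linear t w N) (at s)) \<partial>lborel)
       = (\<Sum>j<N. \<Phi> (w j /\<^sub>R (t (Suc j) - t j)) * ennreal (t (Suc j) - t j))"
proof -
  let ?c = "\<lambda>j. \<Phi> (w j /\<^sub>R (t (Suc j) - t j))"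
  \<comment> \<open>At a node the derivative may fail to exist and \<open>vector_derivative\<close>
    is then unspecified; the nodes form a null set.\<close>
  have "AE s in lborel. s \<notin> t ` {..N}"
    by (rule AE_not_in, rule finite_imp_null_set_lborel) auto
  then have "AE s in lborel. \<Phi> (vector_derivative (pw_linear t w N) (at s)) * indicator {0..1} s
      = (\<Sum>j<N. ?c j * indicator {t j<..<t (Suc j)} s)"
  proof eventually_elim
    case (elim s)
    show ?case
    proof (cases "s \<in> {0..1}")
      case True
      then obtain j where j: "j < N" "t j \<le> s" "s \<le> t (Suc j)"
        using nodes_slot_closed[OF assms, of s] by auto
      have "t j \<in> t ` {..N}" "t (Suc j) \<in> t ` {..N}" using j by auto
      then have s: "t j < s" "s < t (Suc j)" using elim j by (metis order.order_iff_strict)+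
      have "indicator {t i<..<t (Suc i)} s = (if i = j then 1 else 0 :: ennreal)" if "i < N" for i
        using s that j nodes_le[OF assms, of "Suc i" j] nodes_le[OF assms, of "Suc j" i]
        by (cases i j rule: linorder_cases) auto
      then have "(\<Sum>i<N. ?c i * indicator {t i<..<t (Suc i)} s) = (\<Sum>i<N. if i = j then ?c i else 0)"
        by (intro sum.cong) auto
      also have "\<dots> = ?c j" using j by simp
      finally show ?thesis
        using True vector_derivative_at[OF pw_linear_has_vector_derivative[OF assms j(1) s, of w]] by simp
    next
      case False
      have "s \<notin> {t j<..<t (Suc j)}" if "j < N" for j
        using False nodes_range[OF assms, of j] nodes_range[OF assms, of "Suc j"] that by auto
      then show ?thesis using False by simp
    qed
  qed
  then have "(\<integral>\<^sup>+ s\<in>{0..1}. \<Phi> (vector_derivative (pw_linear t w N) (at s)) \<partial>lborel)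
      = (\<integral>\<^sup>+ s. (\<Sum>j<N. ?c j * indicator {t j<..<t (Suc j)} s) \<partial>lborel)"
    by (rule nn_integral_cong_AE)
  also have "\<dots> = (\<Sum>j<N. ?c j * ennreal (t (Suc j) - t j))"
    by (subst nn_integral_sum) (use assms in \<open>auto simp: nn_integral_cmult nodes_def intro!: sum.cong\<close>)
  finally show ?thesis .
qed

lemma var_pw_linear:
  fixes w :: "nat \<Rightarrow> 'a::real_normed_vector"
  assumes "nodes t N"
  shows "(\<integral>\<^sup>+ s\<in>{0..1}. ennreal (norm (vector_derivative (pw_linear t w N) (at s))) \<partial>lborel)
       = ennreal (\<Sum>j<N. norm (w j))"
proof -
  have "ennreal (norm (w j /\<^sub>R (t (Suc j) - t j))) * ennreal (t (Suc j) - t j) = ennreal (norm (w j))"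
    if "j < N" for j
    using nodes_step[OF assms that] by (simp add: ennreal_mult[symmetric] divide_simps)
  then show ?thesis
    by (subst nn_integral_pw_linear_deriv[OF assms], subst sum_ennreal[symmetric]) auto
qed

text \<open>\<open>v\<close> acts as a cumulative variation: its increments telescope over any
  partition. The hypothesis \<open>start\<close> pays for the jump at time 0, where
  \<open>start0\<close> replaces \<open>h 0\<close> by 0.\<close>

lemma var01_le:
  fixes h :: "real \<Rightarrow> 'a::euclidean_space"
  assumes inc: "\<And>a b. 0 \<le> a \<Longrightarrow> a \<le> b \<Longrightarrow> b \<le> 1 \<Longrightarrow> norm (h b - h a) \<le> v b - v a"
    and start: "\<And>b. 0 \<le> b \<Longrightarrow> b \<le> 1 \<Longrightarrow> norm (h b) \<le> v b"
  shows "var01 h \<le> ennreal (v 1)"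
  unfolding var01_def
proof (rule SUP_least)
  fix T assume "T \<in> partitions01"
  then obtain t N where t: "nodes t N" "t ` {..N} = insert 0 (insert 1 T)" using partition_nodes by blast
  let ?w = "\<lambda>j. start0 h (t (Suc j)) - start0 h (t j)"
  have "(\<Sum>j<N. norm (?w j)) \<le> (\<Sum>j<N. start0 v (t (Suc j)) - start0 v (t j))"
  proof (rule sum_mono)
    fix j assume "j \<in> {..<N}"
    then have j: "j < N" by simp
    have "0 \<le> t j" "t j < t (Suc j)" "t (Suc j) \<le> 1"
      using nodes_range[OF t(1), of j] nodes_range[OF t(1), of "Suc j"] nodes_step[OF t(1)] j by auto
    then show "norm (?w j) \<le> start0 v (t (Suc j)) - start0 v (t j)"
      using inc[of "t j" "t (Suc j)"] start[of "t (Suc j)"] by (auto simp: start0_def)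
  qed
  also have "\<dots> = v 1"
    using t(1) sum_lessThan_telescope[of "\<lambda>i. start0 v (t i)" N] by (simp add: nodes_def start0_def)
  finally show "(\<integral>\<^sup>+ s\<in>{0..1}. ennreal (norm (vector_derivative (pl h T) (at s))) \<partial>lborel) \<le> ennreal (v 1)"
    unfolding pl_eq_pw_linear[OF t] var_pw_linear[OF t(1)] by (rule ennreal_leI)
qed

lemma D01_I:
  fixes h :: "real \<Rightarrow> 'a::euclidean_space"
  assumes "continuous_on {0..1} h" "\<And>s. s \<notin> {0..1} \<Longrightarrow> h s = 0"
  shows "h \<in> D01"
proof -
  have R: "continuous (at_right t) h" if "t \<in> {0..<1}" for t
  proof -
    have "(h \<longlongrightarrow> h t) (at t within {t..1})"
      using continuous_on_subset[OF assms(1), of "{t..1}"] that by (auto simp: continuous_on_def)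
    then show ?thesis using that by (simp add: continuous_within at_within_Icc_at_right)
  qed
  have L: "(h \<longlongrightarrow> h t) (at_left t)" if "t \<in> {0<..1}" for t
  proof -
    have "(h \<longlongrightarrow> h t) (at t within {0..t})"
      using continuous_on_subset[OF assms(1), of "{0..t}"] that by (auto simp: continuous_on_def)
    then show ?thesis using that by (simp add: at_within_Icc_at_left)
  qed
  show ?thesis using R L assms(2) unfolding D01_def by blast
qed

lemma pw_linear_D01: "nodes t N \<Longrightarrow> pw_linear t w N \<in> D01"
  for w :: "nat \<Rightarrow> 'a::euclidean_space"
  by (rule D01_I[OF continuous_on_pw_linear]) (auto simp: pw_linear_def)

text \<open>The majorant for \<open>var01_le\<close> is the polygon with the same nodes and the
  increments \<open>norm (w j)\<close>.\<close>

lemma var01_pw_linear_le: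
  fixes w :: "nat \<Rightarrow> 'a::euclidean_space"
  assumes "nodes t N"
  shows "var01 (pw_linear t w N) \<le> ennreal (\<Sum>j<N. norm (w j))"
proof -
  let ?v = "\<lambda>s. \<Sum>j<N. ramp t j s * norm (w j)"
  have one: "?v 1 = (\<Sum>j<N. norm (w j))"
    using nodes_range[OF assms] by (intro sum.cong) (auto simp: ramp_one nodes_step[OF assms])
  have "var01 (pw_linear t w N) \<le> ennreal (?v 1)"
  proof (rule var01_le)
    fix a b :: real assume ab: "0 \<le> a" "a \<le> b" "b \<le> 1"
    have "norm (\<Sum>j<N. (ramp t j b - ramp t j a) *\<^sub>R w j) \<le> (\<Sum>j<N. (ramp t j b - ramp t j a) * norm (w j))"
      using ab ramp_mono[of t _ a b] nodes_step[OF assms]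
      by (intro order_trans[OF norm_sum] sum_mono) auto
    then show "norm (pw_linear t w N b - pw_linear t w N a) \<le> ?v b - ?v a"
      using ab by (simp add: pw_linear_def sum_subtractf algebra_simps)
  next
    fix b :: real assume "0 \<le> b" "b \<le> 1"
    then show "norm (pw_linear t w N b) \<le> ?v b"
      by (auto simp: pw_linear_def ramp_bounds intro!: order_trans[OF norm_sum] sum_mono)
  qed
  then show ?thesis unfolding one .
qed

lemma pw_linear_BV01: "nodes t N \<Longrightarrow> pw_linear t w N \<in> BV01"
  for w :: "nat \<Rightarrow> 'a::euclidean_space"
  unfolding BV01_def using pw_linear_D01 var01_pw_linear_le[of t N w]
  by (auto simp: ennreal_less_top intro: le_less_trans)

lemma pl_BV01: "T \<in> partitions01 \<Longrightarrow> pl h T \<in> BV01"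
  for h :: "real \<Rightarrow> 'a::euclidean_space"
  using partition_nodes[of T] pl_eq_pw_linear[of _ _ T h] pw_linear_BV01 by metis

section \<open>The rate function in dual form, and the cost of polygons\<close>

definition log_mgf :: "'b measure \<Rightarrow> ('b \<Rightarrow> 'a::euclidean_space) \<Rightarrow> 'a \<Rightarrow> real" where
  "log_mgf M Y u = ln (enn2real (\<integral>\<^sup>+\<omega>. ennreal (exp (u \<bullet> Y \<omega>)) \<partial>M))"

text \<open>Outside \<open>Laplace_dom\<close> the cumulant is infinite and its term in the supremum
  is minus infinity, so only real inequalities over the domain remain.\<close>

lemma rate_I_le_iff:
  "rate_I M Y v \<le> ereal c \<longleftrightarrow> (\<forall>u\<in>Laplace_dom M Y. u \<bullet> v - log_mgf M Y u \<le> c)"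
  unfolding rate_I_def SUP_le_iff by (auto simp: cumulant_def log_mgf_def)

lemma rate_I_ge:
  "u \<in> Laplace_dom M Y \<Longrightarrow> ereal (u \<bullet> v - log_mgf M Y u) \<le> rate_I M Y v"
  unfolding rate_I_def by (rule SUP_upper2[of u]) (auto simp: cumulant_def log_mgf_def)

lemma e2ennreal_rate_I_le:
  assumes "\<And>u. u \<in> Laplace_dom M Y \<Longrightarrow> u \<bullet> v - log_mgf M Y u \<le> c"
  shows "e2ennreal (rate_I M Y v) \<le> ennreal c"
proof -
  have "rate_I M Y v \<le> ereal c" using assms by (simp add: rate_I_le_iff)
  then show ?thesis using e2ennreal_mono by (fastforce simp: ennreal.abs_eq)
qed

text \<open>\<open>e2ennreal\<close> cuts negative values to 0, which can only raise the rate, so a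
  bound on the truncated value still bounds every dual term.\<close>

lemma e2ennreal_rate_I_ge:
  assumes "u \<in> Laplace_dom M Y" "e2ennreal (rate_I M Y v) = ennreal c" "0 \<le> c"
  shows "u \<bullet> v - log_mgf M Y u \<le> c"
proof -
  have "rate_I M Y v \<le> enn2ereal (e2ennreal (rate_I M Y v))"
    by (cases "0 \<le> rate_I M Y v") (auto simp: enn2ereal_e2ennreal e2ennreal_neg zero_ennreal.rep_eq)
  also have "\<dots> = ereal c" using assms by simp
  finally show ?thesis using assms rate_I_le_iff by blast
qed

definition pw_cost ::
  "'b measure \<Rightarrow> ('b \<Rightarrow> 'a::euclidean_space) \<Rightarrow> (nat \<Rightarrow> real) \<Rightarrow> (nat \<Rightarrow> 'a) \<Rightarrow> nat \<Rightarrow> ennreal" where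
  "pw_cost M Y t w N =
     (\<Sum>j<N. e2ennreal (rate_I M Y (w j /\<^sub>R (t (Suc j) - t j))) * ennreal (t (Suc j) - t j))"

lemma pw_cost_le_I_D:
  fixes h :: "real \<Rightarrow> 'a::euclidean_space"
  assumes "T \<in> partitions01" "nodes t N" "t ` {..N} = insert 0 (insert 1 T)"
  shows "pw_cost M Y t (\<lambda>j. start0 h (t (Suc j)) - start0 h (t j)) N \<le> I_D M Y h"
  unfolding I_D_def pw_cost_def
  by (rule SUP_upper2[OF assms(1)])
     (simp add: pl_eq_pw_linear[OF assms(2,3)]
       nn_integral_pw_linear_deriv[OF assms(2), where \<Phi> = "\<lambda>v. e2ennreal (rate_I M Y v)"])

text \<open>Jensen's inequality: the rate is convex, so no other partition sees a larger cost than
  the polygon's own nodes. Convexity enters in dual form: for each \<open>u\<close> the affine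
  bounds of the slots are averaged with weights \<open>\<Lambda> j k / D k\<close>, and the supremum
  over \<open>u\<close> is taken afterwards.\<close>

lemma I_D_pw_linear_le:
  fixes w :: "nat \<Rightarrow> 'a::euclidean_space"
  assumes t: "nodes t N"
  shows "I_D M Y (pw_linear t w N) \<le> pw_cost M Y t w N"
proof (cases "pw_cost M Y t w N = \<infinity>")
  case False
  define d where "d j = t (Suc j) - t j" for j
  define J where "J j = e2ennreal (rate_I M Y (w j /\<^sub>R d j))" for j
  define i where "i j = enn2real (J j)" for j
  have d: "d j > 0" if "j < N" for j using nodes_step[OF t that] by (simp add: d_def)
  have J: "J j = ennreal (i j)" if "j < N" for j
  proof -
    have "J j * ennreal (d j) \<noteq> \<infinity>"
      using False that unfolding pw_cost_def J_def d_def by auto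
    then have "J j < \<infinity>" using d[OF that] by (auto simp: ennreal_mult_eq_top_iff less_top)
    then show ?thesis by (simp add: i_def)
  qed
  have i0: "0 \<le> i j" for j by (simp add: i_def)
  have dual: "u \<bullet> (w j /\<^sub>R d j) - log_mgf M Y u \<le> i j" if "u \<in> Laplace_dom M Y" "j < N" for u j
    by (rule e2ennreal_rate_I_ge[OF that(1) _ i0]) (use J[OF that(2)] in \<open>simp add: J_def\<close>)
  have cost: "pw_cost M Y t w N = ennreal (\<Sum>j<N. i j * d j)"
  proof -
    have "pw_cost M Y t w N = (\<Sum>j<N. ennreal (i j * d j))"
      unfolding pw_cost_def using J d i0 by (intro sum.cong) (auto simp: J_def d_def ennreal_mult less_imp_le)
    moreover have "(\<Sum>j<N. ennreal (i j * d j)) = ennreal (\<Sum>j<N. i j * d j)"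
      using d i0 by (intro sum_ennreal) (simp add: less_imp_le)
    ultimately show ?thesis by simp
  qed
  show ?thesis unfolding I_D_def
  proof (rule SUP_least)
    fix T assume "T \<in> partitions01"
    then obtain r R where r: "nodes r R" "r ` {..R} = insert 0 (insert 1 T)" using partition_nodes by blast
    let ?g = "pw_linear t w N"
    \<comment> \<open>Length of the overlap of slot \<open>j\<close> of the polygon with slot
      \<open>k\<close> of the test partition.\<close>
    define \<Lambda> where "\<Lambda> j k = d j * (ramp t j (r (Suc k)) - ramp t j (r k))" for j k
    define D where "D k = r (Suc k) - r k" for k
    define W where "W k = start0 ?g (r (Suc k)) - start0 ?g (r k)" for k
    have st: "start0 ?g = ?g" using pw_linear_0[OF t, of w] by (auto simp: start0_def fun_eq_iff)
    have \<Lambda>0: "0 \<le> \<Lambda> j k" if "j < N" "k < R" for j k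
      using d[OF that(1)] ramp_mono[OF nodes_step[OF t that(1)], of "r k" "r (Suc k)"] nodes_step[OF r(1) that(2)]
      by (simp add: \<Lambda>_def)
    have rk: "r k \<in> {0..1}" "r (Suc k) \<in> {0..1}" if "k < R" for k
      using nodes_range[OF r(1), of k] nodes_range[OF r(1), of "Suc k"] that by auto
    have sumj: "(\<Sum>j<N. \<Lambda> j k) = D k" if "k < R" for k
      using sum_ramp_length[OF t] rk[OF that]
      by (simp add: \<Lambda>_def D_def d_def right_diff_distrib sum_subtractf)
    have sumk: "(\<Sum>k<R. \<Lambda> j k) = d j" if "j < N" for j
    proof -
      have "(\<Sum>k<R. \<Lambda> j k) = d j * (ramp t j (r R) - ramp t j (r 0))"
        using sum_lessThan_telescope[of "\<lambda>k. ramp t j (r k)" R]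
        by (simp add: \<Lambda>_def sum_distrib_left[symmetric])
      moreover have "ramp t j (r R) = 1" "ramp t j (r 0) = 0"
        using r(1) nodes_range[OF t, of j] nodes_range[OF t, of "Suc j"] that
        by (auto simp: nodes_def intro!: ramp_one ramp_zero nodes_step[OF t])
      ultimately show ?thesis by simp
    qed
    have W: "W k = (\<Sum>j<N. \<Lambda> j k *\<^sub>R (w j /\<^sub>R d j))" if "k < R" for k
    proof -
      have "W k = (\<Sum>j<N. (ramp t j (r (Suc k)) - ramp t j (r k)) *\<^sub>R w j)"
        unfolding W_def st using rk[OF that]
        by (simp add: pw_linear_def scaleR_diff_left sum_subtractf)
      moreover have "d j * inverse (d j) = 1" if "j < N" for j using d[OF that] by simp
      ultimately show ?thesis by (auto simp: \<Lambda>_def mult.assoc intro!: sum.cong)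
    qed
    have "e2ennreal (rate_I M Y (W k /\<^sub>R D k)) * ennreal (D k) \<le> ennreal (\<Sum>j<N. \<Lambda> j k * i j)" if k: "k < R" for k
    proof -
      have Dk: "D k > 0" using nodes_step[OF r(1) k] by (simp add: D_def)
      have "e2ennreal (rate_I M Y (W k /\<^sub>R D k)) \<le> ennreal ((\<Sum>j<N. \<Lambda> j k * i j) / D k)"
      proof (rule e2ennreal_rate_I_le)
        fix u assume u: "u \<in> Laplace_dom M Y"
        have "D k * (u \<bullet> (W k /\<^sub>R D k) - log_mgf M Y u) = u \<bullet> W k - D k * log_mgf M Y u"
          using Dk by (simp add: right_diff_distrib)
        also have "\<dots> = (\<Sum>j<N. \<Lambda> j k * (u \<bullet> (w j /\<^sub>R d j) - log_mgf M Y u))"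
          unfolding sumj[OF k, symmetric] W[OF k]
          by (simp add: inner_sum_right right_diff_distrib sum_subtractf sum_distrib_right mult.assoc)
        also have "\<dots> \<le> (\<Sum>j<N. \<Lambda> j k * i j)"
          using \<Lambda>0[OF _ k] dual[OF u] by (intro sum_mono mult_left_mono) auto
        finally show "u \<bullet> (W k /\<^sub>R D k) - log_mgf M Y u \<le> (\<Sum>j<N. \<Lambda> j k * i j) / D k"
          using Dk by (simp add: pos_le_divide_eq mult.commute)
      qed
      then have "e2ennreal (rate_I M Y (W k /\<^sub>R D k)) * ennreal (D k)
          \<le> ennreal ((\<Sum>j<N. \<Lambda> j k * i j) / D k) * ennreal (D k)" by (rule mult_right_mono) simp
      also have "\<dots> = ennreal (\<Sum>j<N. \<Lambda> j k * i j)"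
        using Dk \<Lambda>0[OF _ k] i0 by (subst ennreal_mult[symmetric]) (auto intro!: divide_nonneg_pos sum_nonneg)
      finally show ?thesis .
    qed
    then have "(\<Sum>k<R. e2ennreal (rate_I M Y (W k /\<^sub>R D k)) * ennreal (D k))
        \<le> (\<Sum>k<R. ennreal (\<Sum>j<N. \<Lambda> j k * i j))" by (intro sum_mono) auto
    also have "\<dots> = ennreal (\<Sum>k<R. \<Sum>j<N. \<Lambda> j k * i j)"
      using \<Lambda>0 i0 by (intro sum_ennreal) (auto intro!: sum_nonneg)
    also have "(\<Sum>k<R. \<Sum>j<N. \<Lambda> j k * i j) = (\<Sum>j<N. i j * d j)"
      by (subst sum.swap) (auto simp: sumk[symmetric] sum_distrib_left mult.commute intro!: sum.cong)
    finally show "(\<integral>\<^sup>+ s\<in>{0..1}. e2ennreal (rate_I M Y (vector_derivative (pl ?g T) (at s))) \<partial>lborel)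
        \<le> pw_cost M Y t w N"
      unfolding pl_eq_pw_linear[OF r]
        nn_integral_pw_linear_deriv[OF r(1), where \<Phi> = "\<lambda>v. e2ennreal (rate_I M Y v)"]
        cost W_def D_def .
  qed
qed simp

section \<open>The random polygon and the merging of consecutive steps\<close>

lemma uniform_nodes: "0 < n \<Longrightarrow> nodes (\<lambda>j. real j / real n) n"
  by (auto simp: nodes_def divide_strict_right_mono)

lemma poly_path_eq_pw_linear:
  assumes "0 < n"
  shows "poly_path X n \<omega> = pw_linear (\<lambda>j. real j / real n) (\<lambda>j. X j \<omega> /\<^sub>R real n) n"
proof
  fix s :: real
  show "poly_path X n \<omega> s = pw_linear (\<lambda>j. real j / real n) (\<lambda>j. X j \<omega> /\<^sub>R real n) n s"
  proof (cases "s \<in> {0..1}")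
    case False
    then show ?thesis by (auto simp: poly_path_def pw_linear_def)
  next
    case True
    define k where "k = nat \<lfloor>real n * s\<rfloor>"
    have f: "real k = of_int \<lfloor>real n * s\<rfloor>" using True by (simp add: k_def)
    have k: "real k \<le> real n * s" "real n * s < real k + 1" unfolding f by linarith+
    have lhs: "poly_path X n \<omega> s =
        (1 / real n) *\<^sub>R (Ssum X k \<omega> + (real n * s - real k) *\<^sub>R X k \<omega>)"
      unfolding poly_path_def f using True by (simp add: k_def)
    have Ss: "(\<Sum>i<k. X i \<omega> /\<^sub>R real n) = (1 / real n) *\<^sub>R Ssum X k \<omega>"
      by (simp add: Ssum_def scaleR_sum_right divide_inverse)
    show ?thesis
    proof (cases "k < n")
      case kn: True
      have 1: "real k / real n \<le> s" "s \<le> real (Suc k) / real n"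
        using k assms by (auto simp: field_simps)
      have 2: "(s - real k / real n) / (real (Suc k) / real n - real k / real n) = real n * s - real k"
        using assms by (simp add: field_simps)
      show ?thesis unfolding lhs pw_linear_slot[OF uniform_nodes[OF assms] kn 1] 2 Ss
        by (simp add: scaleR_add_right divide_inverse)
    next
      case kn: False
      \<comment> \<open>Here \<open>s = 1\<close> and \<open>k = n\<close>: \<open>poly_path\<close>
        then mentions the extra step \<open>X n\<close>, but with coefficient 0.\<close>
      have "real n * s \<le> real n * 1" using True by (intro mult_left_mono) auto
      then have "real k = real n * s" "k = n" using k kn by linarith+
      then have s1: "s = real n / real n" using assms by simp
      show ?thesis unfolding lhs
        using \<open>k = n\<close> \<open>real k = real n * s\<close> Ss pw_linear_node[OF uniform_nodes[OF assms], of n "\<lambda>j. X j \<omega> /\<^sub>R real n"]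
        unfolding s1[symmetric] by simp
    qed
  qed
qed

lemma nodes_slot_between:
  fixes t :: "nat \<Rightarrow> real"
  assumes "a < b" "t a \<le> s" "s \<le> t b"
  obtains i where "a \<le> i" "i < b" "t i \<le> s" "s \<le> t (Suc i)"
  using assms
proof (induction b arbitrary: thesis)
  case (Suc b)
  show ?case
  proof (cases "a < b \<and> s \<le> t b")
    case True
    then show ?thesis using Suc by (metis less_SucI)
  next
    case False
    then show ?thesis using Suc.prems by (intro Suc.prems(1)[of b]) (auto simp: less_Suc_eq)
  qed
qed simp

definition grouping :: "(nat \<Rightarrow> nat) \<Rightarrow> nat \<Rightarrow> nat \<Rightarrow> bool" where
  "grouping k m N \<longleftrightarrow> k 0 = 0 \<and> k m = N \<and> (\<forall>j<m. k j < k (Suc j))"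

definition groupsum :: "(nat \<Rightarrow> 'a::comm_monoid_add) \<Rightarrow> (nat \<Rightarrow> nat) \<Rightarrow> nat \<Rightarrow> 'a" where
  "groupsum w k j = (\<Sum>i\<in>{k j..<k (Suc j)}. w i)"

lemma grouping_le:
  assumes "grouping k m N" "i \<le> j" "j \<le> m"
  shows "k i \<le> k j"
  using assms(2,3)
proof (induction j)
  case (Suc j)
  have "k j < k (Suc j)" using assms(1) Suc.prems by (auto simp: grouping_def)
  then show ?case using Suc by (cases "i = Suc j") auto
qed simp

lemma groupsum_partial:
  fixes w :: "nat \<Rightarrow> 'a::ab_group_add"
  assumes "grouping k m N" "j \<le> m"
  shows "(\<Sum>i<j. groupsum w k i) = (\<Sum>i<k j. w i)"
  using assms(2)
proof (induction j)
  case (Suc j)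
  have "k j < k (Suc j)" using assms(1) Suc.prems by (auto simp: grouping_def)
  then have "(\<Sum>i<k (Suc j). w i) = (\<Sum>i<k j. w i) + groupsum w k j"
    unfolding groupsum_def lessThan_atLeast0 by (simp add: sum.atLeastLessThan_concat)
  then show ?case using Suc by simp
qed (use assms in \<open>simp add: grouping_def\<close>)

lemma grouping_nodes:
  assumes "nodes t N" "grouping k m N"
  shows "nodes (t \<circ> k) m"
  unfolding nodes_def
proof (intro conjI allI impI)
  fix j assume "j < m"
  then show "(t \<circ> k) j < (t \<circ> k) (Suc j)"
    using assms grouping_le[OF assms(2), of "Suc j" m]
    by (auto simp: grouping_def intro!: nodes_less[OF assms(1)])
qed (use assms in \<open>auto simp: nodes_def grouping_def\<close>)

text \<open>Greedy from the right: take the longest tail of weight at most \<open>\<delta>\<close>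
  as one group and the step \<open>p\<close> just before it as a group of its own. Together they
  weigh more than \<open>\<delta>\<close>, so every two groups use up \<open>\<delta>\<close> of the
  total, whence the factor 2. A large step is never merged with others.\<close>

lemma grouping_exists:
  fixes a :: "nat \<Rightarrow> real"
  assumes "\<delta> > 0" "\<And>i. 0 \<le> a i"
  shows "\<exists>k m. grouping k m N \<and> real m * \<delta> \<le> 2 * (\<Sum>i<N. a i) + \<delta>
           \<and> (\<forall>j<m. k (Suc j) = Suc (k j) \<or> groupsum a k j \<le> \<delta>)"
proof (induction N rule: less_induct)
  case (less N)
  consider "N = 0" | "0 < N" "(\<Sum>i<N. a i) \<le> \<delta>" | "(\<Sum>i<N. a i) > \<delta>" by linarith
  then show ?case
  proof cases
    case 1
    then show ?thesis using assms by (intro exI[of _ "\<lambda>_. 0"] exI[of _ 0]) (auto simp: grouping_def)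
  next
    case 2
    have "0 \<le> (\<Sum>i<N. a i)" using assms by (intro sum_nonneg) auto
    then show ?thesis using 2 assms
      by (intro exI[of _ "\<lambda>j. if j = 0 then 0 else N"] exI[of _ 1])
         (auto simp: grouping_def groupsum_def lessThan_atLeast0)
  next
    case 3
    define m where "m = (LEAST m. (\<Sum>i\<in>{m..<N}. a i) \<le> \<delta>)"
    have "(\<Sum>i\<in>{N..<N}. a i) \<le> \<delta>" using assms by simp
    then have m: "(\<Sum>i\<in>{m..<N}. a i) \<le> \<delta>" and mN: "m \<le> N"
      unfolding m_def by (rule LeastI, rule Least_le)
    have "m \<noteq> 0" using m 3 by (auto simp: lessThan_atLeast0 intro: ccontr)
    then obtain p where p: "m = Suc p" by (cases m) auto
    have gt: "(\<Sum>i\<in>{p..<N}. a i) > \<delta>"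
      using not_less_Least[of p "\<lambda>m. (\<Sum>i\<in>{m..<N}. a i) \<le> \<delta>"] p m_def by auto
    have split: "(\<Sum>i<N. a i) = (\<Sum>i<p. a i) + (\<Sum>i\<in>{p..<N}. a i)"
      unfolding lessThan_atLeast0 using p mN by (simp add: sum.atLeastLessThan_concat)
    have "p < N" using p mN by simp
    from less[OF this] obtain k q where k: "grouping k q p" "real q * \<delta> \<le> 2 * (\<Sum>i<p. a i) + \<delta>"
      "\<And>j. j < q \<Longrightarrow> k (Suc j) = Suc (k j) \<or> groupsum a k j \<le> \<delta>" by blast
    have kq: "k q = p" "k 0 = 0" using k by (auto simp: grouping_def)
    define k' where "k' j = (if j \<le> q then k j else if j = Suc q then m else N)" for j
    have st: "groupsum a k' j = groupsum a k j" if "j < q" for j using that by (auto simp: groupsum_def k'_def)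
    show ?thesis
    \<comment> \<open>If the last step alone exceeds \<open>\<delta>\<close>, the tail is empty;
      groups must be nonempty, so only one group is added.\<close>
    proof (cases "m = N")
      case True
      have "grouping k' (Suc q) N" using k(1) kq p True
        by (auto simp: grouping_def k'_def less_Suc_eq)
      moreover have "k' (Suc j) = Suc (k' j) \<or> groupsum a k' j \<le> \<delta>" if "j < Suc q" for j
        using k(3)[of j] that kq p by (cases "j = q") (auto simp: k'_def st)
      moreover have "real (Suc q) * \<delta> \<le> 2 * (\<Sum>i<N. a i) + \<delta>"
        using k(2) gt split assms by (simp add: algebra_simps)
      ultimately show ?thesis by blast
    next
      case False
      have "grouping k' (Suc (Suc q)) N" using k(1) kq p False mN
        by (auto simp: grouping_def k'_def less_Suc_eq)
      moreover have "k' (Suc j) = Suc (k' j) \<or> groupsum a k' j \<le> \<delta>" if jq: "j < Suc (Suc q)" for j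
      proof -
        consider "j < q" | "j = q" | "j = Suc q" using jq by linarith
        then show ?thesis
          by cases (use k(3)[of j] kq p m in \<open>auto simp: k'_def st groupsum_def\<close>)
      qed
      moreover have "real (Suc (Suc q)) * \<delta> \<le> 2 * (\<Sum>i<N. a i) + \<delta>"
        using k(2) gt split assms by (simp add: algebra_simps)
      ultimately show ?thesis by blast
    qed
  qed
qed

lemma norm_groupsum_le: "norm (groupsum w k j) \<le> groupsum (\<lambda>i. norm (w i)) k j"
  unfolding groupsum_def by (rule norm_sum)

text \<open>Over a group with a single step the two polygons coincide; over a light group each of
  them stays within \<open>\<delta>\<close> of the common value at the start of the group.\<close>

lemma pw_linear_coarse_dist:
  fixes w :: "nat \<Rightarrow> 'a::real_normed_vector"
  assumes t: "nodes t N" and k: "grouping k m N"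
    and small: "\<And>j. j < m \<Longrightarrow> k (Suc j) = Suc (k j) \<or> groupsum (\<lambda>i. norm (w i)) k j \<le> \<delta>"
    and "0 \<le> \<delta>"
  shows "dist (pw_linear t w N s) (pw_linear (t \<circ> k) (groupsum w k) m s) \<le> 2 * \<delta>"
proof (cases "s \<in> {0..1}")
  case False
  then show ?thesis using assms(4) by (auto simp: pw_linear_def)
next
  case True
  have tk: "nodes (t \<circ> k) m" by (rule grouping_nodes[OF t k])
  obtain j where j: "j < m" "t (k j) \<le> s" "s \<le> t (k (Suc j))"
    using nodes_slot_closed[OF tk, of s] True by auto
  have kj: "k j < k (Suc j)" "k (Suc j) \<le> N"
    using k j grouping_le[OF k, of "Suc j" m] by (auto simp: grouping_def)
  obtain i where i: "k j \<le> i" "i < k (Suc j)" "t i \<le> s" "s \<le> t (Suc i)"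
    using nodes_slot_between[OF kj(1) j(2,3)] by blast
  define c where "c = (s - t i) / (t (Suc i) - t i)"
  define c' where "c' = (s - t (k j)) / (t (k (Suc j)) - t (k j))"
  have c: "0 \<le> c" "c \<le> 1" "0 \<le> c'" "c' \<le> 1"
    using i j nodes_less[OF t kj] nodes_step[OF t, of i] kj by (auto simp: c_def c'_def divide_simps)
  have g: "pw_linear t w N s = (\<Sum>l<i. w l) + c *\<^sub>R w i"
    using i kj by (subst pw_linear_slot[OF t, of i]) (auto simp: c_def)
  have g': "pw_linear (t \<circ> k) (groupsum w k) m s = (\<Sum>l<k j. w l) + c' *\<^sub>R groupsum w k j"
    using j groupsum_partial[OF k, of j w] by (subst pw_linear_slot[OF tk, of j]) (auto simp: c'_def)
  have sp: "(\<Sum>l<i. w l) = (\<Sum>l<k j. w l) + (\<Sum>l\<in>{k j..<i}. w l)"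
    unfolding lessThan_atLeast0 using i by (simp add: sum.atLeastLessThan_concat)
  from small[OF j(1)] show ?thesis
  proof
    assume s1: "k (Suc j) = Suc (k j)"
    then have ij: "i = k j" using i by simp
    have "c = c'" by (simp add: c_def c'_def s1 ij)
    moreover have "groupsum w k j = w (k j)" by (simp add: groupsum_def s1)
    ultimately show ?thesis unfolding g g' using assms(4) by (simp add: ij)
  next
    assume sm: "groupsum (\<lambda>i. norm (w i)) k j \<le> \<delta>"
    have "norm ((\<Sum>l\<in>{k j..<i}. w l) + c *\<^sub>R w i) \<le> (\<Sum>l\<in>{k j..<i}. norm (w l)) + norm (w i)"
      using c by (intro order_trans[OF norm_triangle_ineq] add_mono norm_sum) (auto intro: mult_left_le_one_le)
    also have "\<dots> = (\<Sum>l\<in>{k j..<Suc i}. norm (w l))" using i by simp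
    also have "\<dots> \<le> groupsum (\<lambda>i. norm (w i)) k j"
      unfolding groupsum_def using i by (intro sum_mono2) auto
    finally have 1: "norm ((\<Sum>l\<in>{k j..<i}. w l) + c *\<^sub>R w i) \<le> \<delta>" using sm by simp
    have "norm (c' *\<^sub>R groupsum w k j) \<le> norm (groupsum w k j)"
      using c by (auto intro: mult_left_le_one_le)
    then have 2: "norm (c' *\<^sub>R groupsum w k j) \<le> \<delta>" using sm norm_groupsum_le[of w k j] by linarith
    have "pw_linear t w N s - pw_linear (t \<circ> k) (groupsum w k) m s
        = ((\<Sum>l\<in>{k j..<i}. w l) + c *\<^sub>R w i) - c' *\<^sub>R groupsum w k j"
      unfolding g g' sp by simp
    then show ?thesis using norm_triangle_ineq4[of "(\<Sum>l\<in>{k j..<i}. w l) + c *\<^sub>R w i" "c' *\<^sub>R groupsum w k j"] 1 2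
      by (simp add: dist_norm)
  qed
qed

section \<open>Parametrizations of completed graphs\<close>

text \<open>Such a time change may stall. \<open>rho1'_jump_windows\<close> relies on this at nodes
  where the path does not jump: there the clock interval assigned to a whole window is a single
  point.\<close>

definition reparam :: "(real \<Rightarrow> real) \<Rightarrow> bool" where
  "reparam \<tau> \<longleftrightarrow> continuous_on {0..1} \<tau> \<and> mono_on {0..1} \<tau> \<and> \<tau> 0 = 0 \<and> \<tau> 1 = 1"

lemma reparam_range: "reparam \<tau> \<Longrightarrow> s \<in> {0..1} \<Longrightarrow> \<tau> s \<in> {0..1}"
  using mono_onD[of "{0..1}" \<tau> 0 s] mono_onD[of "{0..1}" \<tau> s 1] by (auto simp: reparam_def)

lemma reparam_id: "reparam (\<lambda>s. s)"
  by (auto simp: reparam_def intro!: mono_onI)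

lemma Pi'_comp_strict:
  assumes "\<gamma> \<in> Pi' h" "reparam \<tau>" "strict_mono_on {0..1} \<tau>"
  shows "(\<lambda>s. \<gamma> (\<tau> s)) \<in> Pi' h"
proof -
  have "inj_on \<tau> {0..1}" using assms(3) by (rule strict_mono_on_imp_inj_on)
  moreover have "\<tau> ` {0..1} = {0..1}"
  proof
    show "\<tau> ` {0..1} \<subseteq> {0..1}" using reparam_range[OF assms(2)] by blast
    show "{0..1} \<subseteq> \<tau> ` {0..1}"
    proof
      fix y :: real assume "y \<in> {0..1}"
      then have "\<exists>x\<ge>0. x \<le> 1 \<and> \<tau> x = y"
        using assms(2) by (intro IVT') (auto simp: reparam_def)
      then show "y \<in> \<tau> ` {0..1}" by force
    qed
  qed
  ultimately have b: "bij_betw \<tau> {0..1} {0..1}" by (simp add: bij_betw_def)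
  have "bij_betw (\<gamma> \<circ> \<tau>) {0..1} (Gamma' h)"
    using bij_betw_trans[OF b] assms(1) by (auto simp: Pi'_def)
  moreover have "continuous_on {0..1} (\<gamma> \<circ> \<tau>)"
    using assms b by (intro continuous_on_compose) (auto simp: Pi'_def reparam_def bij_betw_def)
  ultimately show ?thesis using assms(1,2) by (simp add: Pi'_def reparam_def o_def)
qed

text \<open>The infimum is one of reals, so a lower bound is required: each supremum is over a
  compact image and dominates the distance at time 0. All later estimates of \<open>rho1'\<close>
  descend from this one.\<close>

lemma rho1'_le_dist:
  assumes g: "\<gamma>1 \<in> Pi' h1" "\<gamma>2 \<in> Pi' h2" and le: "\<And>s. s \<in> {0..1} \<Longrightarrow> dist (\<gamma>1 s) (\<gamma>2 s) \<le> e"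
  shows "rho1' h1 h2 \<le> e"
proof -
  let ?f = "\<lambda>(\<gamma>1, \<gamma>2). Sup ((\<lambda>t. dist (\<gamma>1 t :: real \<times> 'a) (\<gamma>2 t)) ` {0..1::real})"
  have nonneg: "0 \<le> ?f p" if p: "p \<in> Pi' h1 \<times> Pi' h2" for p
  proof -
    obtain a b where ab: "p = (a, b)" "a \<in> Pi' h1" "b \<in> Pi' h2" using p by auto
    have "compact ((\<lambda>t. dist (a t) (b t)) ` {0..1})"
      using ab by (intro compact_continuous_image continuous_intros) (auto simp: Pi'_def)
    then have "bdd_above ((\<lambda>t. dist (a t) (b t)) ` {0..1})" by (intro bounded_imp_bdd_above compact_imp_bounded)
    then have "dist (a 0) (b 0) \<le> ?f p" unfolding ab by (auto intro: cSUP_upper)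
    then show ?thesis using zero_le_dist order_trans by blast
  qed
  have "rho1' h1 h2 \<le> ?f (\<gamma>1, \<gamma>2)"
    unfolding rho1'_def by (rule cInf_lower) (use g nonneg in \<open>auto intro!: bdd_belowI2[of _ 0]\<close>)
  also have "\<dots> \<le> e" using le by (auto intro: cSUP_least)
  finally show ?thesis .
qed

text \<open>A non-strict reparametrization \<open>\<tau>\<close> is a uniform limit of the strictly increasing
  \<open>(1 - \<kappa>) \<tau> + \<kappa> id\<close>.\<close>

lemma rho1'_le_reparam:
  assumes g: "\<gamma>1 \<in> Pi' h1" "\<gamma>2 \<in> Pi' h2" and ab: "reparam \<alpha>" "reparam \<beta>"
    and le: "\<And>s. s \<in> {0..1} \<Longrightarrow> dist (\<gamma>1 (\<alpha> s)) (\<gamma>2 (\<beta> s)) \<le> e"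
  shows "rho1' h1 h2 \<le> e"
proof (rule field_le_epsilon)
  fix d :: real assume "d > 0"
  define blend where "blend \<kappa> \<tau> s = (1 - \<kappa>) * \<tau> s + \<kappa> * s" for \<kappa> :: real and \<tau> :: "real \<Rightarrow> real" and s
  have blend: "reparam (blend \<kappa> \<tau>)" "strict_mono_on {0..1} (blend \<kappa> \<tau>)"
    if "reparam \<tau>" "0 < \<kappa>" "\<kappa> < 1" for \<kappa> \<tau>
  proof -
    have "blend \<kappa> \<tau> x < blend \<kappa> \<tau> y" if "x \<in> {0..1}" "y \<in> {0..1}" "x < y" for x y
      using \<open>0 < \<kappa>\<close> \<open>\<kappa> < 1\<close> \<open>reparam \<tau>\<close> that unfolding blend_def
      by (intro add_le_less_mono mult_left_mono mult_strict_left_mono)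
         (auto simp: reparam_def intro: mono_onD)
    then show "strict_mono_on {0..1} (blend \<kappa> \<tau>)" by (rule strict_mono_onI)
    then have "mono_on {0..1} (blend \<kappa> \<tau>)" by (rule strict_mono_on_imp_mono_on)
    moreover have "continuous_on {0..1} (blend \<kappa> \<tau>)"
      using that unfolding blend_def by (intro continuous_intros) (auto simp: reparam_def)
    ultimately show "reparam (blend \<kappa> \<tau>)" using that by (simp add: reparam_def blend_def)
  qed
  have close: "dist (blend \<kappa> \<tau> s) (\<tau> s) \<le> \<kappa>" if "reparam \<tau>" "0 < \<kappa>" "s \<in> {0..1}" for \<kappa> \<tau> s
  proof -
    have "blend \<kappa> \<tau> s - \<tau> s = \<kappa> * (s - \<tau> s)" by (simp add: blend_def algebra_simps)
    then have "dist (blend \<kappa> \<tau> s) (\<tau> s) = \<kappa> * \<bar>s - \<tau> s\<bar>"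
      using that by (simp add: dist_real_def abs_mult)
    moreover have "\<bar>s - \<tau> s\<bar> \<le> 1" using reparam_range[OF that(1,3)] that(3) by auto
    ultimately show ?thesis using mult_left_mono[of "\<bar>s - \<tau> s\<bar>" 1 \<kappa>] that(2) by simp
  qed
  have uc: "\<exists>\<delta>>0. \<forall>x\<in>{0..1}. \<forall>y\<in>{0..1}. dist y x < \<delta> \<longrightarrow> dist (\<gamma> y) (\<gamma> x) < d / 2"
    if "\<gamma> \<in> Pi' h" for \<gamma> h
  proof -
    have "uniformly_continuous_on {0..1} \<gamma>"
      using that by (intro compact_uniformly_continuous) (auto simp: Pi'_def)
    then show ?thesis using \<open>d > 0\<close> unfolding uniformly_continuous_on_def by (meson half_gt_zero)
  qed
  obtain \<delta>1 where \<delta>1: "\<delta>1 > 0" "\<And>x y. x \<in> {0..1} \<Longrightarrow> y \<in> {0..1} \<Longrightarrow> dist y x < \<delta>1 \<Longrightarrow> dist (\<gamma>1 y) (\<gamma>1 x) < d / 2"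
    using uc[OF g(1)] by blast
  obtain \<delta>2 where \<delta>2: "\<delta>2 > 0" "\<And>x y. x \<in> {0..1} \<Longrightarrow> y \<in> {0..1} \<Longrightarrow> dist y x < \<delta>2 \<Longrightarrow> dist (\<gamma>2 y) (\<gamma>2 x) < d / 2"
    using uc[OF g(2)] by blast
  define \<kappa> where "\<kappa> = min (min (\<delta>1 / 2) (\<delta>2 / 2)) (1 / 2)"
  have \<kappa>: "0 < \<kappa>" "\<kappa> < 1" "\<kappa> < \<delta>1" "\<kappa> < \<delta>2"
    using \<delta>1(1) \<delta>2(1) by (auto simp: \<kappa>_def min_def)
  note b1 = blend[OF ab(1) \<kappa>(1,2)] and b2 = blend[OF ab(2) \<kappa>(1,2)]
  show "rho1' h1 h2 \<le> e + d"
  proof (rule rho1'_le_dist[OF Pi'_comp_strict[OF g(1) b1] Pi'_comp_strict[OF g(2) b2]])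
    fix s :: real assume s: "s \<in> {0..1}"
    have "dist (\<gamma>1 (blend \<kappa> \<alpha> s)) (\<gamma>1 (\<alpha> s)) < d / 2"
      using close[OF ab(1) \<kappa>(1) s] \<kappa> by (intro \<delta>1(2) reparam_range[OF ab(1) s] reparam_range[OF b1(1) s]) auto
    moreover have "dist (\<gamma>2 (blend \<kappa> \<beta> s)) (\<gamma>2 (\<beta> s)) < d / 2"
      using close[OF ab(2) \<kappa>(1) s] \<kappa> by (intro \<delta>2(2) reparam_range[OF ab(2) s] reparam_range[OF b2(1) s]) auto
    ultimately show "dist (\<gamma>1 (blend \<kappa> \<alpha> s)) (\<gamma>2 (blend \<kappa> \<beta> s)) \<le> e + d"
      using le[OF s] dist_triangle[of "\<gamma>1 (blend \<kappa> \<alpha> s)" "\<gamma>2 (blend \<kappa> \<beta> s)" "\<gamma>1 (\<alpha> s)"]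
        dist_triangle[of "\<gamma>1 (\<alpha> s)" "\<gamma>2 (blend \<kappa> \<beta> s)" "\<gamma>2 (\<beta> s)"]
      by (simp add: dist_commute[of "\<gamma>2 (\<beta> s)"])
  qed
qed

lemma reparam_pw_linear:
  assumes r: "nodes r N" and b: "b 0 = 0" "b N = 1" "\<And>i. i < N \<Longrightarrow> b i \<le> b (Suc i)"
  shows "reparam (pw_linear r (\<lambda>i. b (Suc i) - b i) N)"
  unfolding reparam_def
proof (intro conjI mono_onI)
  show "continuous_on {0..1} (pw_linear r (\<lambda>i. b (Suc i) - b i) N)" by (rule continuous_on_pw_linear[OF r])
  show "pw_linear r (\<lambda>i. b (Suc i) - b i) N 0 = 0" by (rule pw_linear_0[OF r])
  have "pw_linear r (\<lambda>i. b (Suc i) - b i) N (r N) = b N - b 0"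
    unfolding pw_linear_node[OF r order.refl] by (rule sum_lessThan_telescope)
  then show "pw_linear r (\<lambda>i. b (Suc i) - b i) N 1 = 1" using r b by (simp add: nodes_def)
  fix x y :: real assume "x \<in> {0..1}" "y \<in> {0..1}" "x \<le> y"
  then show "pw_linear r (\<lambda>i. b (Suc i) - b i) N x \<le> pw_linear r (\<lambda>i. b (Suc i) - b i) N y"
    using b(3) by (auto simp: pw_linear_def intro!: sum_mono mult_right_mono ramp_mono nodes_step[OF r])
qed

lemma pw_linear_telescope_slot:
  fixes b :: "nat \<Rightarrow> 'a::real_vector"
  assumes r: "nodes r N" and i: "i < N" and c: "c \<in> {0..1}" and b0: "b 0 = 0"
  shows "pw_linear r (\<lambda>i. b (Suc i) - b i) N (r i + c * (r (Suc i) - r i)) = b i + c *\<^sub>R (b (Suc i) - b i)"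
proof -
  have d: "r (Suc i) - r i > 0" using nodes_step[OF r i] by simp
  then have "0 \<le> c * (r (Suc i) - r i)" "c * (r (Suc i) - r i) \<le> r (Suc i) - r i"
    using c by (auto intro: mult_left_le_one_le)
  then have "r i \<le> r i + c * (r (Suc i) - r i)" "r i + c * (r (Suc i) - r i) \<le> r (Suc i)"
    unfolding le_diff_eq by (simp_all add: add.commute)
  then show ?thesis using d b0 by (simp add: pw_linear_slot[OF r i] sum_lessThan_telescope)
qed

lemma slot_param:
  fixes a b s :: real
  assumes "a < b" "a \<le> s" "s \<le> b"
  obtains c where "c \<in> {0..1}" "s = a + c * (b - a)"
  using that[of "(s - a) / (b - a)"] assms by (auto simp: field_simps)

section \<open>One-sided limits, first estimates of \<open>rho1'\<close>, and the oscillation of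
  cadlag paths\<close>

lemma left_val_tendsto:
  assumes "h \<in> D01" "0 < t" "t \<le> 1"
  shows "(h \<longlongrightarrow> left_val h t) (at_left t)"
proof -
  have "\<forall>t\<in>{0<..1}. \<exists>l. (h \<longlongrightarrow> l) (at_left t)" using assms(1) by (simp add: D01_def)
  then obtain l where "(h \<longlongrightarrow> l) (at_left t)" using assms(2,3) by (meson greaterThanAtMost_iff)
  moreover from this have "left_val h t = l" using assms by (auto simp: left_val_def intro!: tendsto_Lim)
  ultimately show ?thesis by simp
qed

lemma right_tendsto: "h \<in> D01 \<Longrightarrow> 0 \<le> t \<Longrightarrow> t < 1 \<Longrightarrow> (h \<longlongrightarrow> h t) (at_right t)"
  by (auto simp: D01_def continuous_within)

lemma left_val_dist_le:
  assumes "h \<in> D01" "0 < t" "t \<le> 1" "r < t" "\<And>x. r < x \<Longrightarrow> x < t \<Longrightarrow> dist y (h x) \<le> e"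
  shows "dist y (left_val h t) \<le> e"
proof (rule Lim_dist_ubound[OF _ left_val_tendsto[OF assms(1-3)]])
  show "\<forall>\<^sub>F x in at_left t. dist y (h x) \<le> e"
    using assms(4,5) unfolding eventually_at_left[OF assms(4)] by blast
qed (rule trivial_limit_at_left_real)

lemma continuous_left_val:
  assumes "continuous_on {0..1} g" "g 0 = 0" "t \<in> {0..1}"
  shows "left_val g t = g t"
proof (cases "t = 0")
  case False
  then have "(g \<longlongrightarrow> g t) (at t within {0..t})"
    using continuous_on_subset[OF assms(1), of "{0..t}"] assms(3) by (auto simp: continuous_on_def)
  then have "(g \<longlongrightarrow> g t) (at_left t)" using False assms(3) by (simp add: at_within_Icc_at_left)
  then show ?thesis using False by (auto simp: left_val_def intro!: tendsto_Lim)
qed (use assms in \<open>simp add: left_val_def\<close>)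

lemma graph_Pi':
  assumes "continuous_on {0..1} g" "g 0 = 0"
  shows "(\<lambda>s. (s, g s)) \<in> Pi' g"
proof -
  have "Gamma' g = (\<lambda>s. (s, g s)) ` {0..1}"
    using continuous_left_val[OF assms] by (auto simp: Gamma'_def)
  then show ?thesis using assms
    by (auto simp: Pi'_def bij_betw_def inj_on_def intro!: continuous_intros)
qed

lemma rho1'_le_sup:
  assumes "continuous_on {0..1} g1" "g1 0 = 0" "continuous_on {0..1} g2" "g2 0 = 0"
    and "\<And>s. s \<in> {0..1} \<Longrightarrow> dist (g1 s) (g2 s) \<le> e"
  shows "rho1' g1 g2 \<le> e"
  by (rule rho1'_le_dist[OF graph_Pi'[OF assms(1,2)] graph_Pi'[OF assms(3,4)]])
     (use assms(5) in \<open>simp add: dist_Pair_Pair\<close>)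

lemma rho1'_pw_linear_le_sup:
  fixes w :: "nat \<Rightarrow> 'a::euclidean_space"
  assumes "nodes t N" "nodes t' N'"
    and "\<And>s. s \<in> {0..1} \<Longrightarrow> dist (pw_linear t w N s) (pw_linear t' w' N' s) \<le> e"
  shows "rho1' (pw_linear t w N) (pw_linear t' w' N') \<le> e"
  by (rule rho1'_le_sup) (use assms in \<open>simp_all add: continuous_on_pw_linear pw_linear_0\<close>)

text \<open>Running the first path by the polygon that maps nodes \<open>t'\<close> to nodes
  \<open>t\<close> makes the space components equal; the time error is a convex combination of node
  errors. The bound ignores the slopes, so nodes of steep pieces can be rounded too.\<close>

lemma rho1'_pw_linear_retime:
  fixes w :: "nat \<Rightarrow> 'a::euclidean_space"
  assumes t: "nodes t N" and t': "nodes t' N" and le: "\<And>j. j \<le> N \<Longrightarrow> \<bar>t j - t' j\<bar> \<le> \<delta>"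
  shows "rho1' (pw_linear t w N) (pw_linear t' w N) \<le> \<delta>"
proof -
  define \<alpha> where "\<alpha> = pw_linear t' (\<lambda>j. t (Suc j) - t j) N"
  have \<alpha>: "reparam \<alpha>" unfolding \<alpha>_def
    by (rule reparam_pw_linear[OF t']) (use t in \<open>auto simp: nodes_def\<close>)
  note gr = graph_Pi'[OF continuous_on_pw_linear pw_linear_0]
  show ?thesis
  proof (rule rho1'_le_reparam[OF gr[OF t t] gr[OF t' t'] \<alpha> reparam_id])
    fix s :: real assume "s \<in> {0..1}"
    then obtain j where j: "j < N" "t' j \<le> s" "s \<le> t' (Suc j)" using nodes_slot_closed[OF t', of s] by auto
    obtain c where c: "c \<in> {0..1}" "s = t' j + c * (t' (Suc j) - t' j)"
      by (rule slot_param[OF nodes_step[OF t' j(1)] j(2,3)])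
    have as: "\<alpha> s = t j + c * (t (Suc j) - t j)"
      unfolding \<alpha>_def c(2) using pw_linear_telescope_slot[OF t' j(1) c(1), of t] t by (simp add: nodes_def)
    let ?b = "\<lambda>j. \<Sum>i<j. w i"
    have "pw_linear t w N (\<alpha> s) = ?b j + c *\<^sub>R (?b (Suc j) - ?b j)"
      using pw_linear_telescope_slot[OF t j(1) c(1), of ?b] by (simp add: as)
    moreover have "pw_linear t' w N s = ?b j + c *\<^sub>R (?b (Suc j) - ?b j)"
      unfolding c(2) using pw_linear_telescope_slot[OF t' j(1) c(1), of ?b] by simp
    moreover have "\<bar>\<alpha> s - s\<bar> \<le> \<delta>"
    proof -
      have "\<alpha> s - s = (1 - c) * (t j - t' j) + c * (t (Suc j) - t' (Suc j))"
        unfolding as by (subst c(2)) (simp add: algebra_simps)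
      also have "\<bar>\<dots>\<bar> \<le> (1 - c) * \<delta> + c * \<delta>"
        using c(1) le[of j] le[of "Suc j"] j
        by (intro order_trans[OF abs_triangle_ineq] add_mono) (auto simp: abs_mult intro!: mult_left_mono)
      finally show ?thesis by (simp add: algebra_simps)
    qed
    ultimately show "dist (\<alpha> s, pw_linear t w N (\<alpha> s)) (s, pw_linear t' w N s) \<le> \<delta>"
      by (simp add: dist_Pair_Pair dist_real_def)
  qed
qed

text \<open>Compactness through \<open>Bolzano\<close>: because one-sided limits exist, the single
  exceptional point \<open>x\<close> suffices on a neighbourhood of \<open>x\<close>, and
  exceptional sets of adjacent intervals are united.\<close>

lemma D01_regulated:
  fixes h :: "real \<Rightarrow> 'a::euclidean_space"
  assumes h: "h \<in> D01" and e: "e > 0"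
  obtains T where "finite T"
    "\<And>s s'. 0 \<le> s \<Longrightarrow> s \<le> s' \<Longrightarrow> s' < 1 \<Longrightarrow> T \<inter> {s<..s'} = {} \<Longrightarrow> dist (h s) (h s') \<le> e"
proof -
  \<comment> \<open>Only the half-open interval must avoid \<open>T\<close>: by right continuity a
    jump at \<open>s\<close> itself is harmless. The endpoint 1 is excluded since the path may jump
    there.\<close>
  let ?P = "\<lambda>a b. \<exists>T. finite T \<and> (\<forall>s s'. 0 \<le> s \<and> s' < 1 \<and> a \<le> s \<and> s \<le> s' \<and> s' < b \<and> T \<inter> {s<..s'} = {}
      \<longrightarrow> dist (h s) (h s') \<le> e)"
  have "?P 0 1"
  proof (rule Bolzano[of 0 1 ?P])
    show "(0::real) \<le> 1" by simp
    fix a b c :: real assume "?P a b" "?P b c"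
    then obtain T1 T2 where T: "finite T1" "finite T2"
      "\<And>s s'. 0 \<le> s \<and> s' < 1 \<and> a \<le> s \<and> s \<le> s' \<and> s' < b \<and> T1 \<inter> {s<..s'} = {} \<Longrightarrow> dist (h s) (h s') \<le> e"
      "\<And>s s'. 0 \<le> s \<and> s' < 1 \<and> b \<le> s \<and> s \<le> s' \<and> s' < c \<and> T2 \<inter> {s<..s'} = {} \<Longrightarrow> dist (h s) (h s') \<le> e"
      by metis
    have "dist (h s) (h s') \<le> e"
      if "0 \<le> s" "s' < 1" "a \<le> s" "s \<le> s'" "s' < c" "(insert b (T1 \<union> T2)) \<inter> {s<..s'} = {}" for s s'
    proof -
      have "s' < b \<or> b \<le> s" using that by auto
      then show ?thesis using T(3)[of s s'] T(4)[of s s'] that by auto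
    qed
    then show "?P a c" using T(1,2) by (intro exI[of _ "insert b (T1 \<union> T2)"]) blast
  next
    fix x :: real assume x: "0 \<le> x" "x \<le> 1"
    have "\<exists>d>0. \<forall>s. x \<le> s \<and> s < x + d \<and> s < 1 \<longrightarrow> dist (h s) (h x) < e / 2"
    proof (cases "x < 1")
      case True
      then have "\<forall>\<^sub>F s in at_right x. dist (h s) (h x) < e / 2"
        using right_tendsto[OF h x(1)] e by (intro tendstoD) auto
      then obtain b where "b > x" "\<forall>s>x. s < b \<longrightarrow> dist (h s) (h x) < e / 2"
        unfolding eventually_at_right_field by blast
      then show ?thesis using e
        by (intro exI[of _ "b - x"]) (auto simp: order.order_iff_strict)
    qed (use x in \<open>auto intro: exI[of _ 1]\<close>)
    then obtain d1 where d1: "d1 > 0" "\<And>s. x \<le> s \<Longrightarrow> s < x + d1 \<Longrightarrow> s < 1 \<Longrightarrow> dist (h s) (h x) < e / 2" by blast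
    have "\<exists>d>0. \<forall>s. x - d < s \<and> s < x \<and> 0 \<le> s \<longrightarrow> dist (h s) (left_val h x) < e / 2"
    proof (cases "0 < x")
      case True
      then have "\<forall>\<^sub>F s in at_left x. dist (h s) (left_val h x) < e / 2"
        using left_val_tendsto[OF h True x(2)] e by (intro tendstoD) auto
      then obtain b where "b < x" "\<forall>s>b. s < x \<longrightarrow> dist (h s) (left_val h x) < e / 2"
        unfolding eventually_at_left_field by blast
      then show ?thesis using e by (intro exI[of _ "x - b"]) auto
    qed (use x in \<open>auto intro: exI[of _ 1]\<close>)
    then obtain d2 where d2: "d2 > 0"
      "\<And>s. x - d2 < s \<Longrightarrow> s < x \<Longrightarrow> 0 \<le> s \<Longrightarrow> dist (h s) (left_val h x) < e / 2" by blast
    show "\<exists>d>0. \<forall>a b. a \<le> x \<and> x \<le> b \<and> b - a < d \<longrightarrow> ?P a b"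
    proof (intro exI[of _ "min d1 d2"] conjI allI impI)
      fix a b assume ab: "a \<le> x \<and> x \<le> b \<and> b - a < min d1 d2"
      show "?P a b"
      proof (intro exI[of _ "{x}"] conjI allI impI)
        fix s s' assume s: "0 \<le> s \<and> s' < 1 \<and> a \<le> s \<and> s \<le> s' \<and> s' < b \<and> {x} \<inter> {s<..s'} = {}"
        then have "s' < x \<or> x \<le> s" by auto
        then show "dist (h s) (h s') \<le> e"
        proof
          assume "s' < x"
          then have "dist (h s) (left_val h x) < e / 2" "dist (h s') (left_val h x) < e / 2"
            using s ab by (intro d2(2); force)+
          then show ?thesis using dist_triangle2[of "h s" "h s'" "left_val h x"] by linarith
        next
          assume "x \<le> s"
          then have "dist (h s) (h x) < e / 2" "dist (h s') (h x) < e / 2"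
            using s ab by (intro d1(2); force)+
          then show ?thesis using dist_triangle2[of "h s" "h s'" "h x"] by linarith
        qed
      qed simp
    qed (use d1 d2 in auto)
  qed
  then obtain T where T: "finite T" "\<And>s s'. 0 \<le> s \<and> s' < 1 \<and> 0 \<le> s \<and> s \<le> s' \<and> s' < 1 \<and> T \<inter> {s<..s'} = {}
      \<Longrightarrow> dist (h s) (h s') \<le> e" by metis
  show ?thesis by (rule that[OF T(1)]) (use T(2) in simp)
qed

lemma D01_nodes:
  fixes h :: "real \<Rightarrow> 'a::euclidean_space"
  assumes h: "h \<in> D01" and e: "e > 0"
  obtains t N where "nodes t N"
    "\<And>j. j < N \<Longrightarrow> t (Suc j) \<le> t j + e"
    "\<And>j s. j < N \<Longrightarrow> t j \<le> s \<Longrightarrow> s < t (Suc j) \<Longrightarrow> dist (h (t j)) (h s) \<le> e"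
proof -
  obtain T where T: "finite T"
    "\<And>s s'. 0 \<le> s \<Longrightarrow> s \<le> s' \<Longrightarrow> s' < 1 \<Longrightarrow> T \<inter> {s<..s'} = {} \<Longrightarrow> dist (h s) (h s') \<le> e"
    using D01_regulated[OF h e] by blast
  obtain n :: nat where n: "n > 0" "1 / real n < e" using nat_approx_posE[OF e] by (metis zero_less_Suc)
  \<comment> \<open>The exceptional points control the oscillation and the uniform grid controls the
    mesh.\<close>
  define P where "P = (T \<inter> {0..1}) \<union> (\<lambda>i. real i / real n) ` {..n}"
  have "0 = (\<lambda>i. real i / real n) 0" "1 = (\<lambda>i. real i / real n) n" using n by auto
  then have P: "0 \<in> P" "1 \<in> P" unfolding P_def by blast+
  have "finite P" "P \<subseteq> {0..1}" using T(1) n by (auto simp: P_def)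
  from finite_set_nodes[OF this P] obtain t N where t: "nodes t N" "t ` {..N} = P" by blast
  have gap: "x \<notin> {t j<..<t (Suc j)}" if "j < N" "x \<in> P" for x j
  proof -
    have "x \<in> t ` {..N}" using that(2) t(2) by simp
    then obtain i where "i \<le> N" "x = t i" by blast
    then show ?thesis using nodes_le[OF t(1), of i j] nodes_le[OF t(1), of "Suc j" i] that
      by (cases "i \<le> j") auto
  qed
  show ?thesis
  proof (rule that[OF t(1)])
    fix j assume j: "j < N"
    show "t (Suc j) \<le> t j + e"
    proof (rule ccontr)
      assume big: "\<not> ?thesis"
      \<comment> \<open>Index of the first grid point strictly to the right of \<open>t j\<close>;
        it would fall inside a slot longer than \<open>e\<close>.\<close>
      define i where "i = Suc (nat \<lfloor>real n * t j\<rfloor>)"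
      have "0 \<le> t j" "t (Suc j) \<le> 1" using nodes_range[OF t(1), of j] nodes_range[OF t(1), of "Suc j"] j by auto
      then have r: "real i = of_int \<lfloor>real n * t j\<rfloor> + 1" using n by (simp add: i_def)
      have "real n * t j < real i" "real i \<le> real n * t j + 1" unfolding r by linarith+
      then have 1: "t j < real i / real n" "real i / real n \<le> t j + 1 / real n"
        using n by (auto simp: field_simps)
      then have 2: "real i / real n < t (Suc j)" using big n by linarith
      then have "real i / real n \<le> 1" using \<open>t (Suc j) \<le> 1\<close> by linarith
      then have "i \<le> n" using n by (simp add: divide_simps)
      then have "real i / real n \<in> P" by (auto simp: P_def)
      then show False using gap[OF j] 1 2 by auto
    qed
    fix s assume s: "t j \<le> s" "s < t (Suc j)"
    have r: "0 \<le> t j" "t (Suc j) \<le> 1" using nodes_range[OF t(1), of j] nodes_range[OF t(1), of "Suc j"] j by auto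
    then have "T \<inter> {t j<..s} \<subseteq> P \<inter> {t j<..<t (Suc j)}" using s by (auto simp: P_def)
    then have "T \<inter> {t j<..s} = {}" using gap[OF j] by blast
    then show "dist (h (t j)) (h s) \<le> e" using T(2)[of "t j" s] r s by auto
  qed
qed

text \<open>Jumps of size above \<open>1 / Suc n\<close> lie in a finite set, namely the exceptional
  points for that oscillation and the two endpoints.\<close>

lemma D01_countable_jumps:
  fixes h :: "real \<Rightarrow> 'a::euclidean_space"
  assumes h: "h \<in> D01"
  shows "countable {t\<in>{0..1}. h t \<noteq> left_val h t}"
proof -
  have "\<exists>T. finite T \<and> (\<forall>t\<in>{0..1}. t \<notin> T \<longrightarrow> dist (h t) (left_val h t) \<le> 1 / real (Suc n))" for n
  proof -
    have e: "1 / real (Suc n) > 0" by simp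
    obtain T where T: "finite T"
      "\<And>s s'. 0 \<le> s \<Longrightarrow> s \<le> s' \<Longrightarrow> s' < 1 \<Longrightarrow> T \<inter> {s<..s'} = {} \<Longrightarrow> dist (h s) (h s') \<le> 1 / real (Suc n)"
      using D01_regulated[OF h e] by blast
    \<comment> \<open>The endpoints are set aside: at 0 \<open>left_val\<close> is 0 by convention,
      and at 1 \<open>D01_regulated\<close> is silent.\<close>
    have "dist (h t) (left_val h t) \<le> 1 / real (Suc n)"
      if t: "t \<in> {0..1}" "t \<notin> insert 0 (insert 1 T)" for t
    proof -
      have t01: "0 < t" "t < 1" using t by (auto simp: order.order_iff_strict)
      define r where "r = Max (insert 0 (T \<inter> {..<t}))"
      have r: "0 \<le> r" "r < t" using T(1) t01 by (auto simp: r_def)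
      have "T \<inter> {x<..t} = {}" if "r < x" for x
      proof -
        have "y \<le> r" if "y \<in> T" "y < t" for y using T(1) that by (auto simp: r_def)
        then show ?thesis using that t(2) by (force simp: order.order_iff_strict)
      qed
      then show ?thesis
        using r t01 T(2)[of _ t] by (intro left_val_dist_le[OF h _ _ r(2)]) (auto simp: dist_commute)
    qed
    then show ?thesis using T(1) by (intro exI[of _ "insert 0 (insert 1 T)"]) blast
  qed
  then obtain T where T: "\<And>n. finite (T n)"
    "\<And>n t. t \<in> {0..1} \<Longrightarrow> t \<notin> T n \<Longrightarrow> dist (h t) (left_val h t) \<le> 1 / real (Suc n)" by metis
  have "{t\<in>{0..1}. h t \<noteq> left_val h t} \<subseteq> (\<Union>n. T n)"
  proof safe
    fix t :: real assume t: "t \<in> {0..1}" "h t \<noteq> left_val h t"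
    then obtain n where "1 / real (Suc n) < dist (h t) (left_val h t)"
      using nat_approx_posE[of "dist (h t) (left_val h t)"] by auto
    then show "t \<in> (\<Union>n. T n)" using T(2)[OF t(1), of n] by force
  qed
  moreover have "countable (\<Union>n. T n)" using T(1) by (intro countable_UN) (auto intro: countable_finite)
  ultimately show ?thesis by (rule countable_subset)
qed

text \<open>The clock \<open>a\<close> is the identity plus the distribution function of a discrete law charging
  exactly the jump times, normalized; \<open>b\<close> is its left-limit version.\<close>

lemma jump_clock:
  fixes J :: "real set"
  assumes J: "countable J" "J \<subseteq> {0..1}"
  obtains a b :: "real \<Rightarrow> real" and \<kappa> where "\<kappa> > 0" "b 0 = 0" "a 1 = 1" "\<And>t. b t \<le> a t"
    "\<And>t. t \<in> {0..1} \<Longrightarrow> a t = b t \<longleftrightarrow> t \<notin> J"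
    "\<And>s t. s < t \<Longrightarrow> a s + (t - s) * \<kappa> \<le> b t"
    "\<And>\<sigma>. \<sigma> \<in> {0..1} \<Longrightarrow> \<exists>t\<in>{0..1}. b t \<le> \<sigma> \<and> \<sigma> \<le> a t"
proof -
  \<comment> \<open>The image of a geometric law under an enumeration charges every point. The extra
    atom 2 keeps the support nonempty when \<open>J\<close> is empty and lies outside the unit
    interval.\<close>
  define p where "p = map_pmf (from_nat_into (insert 2 J)) (geometric_pmf (1/2))"
  have sp: "set_pmf p = insert 2 J"
    unfolding p_def set_map_pmf using J by (simp add: set_pmf_geometric range_from_nat_into)
  define D where "D = distr (measure_pmf p) borel (\<lambda>x. x)"
  interpret D: prob_space D unfolding D_def by (intro measure_pmf.prob_space_distr) simp
  interpret D: finite_borel_measure D by unfold_locales (simp add: D_def)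
  have mD: "measure D A = measure (measure_pmf p) A" if "A \<in> sets borel" for A
    unfolding D_def using that by (subst measure_distr) auto
  define A where "A t = t + measure D {..t}" for t
  define B where "B t = t + measure D {..<t}" for t
  have AB: "A t = B t + pmf p t" for t
  proof -
    have "measure D ({..<t} \<union> {t}) = measure D {..<t} + measure D {t}"
      by (rule D.finite_measure_Union) (auto simp: D_def)
    moreover have "{..<t} \<union> {t} = {..t}" by auto
    moreover have "measure D {t} = pmf p t" by (simp add: mD measure_pmf_single)
    ultimately show ?thesis by (simp add: A_def B_def)
  qed
  have B0: "B 0 = 0"
  proof -
    have "measure (measure_pmf p) {..<0} = 0"
      using J(2) by (auto simp: measure_pmf_zero_iff sp)
    then show ?thesis by (simp add: B_def mD)
  qed
  have step: "A s + (t - s) \<le> B t" if "s < t" for s t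
  proof -
    have "measure D {..s} \<le> measure D {..<t}"
      using that by (intro D.finite_measure_mono) (auto simp: D_def)
    then show ?thesis by (simp add: A_def B_def)
  qed
  have A1: "A 1 \<ge> 1" by (simp add: A_def)
  have ex: "\<exists>t\<in>{0..1}. B t \<le> \<sigma> \<and> \<sigma> \<le> A t" if \<sigma>: "0 \<le> \<sigma>" "\<sigma> \<le> A 1" for \<sigma>
  proof -
    \<comment> \<open>Generalized inverse of \<open>A\<close>: at the infimum, right continuity
      gives \<open>\<sigma> \<le> A t\<close>, and the left limit of \<open>A\<close>, which is
      \<open>B t\<close>, gives the other bound.\<close>
    define S where "S = {t\<in>{0..1}. \<sigma> \<le> A t}"
    define t where "t = Inf S"
    have ne: "1 \<in> S" and bd: "bdd_below S" using \<sigma> by (auto simp: S_def intro: bdd_belowI[of _ 0])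
    have t01: "0 \<le> t" "t \<le> 1"
      unfolding t_def using ne bd by (auto intro!: cInf_greatest cInf_lower simp: S_def)
    have Amono: "A x \<le> A y" if "x \<le> y" for x y
      unfolding A_def using that by (intro add_mono D.finite_measure_mono) (auto simp: D_def)
    have up: "\<sigma> \<le> A s" if "t < s" for s :: real
    proof -
      have "S \<noteq> {}" using ne by auto
      then obtain y where "y \<in> S" "y < s" using cInf_lessD[of S s] \<open>t < s\<close> unfolding t_def by auto
      then show ?thesis using Amono[of y s] by (auto simp: S_def)
    qed
    have "\<sigma> \<le> A t"
    proof (rule tendsto_lowerbound[of A "A t" "at_right t"])
      have "(cdf D \<longlongrightarrow> cdf D t) (at_right t)" using D.cdf_is_right_cont[of t] by (simp add: continuous_within)
      then show "(A \<longlongrightarrow> A t) (at_right t)" unfolding A_def[abs_def] cdf_def2[symmetric] by (intro tendsto_intros)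
      show "\<forall>\<^sub>F s in at_right t. \<sigma> \<le> A s" using up by (auto simp: eventually_at_right_field intro: exI[of _ "t + 1"])
    qed simp
    moreover have "B t \<le> \<sigma>"
    proof (cases "t = 0")
      case False
      have down: "A s \<le> \<sigma>" if "0 < s" "s < t" for s
      proof (rule ccontr)
        assume "\<not> A s \<le> \<sigma>"
        then have "s \<in> S" using that t01 by (auto simp: S_def)
        then show False using cInf_lower[OF _ bd, of s] that by (simp add: t_def)
      qed
      show ?thesis
      proof (rule tendsto_upperbound[of A "B t" "at_left t"])
        show "(A \<longlongrightarrow> B t) (at_left t)"
          unfolding A_def[abs_def] B_def cdf_def2[symmetric] by (intro tendsto_intros D.cdf_at_left)
        show "\<forall>\<^sub>F s in at_left t. A s \<le> \<sigma>"
          using down False t01 unfolding eventually_at_left_field by (intro exI[of _ 0]) auto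
      qed simp
    qed (use B0 \<sigma> in simp)
    ultimately show ?thesis using t01 by auto
  qed
  show ?thesis
  \<comment> \<open>Division by \<open>A 1\<close> makes the clock end at 1. The identity part of
    \<open>A\<close> then contributes the slope \<open>1 / A 1\<close>, which makes the inverse
    clock Lipschitz.\<close>
  proof (rule that[of "1 / A 1" "\<lambda>t. B t / A 1" "\<lambda>t. A t / A 1"])
    show "B t / A 1 \<le> A t / A 1" for t using A1 AB[of t] by (simp add: divide_right_mono)
    show "A t / A 1 = B t / A 1 \<longleftrightarrow> t \<notin> J" if "t \<in> {0..1}" for t
      using A1 AB[of t] that by (auto simp: pmf_eq_0_set_pmf sp)
    show "A s / A 1 + (t - s) * (1 / A 1) \<le> B t / A 1" if "s < t" for s t
      using A1 step[OF that] by (simp add: divide_simps)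
    show "\<exists>t\<in>{0..1}. B t / A 1 \<le> \<sigma> \<and> \<sigma> \<le> A t / A 1" if "\<sigma> \<in> {0..1}" for \<sigma>
      using ex[of "\<sigma> * A 1"] that A1 by (auto simp: divide_simps mult.commute mult_left_le_one_le)
  qed (use A1 B0 in auto)
qed

text \<open>The clock interval from \<open>b t\<close> to \<open>a t\<close> is spent on the segment
  of the jump at \<open>t\<close>; it is a single point exactly at continuity points. These
  intervals are ordered and fill the unit interval, so each clock value determines one point of the
  completed graph.\<close>

lemma D01_parametrization:
  fixes h :: "real \<Rightarrow> 'a::euclidean_space"
  assumes h: "h \<in> D01"
  obtains \<gamma> a b where "\<gamma> \<in> Pi' h" "b 0 = 0" "a 1 = 1" "\<And>t. b t \<le> a t"
    "\<And>s t. s < t \<Longrightarrow> a s < b t"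
    "\<And>t c. t \<in> {0..1} \<Longrightarrow> c \<in> {0..1} \<Longrightarrow>
        \<gamma> (b t + c * (a t - b t)) = (t, left_val h t + c *\<^sub>R (h t - left_val h t))"
    "\<And>\<sigma>. \<sigma> \<in> {0..1} \<Longrightarrow> \<exists>t\<in>{0..1}. b t \<le> \<sigma> \<and> \<sigma> \<le> a t"
proof -
  define J where "J = {t\<in>{0..1}. h t \<noteq> left_val h t}"
  have "countable J" "J \<subseteq> {0..1}" using D01_countable_jumps[OF h] by (auto simp: J_def)
  then obtain a b :: "real \<Rightarrow> real" and \<kappa> where \<kappa>: "\<kappa> > 0" and b0: "b 0 = 0" and a1: "a 1 = 1"
    and ba: "\<And>t. b t \<le> a t" and abJ: "\<And>t. t \<in> {0..1} \<Longrightarrow> a t = b t \<longleftrightarrow> t \<notin> J"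
    and st: "\<And>s t. s < t \<Longrightarrow> a s + (t - s) * \<kappa> \<le> b t"
    and ex: "\<And>\<sigma>. \<sigma> \<in> {0..1} \<Longrightarrow> \<exists>t\<in>{0..1}. b t \<le> \<sigma> \<and> \<sigma> \<le> a t"
    using jump_clock[of J] by metis
  have lt: "a s < b t" if "s < t" for s t
    using st[OF that] mult_pos_pos[of "t - s" \<kappa>] that \<kappa> by linarith
  \<comment> \<open>The inverse clock: the time whose clock interval contains
    \<open>\<sigma>\<close>; \<open>uniq\<close> below makes the choice canonical.\<close>
  define \<theta> where "\<theta> \<sigma> = (SOME t. t \<in> {0..1} \<and> b t \<le> \<sigma> \<and> \<sigma> \<le> a t)" for \<sigma>
  have \<theta>: "\<theta> \<sigma> \<in> {0..1}" "b (\<theta> \<sigma>) \<le> \<sigma>" "\<sigma> \<le> a (\<theta> \<sigma>)" if "\<sigma> \<in> {0..1}" for \<sigma>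
    using someI_ex[of "\<lambda>t. t \<in> {0..1} \<and> b t \<le> \<sigma> \<and> \<sigma> \<le> a t"] ex[OF that] unfolding \<theta>_def by blast+
  have uniq: "t = t'" if "b t \<le> \<sigma>" "\<sigma> \<le> a t" "b t' \<le> \<sigma>" "\<sigma> \<le> a t'" for t t' \<sigma>
    using lt[of t t'] lt[of t' t] that by (cases t t' rule: linorder_cases) auto
  have range: "b t \<in> {0..1} \<and> a t \<in> {0..1}" if "t \<in> {0..1}" for t
    using lt[of 0 t] lt[of t 1] ba[of 0] ba[of 1] ba[of t] b0 a1 that
    by (cases "t = 0"; cases "t = 1") auto
  \<comment> \<open>Where \<open>a\<close> and \<open>b\<close> agree, the quotient is 0 by
    convention; there the segment is a point.\<close>
  define \<gamma> where "\<gamma> \<sigma> = (\<theta> \<sigma>, left_val h (\<theta> \<sigma>)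
      + ((\<sigma> - b (\<theta> \<sigma>)) / (a (\<theta> \<sigma>) - b (\<theta> \<sigma>))) *\<^sub>R (h (\<theta> \<sigma>) - left_val h (\<theta> \<sigma>)))" for \<sigma>
  have between: "b t \<le> b t + c * (a t - b t)" "b t + c * (a t - b t) \<le> a t" if "c \<in> {0..1}" for t c
  proof -
    have "0 \<le> c * (a t - b t)" "c * (a t - b t) \<le> a t - b t"
      using ba[of t] that by (auto intro: mult_left_le_one_le)
    then show "b t \<le> b t + c * (a t - b t)" "b t + c * (a t - b t) \<le> a t" by (auto simp: le_diff_eq add.commute)
  qed
  have \<gamma>: "\<gamma> (b t + c * (a t - b t)) = (t, left_val h t + c *\<^sub>R (h t - left_val h t))"
    if t: "t \<in> {0..1}" and c: "c \<in> {0..1}" for t c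
  proof -
    let ?\<sigma> = "b t + c * (a t - b t)"
    have "?\<sigma> \<in> {0..1}" using between[OF c, of t] range[OF t] by auto
    then have "\<theta> ?\<sigma> = t" using \<theta>[of ?\<sigma>] between[OF c, of t] uniq by blast
    then show ?thesis using abJ[OF t] t by (cases "a t = b t") (auto simp: \<gamma>_def J_def)
  qed
  have cont: "continuous_on {0..1} \<gamma>"
    unfolding continuous_on_iff
  proof (intro ballI allI impI)
    fix \<sigma>0 e :: real assume \<sigma>0: "\<sigma>0 \<in> {0..1}" and e: "0 < e"
    define t where "t = \<theta> \<sigma>0"
    have t: "t \<in> {0..1}" "b t \<le> \<sigma>0" "\<sigma>0 \<le> a t" using \<theta>[OF \<sigma>0] by (auto simp: t_def)
    \<comment> \<open>Speed at which the jump at \<open>t\<close> is traversed, with value 0 at a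
      continuity point.\<close>
    define K where "K = norm (h t - left_val h t) / (a t - b t)"
    have K0: "0 \<le> K" using ba[of t] by (simp add: K_def)
    have K: "norm (h t - left_val h t) = K * (a t - b t)"
      using abJ[OF t(1)] t(1) by (cases "a t = b t") (auto simp: K_def J_def)
    have "\<exists>r>0. \<forall>s. t < s \<and> s < t + r \<and> s \<le> 1 \<longrightarrow> dist (h t) (h s) \<le> e / 3"
    proof (cases "t < 1")
      case True
      then have "\<forall>\<^sub>F s in at_right t. dist (h s) (h t) < e / 3"
        using right_tendsto[OF h _ True] t(1) e by (intro tendstoD) auto
      then obtain x where "x > t" "\<forall>s>t. s < x \<longrightarrow> dist (h s) (h t) < e / 3"
        unfolding eventually_at_right_field by blast
      then show ?thesis by (intro exI[of _ "x - t"]) (auto simp: dist_commute less_imp_le)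
    qed (use t in \<open>auto intro: exI[of _ 1]\<close>)
    then obtain r1 where r1: "r1 > 0" "\<And>s. t < s \<Longrightarrow> s < t + r1 \<Longrightarrow> s \<le> 1 \<Longrightarrow> dist (h t) (h s) \<le> e / 3" by blast
    have "\<exists>r>0. \<forall>s\<in>{0..1}. t - r < s \<and> s < t \<longrightarrow> 0 \<le> t - r \<and> dist (left_val h t) (h s) \<le> e / 3"
    proof (cases "0 < t")
      case True
      then have "\<forall>\<^sub>F s in at_left t. dist (h s) (left_val h t) < e / 3"
        using left_val_tendsto[OF h True] t(1) e by (intro tendstoD) auto
      then obtain x where "x < t" "\<forall>s>x. s < t \<longrightarrow> dist (h s) (left_val h t) < e / 3"
        unfolding eventually_at_left_field by blast
      then show ?thesis using True
        by (intro exI[of _ "min (t - x) t"]) (auto simp: dist_commute less_imp_le min_def)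
    qed (use t in \<open>auto intro: exI[of _ 1]\<close>)
    then obtain r2 where r2: "r2 > 0"
      "\<And>s. s \<in> {0..1} \<Longrightarrow> t - r2 < s \<Longrightarrow> s < t \<Longrightarrow> 0 \<le> t - r2 \<and> dist (left_val h t) (h s) \<le> e / 3" by blast
    \<comment> \<open>The first two terms keep \<open>s\<close> inside the one-sided neighbourhoods
      of \<open>t\<close>, the third limits the motion along the jump at \<open>t\<close> to
      \<open>e / 3\<close>, the last limits the change of time to \<open>e / 3\<close>.\<close>
    define d where "d = min (min (\<kappa> * r1) (\<kappa> * r2)) (min (e / (3 * (K + 1))) (\<kappa> * (e / 3)))"
    have d: "d > 0" "d \<le> \<kappa> * r1" "d \<le> \<kappa> * r2" "d \<le> \<kappa> * (e / 3)" "d \<le> e / (3 * (K + 1))"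
      using \<kappa> r1(1) r2(1) e K0 unfolding d_def
      by (simp, blast intro: min.coboundedI1, blast intro: min.coboundedI1 min.coboundedI2,
          blast intro: min.coboundedI2, blast intro: min.coboundedI1 min.coboundedI2)
    have Kd: "K * x < e / 3" if "0 \<le> x" "x < d" for x
    proof -
      have "K * x \<le> (K + 1) * x" using that by (simp add: mult_right_mono)
      also have "\<dots> < (K + 1) * (e / (3 * (K + 1)))"
        using that d(5) K0 by (intro mult_strict_left_mono) auto
      also have "\<dots> = e / 3"
      proof -
        have "K + 1 \<noteq> 0" using K0 by linarith
        then show ?thesis by (simp add: nonzero_eq_divide_eq[symmetric] mult.commute) (simp add: divide_simps)
      qed
      finally show ?thesis .
    qed
    define u0 where "u0 = (\<sigma>0 - b t) / (a t - b t)"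
    let ?z = "left_val h t + u0 *\<^sub>R (h t - left_val h t)"
    have \<gamma>0: "\<gamma> \<sigma>0 = (t, ?z)" by (simp add: \<gamma>_def t_def u0_def)
    have u: "u0 * (a t - b t) = \<sigma>0 - b t" unfolding u0_def using t by (cases "a t = b t") auto
    have u01: "0 \<le> u0" "u0 \<le> 1" using t by (auto simp: u0_def divide_le_eq)
    have lo: "dist (left_val h t) ?z = K * (\<sigma>0 - b t)"
    proof -
      have "dist (left_val h t) ?z = u0 * (K * (a t - b t))"
        using u01(1) by (simp add: dist_norm K)
      then show ?thesis using u by (simp add: mult_ac)
    qed
    have hi: "dist (h t) ?z = K * (a t - \<sigma>0)"
    proof -
      have "h t - ?z = (1 - u0) *\<^sub>R (h t - left_val h t)" by (simp add: algebra_simps)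
      then have "dist (h t) ?z = (1 - u0) * (K * (a t - b t))"
        using u01(2) by (simp add: dist_norm K)
      also have "\<dots> = K * ((a t - b t) - u0 * (a t - b t))" by (simp add: algebra_simps)
      finally show ?thesis unfolding u by simp
    qed
    show "\<exists>d>0. \<forall>\<sigma>\<in>{0..1}. dist \<sigma> \<sigma>0 < d \<longrightarrow> dist (\<gamma> \<sigma>) (\<gamma> \<sigma>0) < e"
    proof (intro exI[of _ d] conjI ballI impI)
      fix \<sigma> :: real assume \<sigma>: "\<sigma> \<in> {0..1}" and "dist \<sigma> \<sigma>0 < d"
      then have ds: "\<bar>\<sigma> - \<sigma>0\<bar> < d" by (simp add: dist_real_def)
      define s where "s = \<theta> \<sigma>"
      have s: "s \<in> {0..1}" "b s \<le> \<sigma>" "\<sigma> \<le> a s" using \<theta>[OF \<sigma>] by (auto simp: s_def)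
      let ?v = "(\<sigma> - b s) / (a s - b s)"
      let ?\<xi> = "left_val h s + ?v *\<^sub>R (h s - left_val h s)"
      have v01: "0 \<le> ?v" "?v \<le> 1" using s by (auto simp: divide_le_eq)
      have "?\<xi> \<in> closed_segment (left_val h s) (h s)"
        using v01 by (auto simp: in_segment algebra_simps intro!: exI[of _ ?v])
      then have ball: "dist y ?\<xi> \<le> e / 3" if "dist y (left_val h s) \<le> e / 3" "dist y (h s) \<le> e / 3" for y
        using closed_segment_subset[of "left_val h s" "cball y (e / 3)" "h s"] that by auto
      have \<gamma>s: "\<gamma> \<sigma> = (s, ?\<xi>)" by (simp add: \<gamma>_def s_def)
      have lip: "\<kappa> * \<bar>s - t\<bar> \<le> \<bar>\<sigma> - \<sigma>0\<bar>"
        using st[of s t] st[of t s] s t by (cases s t rule: linorder_cases) (auto simp: mult.commute)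
      have near: "\<bar>s - t\<bar> < r" if "d \<le> \<kappa> * r" for r
      proof -
        have "\<kappa> * \<bar>s - t\<bar> < \<kappa> * r" using lip ds that by linarith
        then show ?thesis using \<kappa> by simp
      qed
      have "dist ?\<xi> ?z < 2 * e / 3"
      proof (cases s t rule: linorder_cases)
        case equal
        have v: "?v - u0 = (\<sigma> - \<sigma>0) / (a t - b t)"
          unfolding equal u0_def diff_divide_distrib[symmetric] by simp
        have "?\<xi> - ?z = (?v - u0) *\<^sub>R (h t - left_val h t)"
          unfolding equal by (simp add: scaleR_diff_left)
        then have "dist ?\<xi> ?z = \<bar>\<sigma> - \<sigma>0\<bar> / (a t - b t) * (K * (a t - b t))"
          using ba[of t] by (simp only: v) (simp add: dist_norm K)
        also have "\<dots> \<le> K * \<bar>\<sigma> - \<sigma>0\<bar>" using K0 by (cases "a t = b t") auto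
        also have "\<dots> < e / 3" using Kd[of "\<bar>\<sigma> - \<sigma>0\<bar>"] ds by simp
        finally show ?thesis using e by linarith
      next
        case greater
        \<comment> \<open>Between \<open>\<sigma>0\<close> and \<open>\<sigma>\<close> the clock
          completes the jump at \<open>t\<close>, so the point at \<open>\<sigma>0\<close> is
          already close to \<open>h t\<close>. The next case is the mirror image with the left
          limit.\<close>
        have "a t \<le> \<sigma>" using lt[OF greater] s by linarith
        then have "K * (a t - \<sigma>0) \<le> K * \<bar>\<sigma> - \<sigma>0\<bar>" using K0 by (intro mult_left_mono) auto
        then have 1: "dist (h t) ?z < e / 3" using hi Kd[of "\<bar>\<sigma> - \<sigma>0\<bar>"] ds by simp
        have "dist (h t) ?\<xi> \<le> e / 3"
          using near[OF d(2)] greater s t r1(2)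
          by (intro ball left_val_dist_le[OF h, of s t]) auto
        then show ?thesis using 1 dist_triangle3[of ?\<xi> ?z "h t"] by linarith
      next
        case less
        have "\<sigma> \<le> b t" using lt[OF less] s by linarith
        then have "K * (\<sigma>0 - b t) \<le> K * \<bar>\<sigma> - \<sigma>0\<bar>" using K0 by (intro mult_left_mono) auto
        then have 1: "dist (left_val h t) ?z < e / 3" using lo Kd[of "\<bar>\<sigma> - \<sigma>0\<bar>"] ds by simp
        have ts: "t - r2 < s" using near[OF d(3)] less by linarith
        have hs: "0 \<le> t - r2" "dist (left_val h t) (h s) \<le> e / 3" using r2(2)[OF s(1) ts less] by auto
        have "dist (left_val h t) (left_val h s) \<le> e / 3"
          using ts hs(1) less s t by (intro left_val_dist_le[OF h _ _ ts] conjunct2[OF r2(2)]) auto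
        then have "dist (left_val h t) ?\<xi> \<le> e / 3" using hs by (intro ball)
        then show ?thesis using 1 dist_triangle3[of ?\<xi> ?z "left_val h t"] by linarith
      qed
      moreover have "dist s t < e / 3" using near[OF d(4)] by (simp add: dist_real_def)
      moreover have "dist (\<gamma> \<sigma>) (\<gamma> \<sigma>0) \<le> dist s t + dist ?\<xi> ?z"
        unfolding \<gamma>0 \<gamma>s dist_Pair_Pair by (intro sqrt_sum_squares_le_sum zero_le_dist)
      ultimately show "dist (\<gamma> \<sigma>) (\<gamma> \<sigma>0) < e" by linarith
    qed (rule d(1))
  qed
  have eq: "\<exists>c\<in>{0..1}. \<sigma> = b (\<theta> \<sigma>) + c * (a (\<theta> \<sigma>) - b (\<theta> \<sigma>)) \<and> (a (\<theta> \<sigma>) = b (\<theta> \<sigma>) \<longrightarrow> c = 0)"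
    if "\<sigma> \<in> {0..1}" for \<sigma>
    using \<theta>[OF that]
    by (intro bexI[of _ "(\<sigma> - b (\<theta> \<sigma>)) / (a (\<theta> \<sigma>) - b (\<theta> \<sigma>))"]) (auto simp: divide_le_eq)
  have "inj_on \<gamma> {0..1}"
  proof (rule inj_onI)
    fix x y assume xy: "x \<in> {0..1}" "y \<in> {0..1}" "\<gamma> x = \<gamma> y"
    then have th: "\<theta> x = \<theta> y" by (simp add: \<gamma>_def)
    define t where "t = \<theta> x"
    have t: "t \<in> {0..1}" using \<theta>(1)[OF xy(1)] by (simp add: t_def)
    obtain c c' where c: "c \<in> {0..1}" "x = b t + c * (a t - b t)" "a t = b t \<Longrightarrow> c = 0"
      "c' \<in> {0..1}" "y = b t + c' * (a t - b t)" "a t = b t \<Longrightarrow> c' = 0"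
      using eq[OF xy(1)] eq[OF xy(2)] th unfolding t_def by metis
    show "x = y"
    proof (cases "t \<in> J")
      case True
      have "c *\<^sub>R (h t - left_val h t) = c' *\<^sub>R (h t - left_val h t)"
        using xy(3) \<gamma>[OF t c(1)] \<gamma>[OF t c(4)] unfolding c(2) c(5) by simp
      then have "c = c'" using True by (simp add: J_def)
      then show ?thesis using c by simp
    next
      case False
      then show ?thesis using c abJ[OF t] by simp
    qed
  qed
  moreover have "\<gamma> ` {0..1} = Gamma' h"
  proof (intro subset_antisym subsetI)
    fix p assume "p \<in> \<gamma> ` {0..1}"
    then obtain \<sigma> where \<sigma>: "\<sigma> \<in> {0..1}" "p = \<gamma> \<sigma>" by blast
    obtain c where c: "c \<in> {0..1}" "\<sigma> = b (\<theta> \<sigma>) + c * (a (\<theta> \<sigma>) - b (\<theta> \<sigma>))" using eq[OF \<sigma>(1)] by blast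
    have "p = (\<theta> \<sigma>, left_val h (\<theta> \<sigma>) + c *\<^sub>R (h (\<theta> \<sigma>) - left_val h (\<theta> \<sigma>)))"
      using \<gamma>[OF \<theta>(1)[OF \<sigma>(1)] c(1)] c(2) \<sigma>(2) by simp
    then show "p \<in> Gamma' h" using \<theta>(1)[OF \<sigma>(1)] c(1)
      by (auto simp: Gamma'_def in_segment algebra_simps intro!: exI[of _ c])
  next
    fix p assume "p \<in> Gamma' h"
    then obtain t x where p: "p = (t, x)" "t \<in> {0..1}" "x \<in> closed_segment (left_val h t) (h t)"
      by (auto simp: Gamma'_def)
    then obtain c where c: "c \<in> {0..1}" "x = left_val h t + c *\<^sub>R (h t - left_val h t)"
      by (auto simp: in_segment algebra_simps)
    have "p = \<gamma> (b t + c * (a t - b t))" using \<gamma>[OF p(2) c(1)] c p by simp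
    moreover have "b t + c * (a t - b t) \<in> {0..1}" using between[OF c(1), of t] range[OF p(2)] by auto
    ultimately show "p \<in> \<gamma> ` {0..1}" by blast
  qed
  moreover have "\<gamma> 0 = (0, 0)" using \<gamma>[of 0 0] b0 by (simp add: left_val_def)
  ultimately have "\<gamma> \<in> Pi' h" using cont by (simp add: Pi'_def bij_betw_def)
  from that[OF this b0 a1 ba lt \<gamma> ex] show ?thesis .
qed

text \<open>A jump of \<open>h\<close> at \<open>t j\<close> is matched with the steep piece of \<open>g\<close> over
  \<open>[r (2 * j), r (2 * j + 1)]\<close>; between two such windows both paths stay in a small ball.\<close>

lemma rho1'_jump_windows:
  fixes h :: "real \<Rightarrow> 'a::euclidean_space"
  assumes h: "h \<in> D01" and t: "nodes t N" and r: "nodes r (2 * N + 1)"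
    and g: "continuous_on {0..1} g" "g 0 = 0"
    and lin: "\<And>i c. i < 2 * N + 1 \<Longrightarrow> c \<in> {0..1} \<Longrightarrow>
      g (r i + c * (r (Suc i) - r i)) = g (r i) + c *\<^sub>R (g (r (Suc i)) - g (r i))"
    and osc: "\<And>j s. j < N \<Longrightarrow> t j \<le> s \<Longrightarrow> s < t (Suc j) \<Longrightarrow> dist (h (t j)) (h s) \<le> e1"
    and pre: "\<And>j. j \<le> N \<Longrightarrow> dist (g (r (2 * j))) (left_val h (t j)) \<le> e1"
    and post: "\<And>j. j \<le> N \<Longrightarrow> dist (g (r (2 * j + 1))) (h (t j)) \<le> e1"
    and time: "\<And>j. j \<le> N \<Longrightarrow> t j \<le> r (2 * j) + e2" "\<And>j. j \<le> N \<Longrightarrow> r (2 * j + 1) \<le> t j + e2"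
      "\<And>j. j < N \<Longrightarrow> r (2 * j + 2) \<le> t j + e2" "\<And>j. j < N \<Longrightarrow> t (Suc j) \<le> r (2 * j + 1) + e2"
  shows "rho1' g h \<le> 3 * e1 + e2"
proof -
  obtain \<gamma> a b where \<gamma>: "\<gamma> \<in> Pi' h" and b0: "b 0 = 0" and a1: "a 1 = 1" and ba: "\<And>t. b t \<le> a t"
    and lt: "\<And>s t. s < t \<Longrightarrow> a s < b t"
    and val: "\<And>t c. t \<in> {0..1} \<Longrightarrow> c \<in> {0..1} \<Longrightarrow>
        \<gamma> (b t + c * (a t - b t)) = (t, left_val h t + c *\<^sub>R (h t - left_val h t))"
    and ex: "\<And>\<sigma>. \<sigma> \<in> {0..1} \<Longrightarrow> \<exists>t\<in>{0..1}. b t \<le> \<sigma> \<and> \<sigma> \<le> a t"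
    using D01_parametrization[OF h] by metis
  have e1: "0 \<le> e1" using post[of 0] zero_le_dist order_trans by blast
  \<comment> \<open>Clock values to be reached at the nodes \<open>r i\<close>: at even indices the
    jump at \<open>t j\<close> begins, at odd ones it is complete. The polygon
    \<open>\<beta>\<close> through them synchronizes the two graphs.\<close>
  define B where "B i = (if even i then b (t (i div 2)) else a (t (i div 2)))" for i :: nat
  have Bev: "B (2 * j) = b (t j)" and Bod: "B (2 * j + 1) = a (t j)" for j by (auto simp: B_def)
  have t01: "t j \<in> {0..1}" if "j \<le> N" for j using nodes_range[OF t that] by simp
  define \<beta> where "\<beta> = pw_linear r (\<lambda>i. B (Suc i) - B i) (2 * N + 1)"
  have B0: "B 0 = 0" using b0 t by (simp add: B_def nodes_def)
  have Bstep: "B i \<le> B (Suc i)" if "i < 2 * N + 1" for i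
  proof (cases "even i")
    case True
    then show ?thesis using ba by (auto simp: B_def)
  next
    case False
    then obtain j where j: "i = 2 * j + 1" using oddE by blast
    have "t j < t (Suc j)" using that j by (intro nodes_step[OF t]) simp
    then show ?thesis using lt[of "t j" "t (Suc j)"] j Bod[of j] Bev[of "Suc j"] by simp
  qed
  have \<beta>: "reparam \<beta>" unfolding \<beta>_def
    by (rule reparam_pw_linear[OF r B0 _ Bstep]) (use a1 t in \<open>simp_all add: B_def nodes_def\<close>)
  show ?thesis
  proof (rule rho1'_le_reparam[OF graph_Pi'[OF g] \<gamma> reparam_id \<beta>])
    fix s :: real assume s01: "s \<in> {0..1}"
    then obtain i where i: "i < 2 * N + 1" "r i \<le> s" "s \<le> r (Suc i)"
      using nodes_slot_closed[OF r, of s] by auto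
    obtain c where c: "c \<in> {0..1}" "s = r i + c * (r (Suc i) - r i)"
      by (rule slot_param[OF nodes_step[OF r i(1)] i(2,3)])
    have \<beta>s: "\<beta> s = B i + c * (B (Suc i) - B i)"
      unfolding \<beta>_def c(2) using pw_linear_telescope_slot[where b = B, OF r i(1) c(1) B0] by simp
    have gs: "g s = g (r i) + c *\<^sub>R (g (r (Suc i)) - g (r i))"
      unfolding c(2) by (rule lin[OF i(1) c(1)])
    have conv: "dist y (g s) \<le> d" if "dist y (g (r i)) \<le> d" "dist y (g (r (Suc i))) \<le> d" for y d
    proof -
      have "g s \<in> closed_segment (g (r i)) (g (r (Suc i)))"
        using c(1) by (auto simp: in_segment gs algebra_simps intro!: exI[of _ c])
      then show ?thesis
        using closed_segment_subset[of "g (r i)" "cball y d" "g (r (Suc i))"] that by auto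
    qed
    have "dist s (fst (\<gamma> (\<beta> s))) \<le> e2 \<and> dist (g s) (snd (\<gamma> (\<beta> s))) \<le> 3 * e1"
    proof (cases "even i")
      case True
      then obtain j where j: "i = 2 * j" by blast
      then have jN: "j \<le> N" using i(1) by simp
      have \<gamma>s: "\<gamma> (\<beta> s) = (t j, left_val h (t j) + c *\<^sub>R (h (t j) - left_val h (t j)))"
        unfolding \<beta>s j using val[OF t01[OF jN] c(1)] Bev[of j] Bod[of j] by simp
      have "g s - snd (\<gamma> (\<beta> s)) = (1 - c) *\<^sub>R (g (r (2 * j)) - left_val h (t j))
          + c *\<^sub>R (g (r (2 * j + 1)) - h (t j))"
        unfolding \<gamma>s gs j by (simp add: algebra_simps)
      then have "dist (g s) (snd (\<gamma> (\<beta> s))) \<le> norm ((1 - c) *\<^sub>R (g (r (2 * j)) - left_val h (t j)))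
          + norm (c *\<^sub>R (g (r (2 * j + 1)) - h (t j)))"
        by (simp only: dist_norm norm_triangle_ineq)
      also have "\<dots> \<le> (1 - c) * e1 + c * e1"
        using c(1) pre[OF jN] post[OF jN]
        by (intro add_mono) (auto simp: dist_norm intro!: mult_left_mono)
      finally have "dist (g s) (snd (\<gamma> (\<beta> s))) \<le> 3 * e1" using e1 by (simp add: algebra_simps)
      moreover have "dist s (fst (\<gamma> (\<beta> s))) \<le> e2"
        using i j time(1,2)[OF jN] by (auto simp: \<gamma>s dist_real_def)
      ultimately show ?thesis by blast
    next
      case False
      then obtain j where j: "i = 2 * j + 1" using oddE by blast
      then have jN: "j < N" using i(1) by simp
      have tt: "t j < t (Suc j)" by (rule nodes_step[OF t jN])
      have "B i \<le> \<beta> s \<and> \<beta> s \<le> B (Suc i)"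
        using c(1) Bstep[OF i(1)] mult_left_le_one_le[of "B (Suc i) - B i" c] by (auto simp: \<beta>s)
      then have bs: "a (t j) \<le> \<beta> s" "\<beta> s \<le> b (t (Suc j))" using j Bod[of j] Bev[of "Suc j"] by auto
      obtain x where x: "x \<in> {0..1}" "b x \<le> \<beta> s" "\<beta> s \<le> a x" using ex[OF reparam_range[OF \<beta> s01]] by blast
      have xt: "t j \<le> x" "x \<le> t (Suc j)"
        using lt[of x "t j"] lt[of "t (Suc j)" x] ba[of "t j"] ba[of "t (Suc j)"] bs x by linarith+
      have left: "dist (h (t j)) (left_val h y) \<le> e1" if "t j < y" "y \<le> t (Suc j)" for y
        using that t01[of j] t01[of "Suc j"] jN osc[OF jN] by (intro left_val_dist_le[OF h, of y "t j"]) auto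
      have "\<exists>p. \<gamma> (\<beta> s) = (x, p) \<and> dist (h (t j)) p \<le> e1"
      proof -
        \<comment> \<open>At the two ends only one endpoint of the jump segment is visited: at
          \<open>t j\<close> the jump is already over, at \<open>t (Suc j)\<close> it has not
          started. Strictly inside, the whole segment is near \<open>h (t j)\<close>.\<close>
        consider "x = t j" | "x = t (Suc j)" | "t j < x" "x < t (Suc j)" using xt by linarith
        then show ?thesis
        proof cases
          case 1
          then have "\<beta> s = b x + 1 * (a x - b x)" using bs x by simp
          then have "\<gamma> (\<beta> s) = (x, h x)" using val[OF x(1), of 1] by simp
          then show ?thesis using 1 e1 by simp
        next
          case 2
          then have "\<beta> s = b x + 0 * (a x - b x)" using bs x by simp
          then have "\<gamma> (\<beta> s) = (x, left_val h x)" using val[OF x(1), of 0] by simp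
          then show ?thesis using 2 left tt by simp
        next
          case 3
          define u where "u = (\<beta> s - b x) / (a x - b x)"
          have u: "u \<in> {0..1}" "\<beta> s = b x + u * (a x - b x)" using x by (auto simp: u_def divide_le_eq)
          let ?p = "left_val h x + u *\<^sub>R (h x - left_val h x)"
          have "?p \<in> closed_segment (left_val h x) (h x)"
            using u(1) by (auto simp: in_segment algebra_simps intro!: exI[of _ u])
          then have "dist (h (t j)) ?p \<le> e1"
            using closed_segment_subset[of "left_val h x" "cball (h (t j)) e1" "h x"] left[of x] osc[OF jN, of x] 3
            by auto
          moreover have "\<gamma> (\<beta> s) = (x, ?p)" unfolding u(2) by (rule val[OF x(1) u(1)])
          ultimately show ?thesis by blast
        qed
      qed
      then obtain p where p: "\<gamma> (\<beta> s) = (x, p)" "dist (h (t j)) p \<le> e1" by blast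
      have "dist (h (t j)) (g (r i)) \<le> 2 * e1"
        using post[of j] jN e1 j by (simp add: dist_commute)
      moreover have "dist (h (t j)) (g (r (Suc i))) \<le> 2 * e1"
        using pre[of "Suc j"] left[OF tt] jN j dist_triangle[of "h (t j)" "g (r (Suc i))" "left_val h (t (Suc j))"]
        by (simp add: dist_commute)
      ultimately have "dist (h (t j)) (g s) \<le> 2 * e1" by (rule conv)
      then have "dist (g s) p \<le> 3 * e1" using p(2) dist_triangle3[of "g s" p "h (t j)"] by linarith
      moreover have "dist s x \<le> e2"
        using xt i j time(3,4)[OF jN] by (auto simp: dist_real_def)
      ultimately show ?thesis by (simp add: p(1))
    qed
    moreover have "dist (s, g s) (\<gamma> (\<beta> s)) \<le> dist s (fst (\<gamma> (\<beta> s))) + dist (g s) (snd (\<gamma> (\<beta> s)))"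
      unfolding dist_prod_def by (auto intro!: sqrt_sum_squares_le_sum)
    ultimately show "dist (s, g s) (\<gamma> (\<beta> s)) \<le> 3 * e1 + e2" by linarith
  qed
qed

text \<open>Window \<open>j\<close> runs from index \<open>2 * j\<close> to \<open>2 * j + 1\<close>
  and ends at \<open>t j\<close>, so a polygon through these nodes samples \<open>h\<close> just
  before and at the jump. Window 0 lies to the right of its node, as time cannot precede 0.\<close>

definition windows :: "(nat \<Rightarrow> real) \<Rightarrow> real \<Rightarrow> nat \<Rightarrow> real" where
  "windows t \<eta> i = (if i = 0 then 0 else if i = 1 then \<eta>
     else if even i then t (i div 2) - \<eta> else t (i div 2))"

lemma nodes_windows:
  assumes t: "nodes t N" and \<eta>: "0 < \<eta>" "\<And>j. j < N \<Longrightarrow> t j + 2 * \<eta> < t (Suc j)"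
  shows "nodes (windows t \<eta>) (2 * N + 1)"
  unfolding nodes_def
proof (intro conjI allI impI)
  show "windows t \<eta> 0 = 0" by (simp add: windows_def)
  show "windows t \<eta> (2 * N + 1) = 1" using nodes_pos[OF t] t by (simp add: windows_def nodes_def)
  fix i assume i: "i < 2 * N + 1"
  consider "i = 0" | "i = 1" | j where "i = 2 * Suc j" | j where "i = 2 * Suc j + 1"
    by (metis One_nat_def Suc_eq_plus1 evenE mult_0_right not0_implies_Suc oddE)
  then show "windows t \<eta> i < windows t \<eta> (Suc i)"
  proof cases
    case 2
    then show ?thesis using \<eta>(2)[of 0] nodes_pos[OF t] t by (simp add: windows_def nodes_def)
  next
    case (4 j)
    then show ?thesis using \<eta>(1) \<eta>(2)[of "Suc j"] i by (simp add: windows_def)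
  qed (use \<eta>(1) in \<open>auto simp: windows_def\<close>)
qed

lemma nodes_partition:
  assumes "nodes r K"
  shows "r ` {1..K} \<in> partitions01" "r ` {..K} = insert 0 (insert 1 (r ` {1..K}))"
proof -
  have "0 < r i \<and> r i \<le> 1" if "i \<in> {1..K}" for i
    using nodes_less[OF assms, of 0 i] nodes_range[OF assms, of i] that assms by (auto simp: nodes_def)
  then show "r ` {1..K} \<in> partitions01" by (auto simp: partitions01_def)
  have "{..K} = insert 0 {1..K}" by auto
  moreover have "1 \<in> r ` {1..K}" using nodes_pos[OF assms] assms by (force simp: nodes_def)
  ultimately show "r ` {..K} = insert 0 (insert 1 (r ` {1..K}))" using assms by (auto simp: nodes_def)
qed

text \<open>The sample at \<open>t j - \<eta>\<close> stands in for the left limit at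
  \<open>t j\<close>; both lie within \<open>e1\<close> of the value at the start of the slot. This
  doubles the space error fed into \<open>rho1'_jump_windows\<close>, hence the factor 6.\<close>

lemma rho1'_pl_windows:
  fixes h :: "real \<Rightarrow> 'a::euclidean_space"
  assumes h: "h \<in> D01" and t: "nodes t N"
    and osc: "\<And>j s. j < N \<Longrightarrow> t j \<le> s \<Longrightarrow> s < t (Suc j) \<Longrightarrow> dist (h (t j)) (h s) \<le> e1"
    and mesh: "\<And>j. j < N \<Longrightarrow> t (Suc j) \<le> t j + e2"
    and \<eta>: "0 < \<eta>" "\<eta> \<le> e2" "\<And>j. j < N \<Longrightarrow> t j + 2 * \<eta> < t (Suc j)"
  shows "rho1' (pl h (windows t \<eta> ` {1..2 * N + 1})) h \<le> 6 * e1 + e2"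
proof -
  let ?r = "windows t \<eta>"
  have r: "nodes ?r (2 * N + 1)" by (rule nodes_windows[OF t \<eta>(1,3)])
  define B where "B i = start0 h (?r i)" for i
  have B0: "B 0 = 0" by (simp add: B_def windows_def start0_def)
  define g where "g = pw_linear ?r (\<lambda>i. B (Suc i) - B i) (2 * N + 1)"
  have g: "pl h (?r ` {1..2 * N + 1}) = g"
    unfolding g_def B_def by (rule pl_eq_pw_linear[OF r nodes_partition(2)[OF r]])
  have gr: "g (?r i) = B i" if "i \<le> 2 * N + 1" for i
    unfolding g_def pw_linear_node[OF r that] using sum_lessThan_telescope[of B i] B0 by simp
  have e1: "0 \<le> e1" using osc[of 0 "t 0"] nodes_step[OF t nodes_pos[OF t]] nodes_pos[OF t] by simp
  have n0: "t 0 = 0" "t N = 1" using t by (auto simp: nodes_def)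
  have first: "dist (h 0) (h \<eta>) \<le> e1"
    using osc[of 0 \<eta>] \<eta>(1) \<eta>(3)[of 0] nodes_pos[OF t] n0 by simp
  have "rho1' g h \<le> 3 * (2 * e1) + e2"
  proof (rule rho1'_jump_windows[OF h t r])
    show "continuous_on {0..1} g" unfolding g_def by (rule continuous_on_pw_linear[OF r])
    show "g 0 = 0" unfolding g_def by (rule pw_linear_0[OF r])
    show "g (?r i + c * (?r (Suc i) - ?r i)) = g (?r i) + c *\<^sub>R (g (?r (Suc i)) - g (?r i))"
      if "i < 2 * N + 1" "c \<in> {0..1}" for i c
      using pw_linear_telescope_slot[where b = B, OF r that B0] gr[of i] gr[of "Suc i"] that(1) by (simp add: g_def)
    show "dist (h (t j)) (h s) \<le> 2 * e1" if "j < N" "t j \<le> s" "s < t (Suc j)" for j s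
      using osc[OF that] e1 by simp
    show "dist (g (?r (2 * j))) (left_val h (t j)) \<le> 2 * e1" if "j \<le> N" for j
    proof (cases j)
      case 0
      then show ?thesis using e1 n0 gr[of 0] B0 by (simp add: left_val_def windows_def)
    next
      case (Suc i)
      have tt: "t i < t j" "t i < t j - \<eta>" using \<eta>(1) \<eta>(3)[of i] Suc that by auto
      have ti: "0 \<le> t i" "t j \<le> 1" using nodes_range[OF t, of i] nodes_range[OF t, of j] Suc that by auto
      have "dist (h (t i)) (left_val h (t j)) \<le> e1"
        using tt ti osc[of i] Suc that by (intro left_val_dist_le[OF h _ _ tt(1)]) auto
      moreover have "dist (h (t i)) (h (t j - \<eta>)) \<le> e1"
        using tt \<eta>(1) Suc that by (intro osc) auto
      moreover have "g (?r (2 * j)) = h (t j - \<eta>)"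
        using gr[of "2 * j"] that Suc tt ti by (simp add: B_def windows_def start0_def)
      ultimately show ?thesis
        using dist_triangle3[of "h (t j - \<eta>)" "left_val h (t j)" "h (t i)"] by simp
    qed
    show "dist (g (?r (2 * j + 1))) (h (t j)) \<le> 2 * e1" if "j \<le> N" for j
    proof (cases j)
      case 0
      then show ?thesis using e1 n0 gr[of 1] first \<eta>(1) by (simp add: B_def windows_def start0_def dist_commute)
    next
      case (Suc i)
      then have "t j > 0" using nodes_less[OF t, of 0 j] that n0 by simp
      then show ?thesis using gr[of "2 * j + 1"] that Suc e1 by (simp add: B_def windows_def start0_def)
    qed
    show "t j \<le> ?r (2 * j) + e2" if "j \<le> N" for j
      using \<eta> n0 by (cases j) (auto simp: windows_def)
    show "?r (2 * j + 1) \<le> t j + e2" if "j \<le> N" for j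
      using \<eta> n0 by (cases j) (auto simp: windows_def)
    show "?r (2 * j + 2) \<le> t j + e2" if "j < N" for j
      using \<eta>(1) mesh[OF that] by (auto simp: windows_def)
    show "t (Suc j) \<le> ?r (2 * j + 1) + e2" if "j < N" for j
      using \<eta>(1) n0 mesh[OF that] by (cases j) (auto simp: windows_def)
  qed
  then show ?thesis unfolding g by simp
qed

lemma D01_pl_approx:
  fixes h :: "real \<Rightarrow> 'a::euclidean_space"
  assumes h: "h \<in> D01" and e: "e > 0"
  obtains T where "T \<in> partitions01" "rho1' (pl h T) h < e"
proof -
  \<comment> \<open>The bound from \<open>rho1'_pl_windows\<close> becomes 7/8 of \<open>e\<close>,
    which keeps the conclusion strict.\<close>
  have e8: "e / 8 > 0" using e by simp
  obtain t N where t: "nodes t N" "\<And>j. j < N \<Longrightarrow> t (Suc j) \<le> t j + e / 8"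
    "\<And>j s. j < N \<Longrightarrow> t j \<le> s \<Longrightarrow> s < t (Suc j) \<Longrightarrow> dist (h (t j)) (h s) \<le> e / 8"
    using D01_nodes[OF h e8] by metis
  define d where "d = Min ((\<lambda>j. t (Suc j) - t j) ` {..<N})"
  have ne: "{..<N} \<noteq> {}" using nodes_pos[OF t(1)] by auto
  have d0: "d > 0" unfolding d_def using ne nodes_step[OF t(1)] by (subst Min_gr_iff) auto
  have dle: "d \<le> t (Suc j) - t j" if "j < N" for j unfolding d_def using that by (intro Min_le) auto
  define \<eta> where "\<eta> = d / 3"
  have \<eta>: "0 < \<eta>" "\<eta> \<le> e / 8" "\<And>j. j < N \<Longrightarrow> t j + 2 * \<eta> < t (Suc j)"
  proof -
    show "0 < \<eta>" using d0 by (simp add: \<eta>_def)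
    show "\<eta> \<le> e / 8" using dle[of 0] t(2)[of 0] nodes_pos[OF t(1)] d0 by (auto simp: \<eta>_def)
    show "t j + 2 * \<eta> < t (Suc j)" if "j < N" for j using dle[OF that] d0 by (simp add: \<eta>_def)
  qed
  have "rho1' (pl h (windows t \<eta> ` {1..2 * N + 1})) h \<le> 6 * (e / 8) + e / 8"
    by (rule rho1'_pl_windows[OF h t(1,3,2) \<eta>])
  then have "rho1' (pl h (windows t \<eta> ` {1..2 * N + 1})) h < e" using e by simp
  moreover have "windows t \<eta> ` {1..2 * N + 1} \<in> partitions01"
    by (rule nodes_partition[OF nodes_windows[OF t(1) \<eta>(1,3)]])
  ultimately show ?thesis using that by blast
qed

section \<open>Step paths and their polygons\<close>

lemma step_path_eq:
  assumes "0 < n" "s \<in> {0..1}" "real k / real n \<le> s" "s < real (Suc k) / real n"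
  shows "step_path X n \<omega> s = Ssum X k \<omega> /\<^sub>R real n"
proof -
  have "real k \<le> real n * s" "real n * s < real k + 1" using assms by (auto simp: field_simps)
  then have "\<lfloor>real n * s\<rfloor> = int k" by (simp add: floor_eq_iff)
  then show ?thesis using assms by (simp add: step_path_def divide_inverse)
qed

lemma step_path_node:
  assumes "0 < n" "k \<le> n"
  shows "step_path X n \<omega> (real k / real n) = Ssum X k \<omega> /\<^sub>R real n"
  using assms by (intro step_path_eq) (auto simp: divide_simps)

lemma unit_slot:
  assumes "0 < n" "0 \<le> s"
  obtains k where "real k / real n \<le> s" "s < real (Suc k) / real n"
proof -
  define k where "k = nat \<lfloor>real n * s\<rfloor>"
  have f: "real k = of_int \<lfloor>real n * s\<rfloor>" using assms by (simp add: k_def)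
  have "real k \<le> real n * s" "real n * s < real k + 1" unfolding f by linarith+
  then show ?thesis using assms by (intro that[of k]) (auto simp: field_simps)
qed

lemma unit_slot_left:
  assumes "0 < n" "0 < s" "s \<le> 1"
  obtains k where "k < n" "real k / real n < s" "s \<le> real (Suc k) / real n"
proof -
  obtain k where k: "real k / real n \<le> s" "s < real (Suc k) / real n" using unit_slot[OF assms(1), of s] assms by auto
  show ?thesis
  proof (cases "real k / real n = s")
    case True
    then have "k > 0" using assms by (cases k) auto
    moreover have "k \<le> n"
    proof -
      have "s * real n \<le> 1 * real n" using assms by (intro mult_right_mono) auto
      moreover have "real k = s * real n" using True assms(1) by (auto simp: field_simps)
      ultimately have "real k \<le> real n" by linarith
      then show ?thesis by simp
    qed
    ultimately show ?thesis using True assms(1)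
      by (intro that[of "k - 1"]) (auto simp: divide_strict_right_mono of_nat_diff divide_simps)
  next
    case False
    then have "real k / real n < 1" using k assms by linarith
    then show ?thesis using False k assms by (intro that[of k]) (auto simp: divide_simps)
  qed
qed

lemma step_path_D01:
  fixes X :: "nat \<Rightarrow> 'b \<Rightarrow> 'a::euclidean_space"
  assumes n: "0 < n"
  shows "step_path X n \<omega> \<in> D01"
proof -
  have "continuous (at_right t) (step_path X n \<omega>)" if t: "t \<in> {0..<1}" for t
  proof -
    obtain k where k: "real k / real n \<le> t" "t < real (Suc k) / real n" using unit_slot[OF n, of t] t by auto
    have "\<forall>\<^sub>F s in at_right t. step_path X n \<omega> s = step_path X n \<omega> t"
      unfolding eventually_at_right_field using k t n
      by (intro exI[of _ "min 1 (real (Suc k) / real n)"]) (auto simp: step_path_eq[OF n, of _ k])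
    then show ?thesis unfolding continuous_within by (rule tendsto_eventually)
  qed
  moreover have "\<exists>l. (step_path X n \<omega> \<longlongrightarrow> l) (at_left t)" if t: "t \<in> {0<..1}" for t
  proof -
    obtain k where k: "real k / real n < t" "t \<le> real (Suc k) / real n" using unit_slot_left[OF n, of t] t by auto
    have "\<forall>\<^sub>F s in at_left t. step_path X n \<omega> s = Ssum X k \<omega> /\<^sub>R real n"
      unfolding eventually_at_left_field
    proof (intro exI conjI allI impI)
      fix s assume s: "real k / real n < s" "s < t"
      have "0 \<le> real k / real n" by simp
      then have "s \<in> {0..1}" using s t unfolding atLeastAtMost_iff greaterThanAtMost_iff by linarith
      then show "step_path X n \<omega> s = Ssum X k \<omega> /\<^sub>R real n" using s k by (intro step_path_eq[OF n]) auto
    qed (rule k(1))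
    then show ?thesis by (intro exI tendsto_eventually)
  qed
  ultimately show ?thesis by (auto simp: D01_def step_path_def)
qed

lemma step_path_left_val:
  fixes X :: "nat \<Rightarrow> 'b \<Rightarrow> 'a::euclidean_space"
  assumes "0 < n" "k < n"
  shows "left_val (step_path X n \<omega>) (real (Suc k) / real n) = Ssum X k \<omega> /\<^sub>R real n"
proof -
  have 0: "0 \<le> real k / real n" "real (Suc k) / real n \<le> 1" using assms by auto
  have "dist (Ssum X k \<omega> /\<^sub>R real n) (left_val (step_path X n \<omega>) (real (Suc k) / real n)) \<le> 0"
  proof (rule left_val_dist_le[OF step_path_D01[OF assms(1)], of _ "real k / real n"])
    fix x assume x: "real k / real n < x" "x < real (Suc k) / real n"
    then have "0 \<le> x" using 0 by linarith
    then show "dist (Ssum X k \<omega> /\<^sub>R real n) (step_path X n \<omega> x) \<le> 0"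
      using 0 x \<open>0 \<le> x\<close> by (subst step_path_eq[OF assms(1), of _ k]) auto
  qed (use assms in \<open>auto simp: divide_strict_right_mono\<close>)
  then show ?thesis by simp
qed

lemma var01_step_path:
  fixes X :: "nat \<Rightarrow> 'b \<Rightarrow> 'a::euclidean_space"
  assumes n: "0 < n"
  shows "var01 (step_path X n \<omega>) \<le> ennreal ((\<Sum>i<n. norm (X i \<omega>)) / real n)"
proof -
  let ?v = "\<lambda>s. (\<Sum>i<nat \<lfloor>real n * s\<rfloor>. norm (X i \<omega>)) / real n"
  have "var01 (step_path X n \<omega>) \<le> ennreal (?v 1)"
  proof (rule var01_le)
    fix a b :: real assume ab: "0 \<le> a" "a \<le> b" "b \<le> 1"
    let ?k = "nat \<lfloor>real n * a\<rfloor>" and ?l = "nat \<lfloor>real n * b\<rfloor>"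
    have kl: "?k \<le> ?l" using ab by (intro nat_mono floor_mono mult_left_mono) auto
    have split: "(\<Sum>i<?l. f i) = (\<Sum>i<?k. f i) + (\<Sum>i\<in>{?k..<?l}. f i)" for f :: "nat \<Rightarrow> 'c::comm_monoid_add"
      unfolding lessThan_atLeast0 using kl by (simp add: sum.atLeastLessThan_concat)
    have "step_path X n \<omega> b - step_path X n \<omega> a = (1 / real n) *\<^sub>R (\<Sum>i\<in>{?k..<?l}. X i \<omega>)"
      using ab split[of "\<lambda>i. X i \<omega>"] by (simp add: step_path_def Ssum_def scaleR_diff_right[symmetric])
    then have "norm (step_path X n \<omega> b - step_path X n \<omega> a) \<le> (\<Sum>i\<in>{?k..<?l}. norm (X i \<omega>)) / real n"
      using n norm_sum[of "\<lambda>i. X i \<omega>" "{?k..<?l}"] by (simp add: divide_right_mono)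
    also have "\<dots> = ?v b - ?v a"
      using split[of "\<lambda>i. norm (X i \<omega>)"] by (simp add: diff_divide_distrib[symmetric])
    finally show "norm (step_path X n \<omega> b - step_path X n \<omega> a) \<le> ?v b - ?v a" .
  next
    fix b :: real assume "0 \<le> b" "b \<le> 1"
    then show "norm (step_path X n \<omega> b) \<le> ?v b"
      using n norm_sum[of "\<lambda>i. X i \<omega>" "{..<nat \<lfloor>real n * b\<rfloor>}"]
      by (simp add: step_path_def Ssum_def divide_right_mono)
  qed
  then show ?thesis by simp
qed

lemma step_path_BV01:
  "0 < n \<Longrightarrow> step_path X n \<omega> \<in> BV01" for X :: "nat \<Rightarrow> 'b \<Rightarrow> 'a::euclidean_space"
  unfolding BV01_def using step_path_D01[of n X \<omega>] var01_step_path[of n X \<omega>]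
  by (auto simp: ennreal_less_top intro: le_less_trans)

text \<open>The polygon spends nearly the whole slot before a jump time on the step that the step
  path makes at its end, so the windows fill these slots up to strips of length
  \<open>\<mu>\<close>. The time error is one slot; the space error comes from the strips and
  vanishes with \<open>\<mu>\<close>.\<close>

lemma rho1'_poly_step:
  fixes X :: "nat \<Rightarrow> 'b \<Rightarrow> 'a::euclidean_space"
  assumes n: "0 < n"
  shows "rho1' (poly_path X n \<omega>) (step_path X n \<omega>) \<le> 1 / real n"
proof (rule field_le_epsilon)
  fix e :: real assume e: "e > 0"
  let ?g = "poly_path X n \<omega>" and ?h = "step_path X n \<omega>" and ?t = "\<lambda>j. real j / real n"
  let ?w = "\<lambda>j. X j \<omega> /\<^sub>R real n"
  note un = uniform_nodes[OF n]
  have g: "?g = pw_linear ?t ?w n" by (rule poly_path_eq_pw_linear[OF n])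
  define K where "K = (\<Sum>i<n. norm (X i \<omega>)) + 1"
  have K: "K > 0" "norm (X i \<omega>) \<le> K" if "i < n" for i
    using that member_le_sum[of i "{..<n}" "\<lambda>i. norm (X i \<omega>)"] sum_nonneg[of "{..<n}" "\<lambda>i. norm (X i \<omega>)"]
    by (auto simp: K_def)
  define \<mu> where "\<mu> = min (1 / real n / 2) (e / (3 * K))"
  have \<mu>: "0 < \<mu>" "\<mu> < 1 / real n" "3 * (\<mu> * K) \<le> e"
    using n e K(1)[of 0] by (auto simp: \<mu>_def min_def field_simps)
  have affine: "?g (?t k + x) = ?g (?t k) + x *\<^sub>R X k \<omega>" if "k < n" "0 \<le> x" "x \<le> 1 / real n" for k x
  proof -
    have "?t k \<le> ?t k + x" "?t k + x \<le> ?t (Suc k)" using that n by (auto simp: field_simps)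
    then show ?thesis unfolding g using that n pw_linear_node[OF un, of k ?w]
      by (subst pw_linear_slot[OF un that(1)]) (auto simp: field_simps)
  qed
  have gnode: "?g (?t k) = ?h (?t k)" if "k \<le> n" for k
    unfolding g pw_linear_node[OF un that] step_path_node[OF n that] by (simp add: Ssum_def scaleR_sum_right)
  \<comment> \<open>The first window ends at \<open>\<mu> / 2\<close> because index 2 already takes
    the value \<open>\<mu>\<close>.\<close>
  define r where "r i = (if i = 0 then 0 else if i = 1 then \<mu> / 2
     else if even i then ?t (i div 2 - 1) + \<mu> else ?t (i div 2))" for i
  \<comment> \<open>Both \<open>r i\<close> and \<open>r (Suc i)\<close> lie in the slot of the walk
    with this index, so the random polygon is affine between them.\<close>
  define k where "k i = (i - 1) div 2" for i :: nat
  have rk: "\<exists>x y. r i = ?t (k i) + x \<and> r (Suc i) = ?t (k i) + y \<and> 0 \<le> x \<and> x < y \<and> y \<le> 1 / real n" for i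
  proof -
    consider "i = 0" | "i = 1" | j where "i = 2 * Suc j" | j where "i = 2 * Suc j + 1"
      by (metis One_nat_def Suc_eq_plus1 evenE mult_0_right not0_implies_Suc oddE)
    then show ?thesis
    proof cases
      case 1
      then show ?thesis using \<mu>(1,2) by (intro exI[of _ 0] exI[of _ "\<mu> / 2"]) (auto simp: r_def k_def)
    next
      case 2
      then show ?thesis using \<mu>(1,2) by (intro exI[of _ "\<mu> / 2"] exI[of _ \<mu>]) (auto simp: r_def k_def)
    next
      case (3 j)
      then show ?thesis using \<mu>(1,2) by (intro exI[of _ \<mu>] exI[of _ "1 / real n"]) (auto simp: r_def k_def add_divide_distrib)
    next
      case (4 j)
      then show ?thesis using \<mu>(1,2) by (intro exI[of _ 0] exI[of _ \<mu>]) (auto simp: r_def k_def)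
    qed
  qed
  have r: "nodes r (2 * n + 1)"
    unfolding nodes_def
  proof (intro conjI allI impI)
    show "r i < r (Suc i)" for i using rk[of i] by auto
  qed (use n in \<open>auto simp: r_def\<close>)
  have "rho1' ?g ?h \<le> 3 * (\<mu> * K) + 1 / real n"
  proof (rule rho1'_jump_windows[OF step_path_D01[OF n] un r])
    show "continuous_on {0..1} ?g" unfolding g by (rule continuous_on_pw_linear[OF un])
    show "?g 0 = 0" unfolding g by (rule pw_linear_0[OF un])
    show "?g (r i + c * (r (Suc i) - r i)) = ?g (r i) + c *\<^sub>R (?g (r (Suc i)) - ?g (r i))"
      if i: "i < 2 * n + 1" and c: "c \<in> {0..1}" for i c
    proof -
      obtain x y where xy: "r i = ?t (k i) + x" "r (Suc i) = ?t (k i) + y" "0 \<le> x" "x < y" "y \<le> 1 / real n"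
        using rk[of i] by blast
      have kn: "k i < n" using i n by (auto simp: k_def)
      have "0 \<le> c * (y - x)" "c * (y - x) \<le> y - x"
        using c xy by (auto intro: mult_left_le_one_le)
      then have z: "0 \<le> x + c * (y - x)" "x + c * (y - x) \<le> 1 / real n" using xy by linarith+
      have eq: "r i + c * (r (Suc i) - r i) = ?t (k i) + (x + c * (y - x))" by (simp add: xy)
      have gx: "?g (r i) = ?g (?t (k i)) + x *\<^sub>R X (k i) \<omega>"
        and gy: "?g (r (Suc i)) = ?g (?t (k i)) + y *\<^sub>R X (k i) \<omega>"
        unfolding xy(1,2) using xy(3-5) by (auto intro!: affine[OF kn])
      show ?thesis unfolding eq affine[OF kn z] gx gy by (simp add: algebra_simps)
    qed
    show "dist (?h (?t j)) (?h s) \<le> \<mu> * K" if "j < n" "?t j \<le> s" "s < ?t (Suc j)" for j s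
    proof -
      have "0 \<le> ?t j" "?t (Suc j) \<le> 1" using that n by auto
      then have "s \<in> {0..1}" using that(2,3) unfolding atLeastAtMost_iff by linarith
      then show ?thesis using that step_path_eq[OF n _ that(2,3), of X \<omega>] step_path_node[OF n, of j X \<omega>] \<mu> K[of j] by simp
    qed
    show "dist (?g (r (2 * j))) (left_val ?h (?t j)) \<le> \<mu> * K" if "j \<le> n" for j
    proof (cases j)
      case 0
      then show ?thesis using \<mu> K[of 0] n pw_linear_0[OF un, of ?w] by (simp add: left_val_def r_def g)
    next
      case (Suc i)
      have "?g (r (2 * j)) = ?h (?t i) + \<mu> *\<^sub>R X i \<omega>"
        using affine[of i \<mu>] gnode[of i] that Suc \<mu> by (simp add: r_def)
      moreover have "left_val ?h (?t j) = ?h (?t i)"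
        using step_path_left_val[OF n, of i X \<omega>] step_path_node[OF n, of i X \<omega>] Suc that by simp
      ultimately show ?thesis using \<mu>(1) K[of i] Suc that by (simp add: dist_norm)
    qed
    show "dist (?g (r (2 * j + 1))) (?h (?t j)) \<le> \<mu> * K" if "j \<le> n" for j
    proof (cases j)
      case 0
      have "?g (?t 0 + \<mu> / 2) = ?g (?t 0) + (\<mu> / 2) *\<^sub>R X 0 \<omega>" using n \<mu> by (intro affine) auto
      then have "?g (\<mu> / 2) = ?h 0 + (\<mu> / 2) *\<^sub>R X 0 \<omega>" using gnode[of 0] by simp
      then have "dist (?g (r (2 * j + 1))) (?h (?t j)) = \<mu> / 2 * norm (X 0 \<omega>)"
        using 0 \<mu>(1) by (simp add: r_def dist_norm)
      also have "\<dots> \<le> \<mu> * K" using \<mu>(1) K[of 0] n by (intro mult_mono) auto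
      finally show ?thesis .
    next
      case (Suc i)
      then show ?thesis using gnode[OF that] \<mu>(1) K[of 0] n by (simp add: r_def)
    qed
    show "?t j \<le> r (2 * j) + 1 / real n" if "j \<le> n" for j
      using \<mu> by (cases j) (auto simp: r_def add_divide_distrib)
    show "r (2 * j + 1) \<le> ?t j + 1 / real n" if "j \<le> n" for j
      using \<mu> by (cases j) (auto simp: r_def)
    show "r (2 * j + 2) \<le> ?t j + 1 / real n" if "j < n" for j
      using \<mu> by (auto simp: r_def)
    show "?t (Suc j) \<le> r (2 * j + 1) + 1 / real n" if "j < n" for j
      using \<mu> by (cases j) (auto simp: r_def add_divide_distrib)
  qed
  then show "rho1' ?g ?h \<le> 1 / real n + e" using \<mu>(3) by linarith
qed

text \<open>On a grid refining the jump times the path is constant on every slot, so the space error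
  in \<open>rho1'_pl_windows\<close> is 0. The partition is the same for all
  \<open>\<omega>\<close>, as the measurability proof requires.\<close>

lemma step_path_pl_approx:
  fixes X :: "nat \<Rightarrow> 'b \<Rightarrow> 'a::euclidean_space"
  assumes n: "0 < n" and m: "0 < m"
  shows "rho1' (pl (step_path X n \<omega>) (windows (\<lambda>j. real j / real (n * m)) (1 / (3 * real (n * m))) ` {1..2 * (n * m) + 1}))
           (step_path X n \<omega>) \<le> 1 / real (n * m)"
proof -
  let ?N = "n * m" and ?h = "step_path X n \<omega>"
  have N: "0 < ?N" using n m by simp
  have "rho1' (pl ?h (windows (\<lambda>j. real j / real ?N) (1 / (3 * real ?N)) ` {1..2 * ?N + 1})) ?h
      \<le> 6 * 0 + 1 / real ?N"
  proof (rule rho1'_pl_windows[OF step_path_D01[OF n] uniform_nodes[OF N]])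
    fix j s assume js: "j < ?N" "real j / real ?N \<le> s" "s < real (Suc j) / real ?N"
    define k where "k = j div m"
    have "k * m \<le> j" "Suc j \<le> Suc k * m"
      using m dividend_less_div_times[of m j] by (auto simp: k_def)
    then have "real (k * m) / real ?N \<le> real j / real ?N" "real (Suc j) / real ?N \<le> real (Suc k * m) / real ?N"
      by (intro divide_right_mono; simp only: of_nat_le_iff of_nat_0_le_iff)+
    moreover have "real (k * m) / real ?N = real k / real n" "real (Suc k * m) / real ?N = real (Suc k) / real n"
      unfolding of_nat_mult by (rule mult_divide_mult_cancel_right, use m in simp)+
    moreover have "0 \<le> real j / real ?N" "real (Suc j) / real ?N \<le> 1" using js(1) by (auto simp: divide_simps simp flip: of_nat_Suc of_nat_mult)
    ultimately have "real k / real n \<le> real j / real ?N" "real j / real ?N < real (Suc k) / real n"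
      "real k / real n \<le> s" "s < real (Suc k) / real n" "real j / real ?N \<in> {0..1}" "s \<in> {0..1}"
      using js unfolding atLeastAtMost_iff by linarith+
    then show "dist (?h (real j / real ?N)) (?h s) \<le> 0" by (simp add: step_path_eq[OF n, of _ k])
  qed (use N in \<open>auto simp: field_simps simp flip: of_nat_mult\<close>)
  then show ?thesis by simp
qed

section \<open>Cramer's theorem for tubes and cells\<close>

definition psum :: "nat \<Rightarrow> (nat \<Rightarrow> 'a::comm_monoid_add) \<Rightarrow> 'a" where
  "psum n x = (\<Sum>i<n. x i)"

definition shift :: "nat \<Rightarrow> (nat \<Rightarrow> 'a) \<Rightarrow> nat \<Rightarrow> 'a" where
  "shift k x = (\<lambda>i. x (k + i))"

lemma psum_add: "psum (m + n) x = psum m x + psum n (shift m x)"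
proof (induction n)
  case (Suc n)
  then show ?case by (simp add: psum_def shift_def add.assoc)
qed (simp add: psum_def)

lemma psum_0 [simp]: "psum 0 x = 0"
  by (simp add: psum_def)

lemma psum_cong: "(\<And>i. i < n \<Longrightarrow> x i = y i) \<Longrightarrow> psum n x = psum n y"
  unfolding psum_def by (intro sum.cong) auto

text \<open>The walk is studied on the canonical space of sequences with product law
  \<open>S\<close>; the result is carried back to the given random vectors at the end.\<close>

locale iid_law = prob_space \<mu> for \<mu> :: "'a::euclidean_space measure" +
  assumes sets_law [measurable_cong]: "sets \<mu> = sets borel"

sublocale iid_law \<subseteq> sequence_space \<mu>
  by unfold_locales

context iid_law
begin

definition law_dom :: "'a set" where "law_dom = Laplace_dom \<mu> (\<lambda>x. x)"

definition \<Lambda> :: "'a \<Rightarrow> real" where "\<Lambda> = log_mgf \<mu> (\<lambda>x. x)"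

definition rate :: "'a \<Rightarrow> ereal" where "rate = rate_I \<mu> (\<lambda>x. x)"

lemma space_law [simp]: "space \<mu> = UNIV"
  using sets_eq_imp_space_eq[OF sets_law] by simp

lemma space_S [simp]: "space S = UNIV"
  by (simp add: space_PiM PiE_UNIV_domain)

lemma measurable_law: "f \<in> measurable borel N \<Longrightarrow> f \<in> measurable \<mu> N"
  using measurable_cong_sets[OF sets_law refl] by blast

lemma measurable_coord [measurable]: "(\<lambda>x. x i) \<in> measurable S borel"
proof -
  have "(\<lambda>x. x i) \<in> measurable S \<mu>" by measurable
  then show ?thesis using measurable_cong_sets[OF refl sets_law] by blast
qed

lemma measurable_psum [measurable]: "psum n \<in> measurable S borel"
  unfolding psum_def[abs_def] by measurable

lemma psum_event:
  assumes "{z. Q z} \<in> sets borel"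
  shows "{x. Q (psum n x)} \<in> sets S"
  using measurable_sets[OF measurable_psum assms, of n] by (simp add: vimage_def)

lemma psum_near_event [measurable]: "{x. norm (psum n x - a) \<le> \<alpha>} \<in> sets S"
  by (rule psum_event) measurable

lemma psum_halfspace_event [measurable]: "{x. c \<le> u \<bullet> psum n x} \<in> sets S"
  by (rule psum_event) measurable

lemma psum_mean_event [measurable]: "C \<in> sets borel \<Longrightarrow> {x. psum n x /\<^sub>R r \<in> C} \<in> sets S"
proof (rule psum_event)
  assume C: "C \<in> sets borel"
  have "(\<lambda>z::'a. z /\<^sub>R r) \<in> borel_measurable borel" by measurable
  from measurable_sets[OF this C] show "{z. z /\<^sub>R r \<in> C} \<in> sets borel" by (simp add: vimage_def)
qed

lemma measurable_shift [measurable]: "shift k \<in> measurable S S"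
  unfolding shift_def[abs_def]
  by (rule measurable_PiM_single') (auto simp: PiE_UNIV_domain)

abbreviation Pr :: "(nat \<Rightarrow> 'a) set \<Rightarrow> real" where "Pr \<equiv> measure S"

text \<open>\<open>comb_seq k\<close> splices the first \<open>k\<close> entries of one sequence
  with another one, and two independent draws from \<open>S\<close> spliced in this way have law
  \<open>S\<close> again.\<close>

lemma Pr_concat:
  assumes A: "A \<in> sets S" and B: "B \<in> sets S"
    and dep: "\<And>x y. (\<And>i. i < k \<Longrightarrow> x i = y i) \<Longrightarrow> x \<in> A \<Longrightarrow> y \<in> A"
  shows "Pr {x. x \<in> A \<and> shift k x \<in> B} = Pr A * Pr B"
proof -
  let ?E = "{x. x \<in> A \<and> shift k x \<in> B}"
  let ?f = "\<lambda>(\<omega>, \<omega>'). comb_seq k \<omega> \<omega>'"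
  have E: "?E \<in> sets S"
  proof -
    have "?E = A \<inter> (shift k -` B \<inter> space S)" by auto
    then show ?thesis using A measurable_sets[OF measurable_shift B, of k] by (simp only: sets.Int)
  qed
  have sh: "shift k (comb_seq k \<omega> \<omega>') = \<omega>'" for \<omega> \<omega>' :: "nat \<Rightarrow> 'a"
    by (simp add: shift_def comb_seq_def)
  have inA: "comb_seq k \<omega> \<omega>' \<in> A \<longleftrightarrow> \<omega> \<in> A" for \<omega> \<omega>' :: "nat \<Rightarrow> 'a"
    using dep[of "comb_seq k \<omega> \<omega>'" \<omega>] dep[of \<omega> "comb_seq k \<omega> \<omega>'"] by (auto simp: comb_seq_def)
  have "emeasure S ?E = emeasure (distr (S \<Otimes>\<^sub>M S) S ?f) ?E" by (subst PiM_comb_seq) simp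
  also have "\<dots> = emeasure (S \<Otimes>\<^sub>M S) (?f -` ?E \<inter> space (S \<Otimes>\<^sub>M S))"
    by (rule emeasure_distr[OF measurable_comb_seq E])
  also have "?f -` ?E \<inter> space (S \<Otimes>\<^sub>M S) = A \<times> B"
    by (auto simp: sh inA space_pair_measure)
  also have "emeasure (S \<Otimes>\<^sub>M S) (A \<times> B) = emeasure S A * emeasure S B"
    by (rule P.emeasure_pair_measure_Times[OF A B])
  finally show ?thesis by (simp add: measure_def enn2real_mult)
qed

lemma nn_integral_prod_iid:
  fixes f :: "'a \<Rightarrow> ennreal"
  assumes f [measurable]: "f \<in> borel_measurable borel"
  shows "(\<integral>\<^sup>+x. (\<Prod>i<m. f (x i)) \<partial>S) = (\<integral>\<^sup>+y. f y \<partial>\<mu>) ^ m"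
proof (induction m)
  case 0
  then show ?case by (simp add: P.emeasure_space_1[simplified])
next
  case (Suc m)
  have f' [measurable]: "f \<in> borel_measurable \<mu>" by (rule measurable_law[OF f])
  have "(\<integral>\<^sup>+x. (\<Prod>i<Suc m. f (x i)) \<partial>S)
      = (\<integral>\<^sup>+x. (\<Prod>i<Suc m. f (x i)) \<partial>distr (\<mu> \<Otimes>\<^sub>M S) S (\<lambda>(s, \<omega>). case_nat s \<omega>))"
    by (subst PiM_iter) simp
  also have "\<dots> = (\<integral>\<^sup>+(s, \<omega>). (\<Prod>i<Suc m. f (case_nat s \<omega> i)) \<partial>(\<mu> \<Otimes>\<^sub>M S))"
    by (subst nn_integral_distr) (measurable, simp add: split_beta')
  also have "\<dots> = (\<integral>\<^sup>+(s, \<omega>). f s * (\<Prod>i<m. f (\<omega> i)) \<partial>(\<mu> \<Otimes>\<^sub>M S))"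
    by (simp add: prod.lessThan_Suc_shift del: prod.lessThan_Suc)
  also have "\<dots> = (\<integral>\<^sup>+s. (\<integral>\<^sup>+\<omega>. f s * (\<Prod>i<m. f (\<omega> i)) \<partial>S) \<partial>\<mu>)"
    by (subst P.nn_integral_fst[symmetric]) (auto simp: split_beta')
  also have "\<dots> = (\<integral>\<^sup>+s. f s * (\<integral>\<^sup>+y. f y \<partial>\<mu>) ^ m \<partial>\<mu>)"
    by (subst nn_integral_cmult) (auto simp: Suc.IH)
  also have "\<dots> = (\<integral>\<^sup>+y. f y \<partial>\<mu>) ^ Suc m"
    by (subst nn_integral_multc) auto
  finally show ?case .
qed

lemma mgf_eq:
  assumes "u \<in> law_dom"
  shows "(\<integral>\<^sup>+y. ennreal (exp (u \<bullet> y)) \<partial>\<mu>) = ennreal (exp (\<Lambda> u))"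
proof -
  let ?L = "\<integral>\<^sup>+y. ennreal (exp (u \<bullet> y)) \<partial>\<mu>"
  have fin: "?L < \<infinity>" using assms by (simp add: law_dom_def Laplace_dom_def)
  have "?L \<noteq> 0"
  proof
    assume "?L = 0"
    then have "AE y in \<mu>. False" by (subst (asm) nn_integral_0_iff_AE) (auto intro!: measurable_law)
    then show False by (simp add: AE_False)
  qed
  then have "enn2real ?L > 0" using fin by (simp add: enn2real_positive_iff zero_less_iff_neq_zero)
  then show ?thesis using fin by (simp add: \<Lambda>_def log_mgf_def)
qed

lemma prod_exp_inner: "(\<Prod>i<m. ennreal (exp (u \<bullet> x i))) = ennreal (exp (u \<bullet> psum m x))"
  by (simp add: prod_ennreal exp_sum[symmetric] psum_def inner_sum_right)

lemma chernoff:
  assumes u: "u \<in> law_dom"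
  shows "Pr {x. c \<le> u \<bullet> psum m x} \<le> exp (real m * \<Lambda> u - c)"
proof -
  have "emeasure S {x\<in>space S. 1 \<le> ennreal (exp (- c)) * ennreal (exp (u \<bullet> psum m x))}
      \<le> ennreal (exp (- c)) * (\<integral>\<^sup>+x. ennreal (exp (u \<bullet> psum m x)) * indicator (space S) x \<partial>S)"
    by (rule nn_integral_Markov_inequality) (use sets.top[of S] in auto)
  also have "(\<integral>\<^sup>+x. ennreal (exp (u \<bullet> psum m x)) * indicator (space S) x \<partial>S) = ennreal (exp (\<Lambda> u)) ^ m"
    using nn_integral_prod_iid[of "\<lambda>y. ennreal (exp (u \<bullet> y))" m] mgf_eq[OF u]
    by (simp add: prod_exp_inner)
  also have "ennreal (exp (- c)) * ennreal (exp (\<Lambda> u)) ^ m = ennreal (exp (real m * \<Lambda> u - c))"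
    by (simp add: ennreal_power ennreal_mult[symmetric] exp_of_nat_mult exp_diff exp_minus divide_inverse mult.commute)
  also have "{x\<in>space S. 1 \<le> ennreal (exp (- c)) * ennreal (exp (u \<bullet> psum m x))} = {x. c \<le> u \<bullet> psum m x}"
    by (auto simp: ennreal_mult[symmetric] exp_add[symmetric] ennreal_1[symmetric] simp del: ennreal_1)
  finally show ?thesis by (simp add: P.emeasure_eq_measure)
qed

text \<open>By independence \<open>Pr (S\<^sub>m \<in> m C)\<close> is supermultiplicative for convex \<open>C\<close>; hence the
  asymptotic Chernoff bound over a finite cover of \<open>C\<close> by half-spaces is already valid for each \<open>m\<close>.\<close>

lemma convex_chernoff:
  assumes C: "compact C" "convex C" and m: "0 < m" and p: "Pr {x. psum m x /\<^sub>R real m \<in> C} > 0"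
  shows "\<exists>w\<in>C. rate w \<le> ereal (- ln (Pr {x. psum m x /\<^sub>R real m \<in> C}) / real m)"
proof (rule ccontr)
  let ?p = "Pr {x. psum m x /\<^sub>R real m \<in> C}"
  assume "\<not> (\<exists>w\<in>C. rate w \<le> ereal (- ln ?p / real m))"
  then have no: "\<not> rate w \<le> ereal (- ln ?p / real m)" if "w \<in> C" for w using that by blast
  have [measurable]: "C \<in> sets borel" using C(1) by (simp add: borel_compact)
  have ne: "C \<noteq> {}" using p by auto
  define a where "a = - ln ?p / real m"
  have "\<exists>u\<in>law_dom. a < u \<bullet> w - \<Lambda> u" if "w \<in> C" for w
    using no[OF that] by (auto simp: a_def rate_def \<Lambda>_def law_dom_def rate_I_le_iff not_le)
  then obtain U where U: "\<And>w. w \<in> C \<Longrightarrow> U w \<in> law_dom" "\<And>w. w \<in> C \<Longrightarrow> a < U w \<bullet> w - \<Lambda> (U w)" by metis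
  \<comment> \<open>A midpoint: \<open>w\<close> stays in its open half-space while the level stays
    above \<open>a\<close>, a margin that survives the minimum over a finite cover.\<close>
  define b where "b w = (a + (U w \<bullet> w - \<Lambda> (U w))) / 2" for w
  have b: "a < b w" "b w < U w \<bullet> w - \<Lambda> (U w)" if "w \<in> C" for w using U(2)[OF that] by (auto simp: b_def)
  define H where "H w = {z. b w < U w \<bullet> z - \<Lambda> (U w)}" for w
  have "open (H w)" for w unfolding H_def by (intro open_Collect_less continuous_intros)
  moreover have "C \<subseteq> (\<Union>w\<in>C. H w)" using b by (auto simp: H_def)
  ultimately obtain W where W: "W \<subseteq> C" "finite W" "C \<subseteq> (\<Union>w\<in>W. H w)"
    using compactE_image[OF C(1), of C H] by metis
  have Wne: "W \<noteq> {}" using W(3) ne by auto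
  define b' where "b' = Min (b ` W)"
  have b': "a < b'" "\<And>w. w \<in> W \<Longrightarrow> b' \<le> b w"
    using W b Wne by (auto simp: b'_def Min_gr_iff)
  \<comment> \<open>Chernoff's bound over the finite cover: decay at the rate \<open>b'\<close>,
    which exceeds \<open>a\<close>, up to the factor \<open>card W\<close>.\<close>
  have up: "Pr {x. psum n x /\<^sub>R real n \<in> C} \<le> real (card W) * exp (- real n * b')" if "0 < n" for n
  proof -
    have "Pr {x. psum n x /\<^sub>R real n \<in> C} \<le> Pr (\<Union>w\<in>W. {x. real n * (\<Lambda> (U w) + b w) \<le> U w \<bullet> psum n x})"
    proof (rule P.finite_measure_mono)
      show "{x. psum n x /\<^sub>R real n \<in> C} \<subseteq> (\<Union>w\<in>W. {x. real n * (\<Lambda> (U w) + b w) \<le> U w \<bullet> psum n x})"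
      proof
        fix x assume "x \<in> {x. psum n x /\<^sub>R real n \<in> C}"
        then obtain w where w: "w \<in> W" "psum n x /\<^sub>R real n \<in> H w" using W(3) by blast
        then have "b w + \<Lambda> (U w) \<le> (U w \<bullet> psum n x) / real n"
          by (simp add: H_def divide_inverse mult.commute less_imp_le)
        then show "x \<in> (\<Union>w\<in>W. {x. real n * (\<Lambda> (U w) + b w) \<le> U w \<bullet> psum n x})"
          using w(1) that by (auto simp: pos_le_divide_eq algebra_simps)
      qed
      show "(\<Union>w\<in>W. {x. real n * (\<Lambda> (U w) + b w) \<le> U w \<bullet> psum n x}) \<in> P.events"
        using W(2) by (intro sets.finite_UN) auto
    qed
    also have "\<dots> \<le> (\<Sum>w\<in>W. Pr {x. real n * (\<Lambda> (U w) + b w) \<le> U w \<bullet> psum n x})"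
      using W(2) by (intro P.finite_measure_subadditive_finite image_subsetI) auto
    also have "\<dots> \<le> (\<Sum>w\<in>W. exp (- real n * b'))"
    proof (rule sum_mono)
      fix w assume w: "w \<in> W"
      have "Pr {x. real n * (\<Lambda> (U w) + b w) \<le> U w \<bullet> psum n x}
          \<le> exp (real n * \<Lambda> (U w) - real n * (\<Lambda> (U w) + b w))"
        using W(1) w by (intro chernoff U) auto
      also have "\<dots> \<le> exp (- real n * b')"
        using mult_left_mono[OF b'(2)[OF w], of "real n"] by (simp add: algebra_simps)
      finally show "Pr {x. real n * (\<Lambda> (U w) + b w) \<le> U w \<bullet> psum n x} \<le> exp (- real n * b')" .
    qed
    finally show ?thesis by simp
  qed
  \<comment> \<open>The mean over several blocks is a convex combination of the block means, so
    concatenated blocks keep the mean in \<open>C\<close>.\<close>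
  have low: "?p ^ q \<le> Pr {x. psum (q * m) x /\<^sub>R real (q * m) \<in> C}" if "0 < q" for q
    using that
  proof (induction q rule: nat_induct_non_zero)
    case (Suc q)
    let ?A = "{x. psum m x /\<^sub>R real m \<in> C}" and ?B = "{x. psum (q * m) x /\<^sub>R real (q * m) \<in> C}"
    have "?p ^ Suc q \<le> ?p * Pr ?B" using Suc by (simp add: mult_left_mono)
    also have "\<dots> = Pr {x. x \<in> ?A \<and> shift m x \<in> ?B}"
    proof (rule Pr_concat[symmetric])
      show "?A \<in> P.events" "?B \<in> P.events" by measurable
      show "y \<in> ?A" if "\<And>i. i < m \<Longrightarrow> x i = y i" "x \<in> ?A" for x y
        using that(2) psum_cong[of m x y, OF that(1)] by simp
    qed
    also have "\<dots> \<le> Pr {x. psum (Suc q * m) x /\<^sub>R real (Suc q * m) \<in> C}"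
    proof (rule P.finite_measure_mono)
      show "{x. x \<in> ?A \<and> shift m x \<in> ?B} \<subseteq> {x. psum (Suc q * m) x /\<^sub>R real (Suc q * m) \<in> C}"
      proof (intro subsetI CollectI)
        fix x assume "x \<in> {x. x \<in> ?A \<and> shift m x \<in> ?B}"
        let ?v = "psum m x /\<^sub>R real m" and ?w = "psum (q * m) (shift m x) /\<^sub>R real (q * m)"
        have vw: "?v \<in> C" "?w \<in> C" using \<open>x \<in> _\<close> by blast+
        have "(1 / real (Suc q)) *\<^sub>R ?v + (real q / real (Suc q)) *\<^sub>R ?w \<in> C"
          using vw by (intro convexD[OF C(2)]) (auto simp: add_divide_distrib[symmetric])
        also have "(1 / real (Suc q)) *\<^sub>R ?v + (real q / real (Suc q)) *\<^sub>R ?w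
            = psum (Suc q * m) x /\<^sub>R real (Suc q * m)"
        proof -
          have "1 / real (Suc q) * inverse (real m) = inverse (real (Suc q * m))"
            "real q / real (Suc q) * inverse (real (q * m)) = inverse (real (Suc q * m))"
            using m \<open>0 < q\<close> by (simp_all add: field_simps)
          then show ?thesis
            unfolding scaleR_scaleR by (simp only: scaleR_add_right[symmetric] mult_Suc psum_add)
        qed
        finally show "psum (Suc q * m) x /\<^sub>R real (Suc q * m) \<in> C" .
      qed
      show "{x. psum (Suc q * m) x /\<^sub>R real (Suc q * m) \<in> C} \<in> P.events" by measurable
    qed
    finally show ?case .
  qed simp
  \<comment> \<open>The gain per block. Comparing the two bounds keeps all powers of
    \<open>z\<close> below \<open>card W\<close>, which is impossible once
    \<open>z > 1\<close>.\<close>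
  define z where "z = ?p * exp (real m * b')"
  have "ln ?p + real m * b' > 0" using b'(1) m by (simp add: a_def field_simps)
  then have "exp (ln ?p + real m * b') > 1" by simp
  then have z: "z > 1" using p by (simp add: z_def exp_add)
  obtain q where q: "real (card W) < z ^ q" using real_arch_pow[OF z] by blast
  have "z ^ Suc q \<le> real (card W)"
  proof -
    have "?p ^ Suc q \<le> real (card W) * exp (- real (Suc q * m) * b')"
      using low[of "Suc q"] up[of "Suc q * m"] m by force
    then have "?p ^ Suc q * exp (real (Suc q * m) * b') \<le> real (card W) * exp (- real (Suc q * m) * b') * exp (real (Suc q * m) * b')"
      by (intro mult_right_mono) auto
    also have "\<dots> = real (card W)" unfolding mult.assoc exp_add[symmetric] by (simp only: mult_minus_left add.left_inverse exp_zero mult_1_right)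
    finally show ?thesis
      unfolding z_def power_mult_distrib exp_of_nat_mult[symmetric] by (simp add: algebra_simps)
  qed
  moreover have "z ^ q \<le> z ^ Suc q" using z by (intro power_increasing) auto
  ultimately show False using q by linarith
qed

section \<open>Probabilities of balls, and the closed convex set behind Cramer's lower bound\<close>

definition nearP :: "nat \<Rightarrow> 'a \<Rightarrow> real \<Rightarrow> real" where
  "nearP m a \<alpha> = Pr {x. norm (psum m x - a) \<le> \<alpha>}"

lemma nearP_mono: "norm (a - b) + \<alpha> \<le> \<beta> \<Longrightarrow> nearP m a \<alpha> \<le> nearP m b \<beta>"
proof -
  assume le: "norm (a - b) + \<alpha> \<le> \<beta>"
  have "norm (y - b) \<le> norm (a - b) + norm (y - a)" for y :: 'a
    using norm_triangle_ineq[of "a - b" "y - a"] by (simp add: algebra_simps)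
  then have "{x. norm (psum m x - a) \<le> \<alpha>} \<subseteq> {x. norm (psum m x - b) \<le> \<beta>}"
    using le by (intro Collect_mono) (metis add_left_mono order_trans)
  then show ?thesis unfolding nearP_def by (intro P.finite_measure_mono) auto
qed

lemma nearP_add: "nearP m a \<alpha> * nearP n b \<beta> \<le> nearP (m + n) (a + b) (\<alpha> + \<beta>)"
proof -
  let ?A = "{x. norm (psum m x - a) \<le> \<alpha>}" and ?B = "{x. norm (psum n x - b) \<le> \<beta>}"
  have "nearP m a \<alpha> * nearP n b \<beta> = Pr {x. x \<in> ?A \<and> shift m x \<in> ?B}"
    unfolding nearP_def
  proof (rule Pr_concat[symmetric])
    show "?A \<in> P.events" "?B \<in> P.events" by measurable
    show "y \<in> ?A" if "\<And>i. i < m \<Longrightarrow> x i = y i" "x \<in> ?A" for x y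
      using that(2) psum_cong[of m x y, OF that(1)] by simp
  qed
  also have "\<dots> \<le> nearP (m + n) (a + b) (\<alpha> + \<beta>)"
    unfolding nearP_def
  proof (rule P.finite_measure_mono)
    have "norm (y + z - (a + b)) \<le> norm (y - a) + norm (z - b)" for y z :: 'a
      using norm_triangle_ineq[of "y - a" "z - b"] by (simp add: algebra_simps)
    then show "{x. x \<in> ?A \<and> shift m x \<in> ?B} \<subseteq> {x. norm (psum (m + n) x - (a + b)) \<le> \<alpha> + \<beta>}"
      unfolding psum_add mem_Collect_eq by (intro Collect_mono) (metis add_mono order_trans)
    show "{x. norm (psum (m + n) x - (a + b)) \<le> \<alpha> + \<beta>} \<in> P.events" by measurable
  qed
  finally show ?thesis .
qed

lemma nearP_power: "nearP m a \<alpha> ^ q \<le> nearP (q * m) (real q *\<^sub>R a) (real q * \<alpha>)"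
proof (induction q)
  case 0
  then show ?case using P.prob_space by (simp add: nearP_def)
next
  case (Suc q)
  have "nearP m a \<alpha> ^ Suc q \<le> nearP m a \<alpha> * nearP (q * m) (real q *\<^sub>R a) (real q * \<alpha>)"
    using Suc by (auto intro!: mult_left_mono simp: nearP_def)
  also have "\<dots> \<le> nearP (m + q * m) (a + real q *\<^sub>R a) (\<alpha> + real q * \<alpha>)" by (rule nearP_add)
  finally show ?case by (simp add: algebra_simps)
qed

text \<open>Cramer's lower bound says that this set is the epigraph of \<^term>\<open>rate\<close>.\<close>

definition lower_epi :: "('a \<times> real) set" where
  "lower_epi = {(v, c). \<forall>\<epsilon>>0. \<forall>\<eta>>0. \<exists>m>0. exp (- real m * (c + \<eta>)) \<le> nearP m (real m *\<^sub>R v) (real m * \<epsilon>)}"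

lemma lower_epi_up: "(v, c) \<in> lower_epi \<Longrightarrow> c \<le> c' \<Longrightarrow> (v, c') \<in> lower_epi"
proof -
  assume E: "(v, c) \<in> lower_epi" and cc: "c \<le> c'"
  have "exp (- real m * (c' + \<eta>)) \<le> exp (- real m * (c + \<eta>))" for m \<eta>
    using cc by (auto intro!: mult_left_mono)
  then show ?thesis using E unfolding lower_epi_def mem_Collect_eq case_prod_conv by (meson order_trans)
qed

lemma lower_epi_nonneg:
  assumes "(v, c) \<in> lower_epi"
  shows "0 \<le> c"
proof (rule field_le_epsilon)
  fix \<eta> :: real assume "\<eta> > 0"
  then obtain m where "m > 0" "exp (- real m * (c + \<eta>)) \<le> nearP m (real m *\<^sub>R v) (real m * 1)"
    using assms zero_less_one unfolding lower_epi_def by blast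
  moreover have "nearP m (real m *\<^sub>R v) (real m * 1) \<le> 1" unfolding nearP_def by (rule P.prob_le_1)
  ultimately have "exp (- real m * (c + \<eta>)) \<le> 1" "m > 0" by linarith+
  then have "real m * (c + \<eta>) \<ge> 0" "m > 0" unfolding exp_le_one_iff by auto
  then show "0 \<le> c + \<eta>" by (simp add: zero_le_mult_iff)
qed

text \<open>A diagonal criterion: the point, the level and both tolerances may be perturbed by the
  same \<open>\<delta>\<close>. It serves closedness, convexity with rational weights, and the limit
  in \<open>lower_epi_from_mgf\<close>.\<close>

lemma lower_epi_limit:
  assumes "\<And>\<delta>. \<delta> > 0 \<Longrightarrow> \<exists>v' c' m. norm (v' - v) \<le> \<delta> \<and> c' \<le> c + \<delta> \<and> 0 < m \<and>
      exp (- real m * (c' + \<delta>)) \<le> nearP m (real m *\<^sub>R v') (real m * \<delta>)"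
  shows "(v, c) \<in> lower_epi"
  unfolding lower_epi_def
proof (clarify)
  fix \<epsilon> \<eta> :: real assume "\<epsilon> > 0" "\<eta> > 0"
  define \<delta> where "\<delta> = min (\<epsilon> / 2) (\<eta> / 2)"
  have \<delta>: "\<delta> > 0" "\<delta> \<le> \<epsilon> / 2" "\<delta> \<le> \<eta> / 2" using \<open>\<epsilon> > 0\<close> \<open>\<eta> > 0\<close> by (auto simp: \<delta>_def)
  obtain v' c' m where m: "norm (v' - v) \<le> \<delta>" "c' \<le> c + \<delta>" "0 < m"
    "exp (- real m * (c' + \<delta>)) \<le> nearP m (real m *\<^sub>R v') (real m * \<delta>)" using assms[OF \<delta>(1)] by blast
  have "real m * (c' + \<delta>) \<le> real m * (c + \<eta>)" using m(2) \<delta>(3) by (intro mult_left_mono) auto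
  then have "exp (- real m * (c + \<eta>)) \<le> exp (- real m * (c' + \<delta>))" by simp
  also note m(4)
  also have "nearP m (real m *\<^sub>R v') (real m * \<delta>) \<le> nearP m (real m *\<^sub>R v) (real m * \<epsilon>)"
  proof (rule nearP_mono)
    have "norm (real m *\<^sub>R v' - real m *\<^sub>R v) = real m * norm (v' - v)"
      by (simp add: scaleR_diff_right[symmetric])
    also have "\<dots> \<le> real m * \<delta>" using m(1) by (intro mult_left_mono) auto
    finally have "norm (real m *\<^sub>R v' - real m *\<^sub>R v) + real m * \<delta> \<le> real m * (2 * \<delta>)"
      by (simp only: mult_2 distrib_left)
    also have "\<dots> \<le> real m * \<epsilon>" using \<delta>(2) by (intro mult_left_mono) auto
    finally show "norm (real m *\<^sub>R v' - real m *\<^sub>R v) + real m * \<delta> \<le> real m * \<epsilon>" .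
  qed
  finally show "\<exists>m>0. exp (- real m * (c + \<eta>)) \<le> nearP m (real m *\<^sub>R v) (real m * \<epsilon>)" using m(3) by blast
qed

lemma lower_epiD:
  assumes "(v, c) \<in> lower_epi" "\<delta> > 0"
  obtains m where "0 < m" "exp (- real m * (c + \<delta>)) \<le> nearP m (real m *\<^sub>R v) (real m * \<delta>)"
  using assms unfolding lower_epi_def by blast

lemma closed_lower_epi: "closed lower_epi"
proof -
  have "p \<in> lower_epi" if p: "p \<in> closure lower_epi" for p
  proof -
    obtain v c where vc: "p = (v, c)" by (cases p)
    show ?thesis unfolding vc
    proof (rule lower_epi_limit)
      fix \<delta> :: real assume \<delta>: "\<delta> > 0"
      then obtain v' c' where E: "(v', c') \<in> lower_epi" "dist (v', c') (v, c) < \<delta>"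
        using p unfolding vc closure_approachable by fast
      have "dist v' v \<le> dist (v', c') (v, c)" "dist c' c \<le> dist (v', c') (v, c)"
        using dist_fst_le[of "(v', c')" "(v, c)"] dist_snd_le[of "(v', c')" "(v, c)"] by auto
      then have "norm (v' - v) \<le> \<delta>" "c' \<le> c + \<delta>" using E(2) by (auto simp: dist_norm)
      then show "\<exists>v' c' m. norm (v' - v) \<le> \<delta> \<and> c' \<le> c + \<delta> \<and> 0 < m \<and>
          exp (- real m * (c' + \<delta>)) \<le> nearP m (real m *\<^sub>R v') (real m * \<delta>)"
        using lower_epiD[OF E(1) \<delta>] by metis
    qed
  qed
  then show ?thesis by (metis closure_subset subsetI subset_antisym closure_closed closed_closure)
qed

text \<open>Concatenate \<open>k1 * m2\<close> blocks of length \<open>m1\<close> with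
  \<open>k2 * m1\<close> blocks of length \<open>m2\<close>: the total lengths are in the ratio of
  \<open>k1\<close> to \<open>k2\<close>, whatever block lengths witness the two
  memberships.\<close>

lemma lower_epi_rational_convex:
  assumes E: "(v1, c1) \<in> lower_epi" "(v2, c2) \<in> lower_epi" and k: "0 < k1 + k2"
  shows "((real k1 / real (k1 + k2)) *\<^sub>R v1 + (real k2 / real (k1 + k2)) *\<^sub>R v2,
     (real k1 / real (k1 + k2)) * c1 + (real k2 / real (k1 + k2)) * c2) \<in> lower_epi"
proof (rule lower_epi_limit)
  fix \<delta> :: real assume \<delta>: "\<delta> > 0"
  obtain m1 where m1: "0 < m1" "exp (- real m1 * (c1 + \<delta>)) \<le> nearP m1 (real m1 *\<^sub>R v1) (real m1 * \<delta>)"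
    using lower_epiD[OF E(1) \<delta>] by blast
  obtain m2 where m2: "0 < m2" "exp (- real m2 * (c2 + \<delta>)) \<le> nearP m2 (real m2 *\<^sub>R v2) (real m2 * \<delta>)"
    using lower_epiD[OF E(2) \<delta>] by blast
  define M where "M = (k1 + k2) * (m1 * m2)"
  define v where "v = (real k1 / real (k1 + k2)) *\<^sub>R v1 + (real k2 / real (k1 + k2)) *\<^sub>R v2"
  define c where "c = (real k1 / real (k1 + k2)) * c1 + (real k2 / real (k1 + k2)) * c2"
  have kk: "real k1 + real k2 > 0" using k by linarith
  have Mk: "real M * (real k1 / real (k1 + k2)) = real (k1 * m2) * real m1"
    "real M * (real k2 / real (k1 + k2)) = real (k2 * m1) * real m2"
    using kk by (simp_all add: M_def field_simps)
  have Mv: "real M *\<^sub>R v = real (k1 * m2) *\<^sub>R (real m1 *\<^sub>R v1) + real (k2 * m1) *\<^sub>R (real m2 *\<^sub>R v2)"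
    unfolding v_def scaleR_add_right scaleR_scaleR Mk ..
  have Mc: "real M * (c + \<delta>) = real (k1 * m2) * (real m1 * (c1 + \<delta>)) + real (k2 * m1) * (real m2 * (c2 + \<delta>))"
  proof -
    have "real M * c = (real (k1 * m2) * real m1) * c1 + (real (k2 * m1) * real m2) * c2"
      unfolding c_def Mk[symmetric] by (simp only: distrib_left mult.assoc)
    then show ?thesis by (simp add: distrib_left M_def algebra_simps)
  qed
  have "exp (- real M * (c + \<delta>)) = exp (- real m1 * (c1 + \<delta>)) ^ (k1 * m2) * exp (- real m2 * (c2 + \<delta>)) ^ (k2 * m1)"
    unfolding exp_of_nat_mult[symmetric] exp_add[symmetric] using Mc by simp
  also have "\<dots> \<le> nearP m1 (real m1 *\<^sub>R v1) (real m1 * \<delta>) ^ (k1 * m2) * nearP m2 (real m2 *\<^sub>R v2) (real m2 * \<delta>) ^ (k2 * m1)"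
    using m1 m2 by (intro mult_mono power_mono) (auto simp: nearP_def)
  also have "\<dots> \<le> nearP (k1 * m2 * m1) (real (k1 * m2) *\<^sub>R (real m1 *\<^sub>R v1)) (real (k1 * m2) * (real m1 * \<delta>))
      * nearP (k2 * m1 * m2) (real (k2 * m1) *\<^sub>R (real m2 *\<^sub>R v2)) (real (k2 * m1) * (real m2 * \<delta>))"
    by (intro mult_mono nearP_power) (auto simp: nearP_def)
  also have "\<dots> \<le> nearP (k1 * m2 * m1 + k2 * m1 * m2) (real M *\<^sub>R v)
      (real (k1 * m2) * (real m1 * \<delta>) + real (k2 * m1) * (real m2 * \<delta>))"
    unfolding Mv by (rule nearP_add)
  also have "\<dots> = nearP M (real M *\<^sub>R v) (real M * \<delta>)"
    by (simp add: M_def algebra_simps)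
  finally have "exp (- real M * (c + \<delta>)) \<le> nearP M (real M *\<^sub>R v) (real M * \<delta>)" .
  moreover have "0 < M" using k m1 m2 by (simp add: M_def)
  ultimately show "\<exists>v' c' m. norm (v' - v) \<le> \<delta> \<and> c' \<le> c + \<delta> \<and> 0 < m \<and>
          exp (- real m * (c' + \<delta>)) \<le> nearP m (real m *\<^sub>R v') (real m * \<delta>)"
    using \<delta> by (intro exI[of _ v] exI[of _ c] exI[of _ M]) auto
qed

text \<open>Rational weights approximate \<open>s\<close>, and the set is closed.\<close>

lemma convex_lower_epi: "convex lower_epi"
  unfolding convex_alt
proof (intro ballI allI impI)
  fix p q :: "'a \<times> real" and s :: real
  assume E: "p \<in> lower_epi" "q \<in> lower_epi" and s: "0 \<le> s \<and> s \<le> 1"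
  define r where "r n = real (nat \<lfloor>real (Suc n) * s\<rfloor>) / real (Suc n)" for n
  have r: "(1 - r n) *\<^sub>R p + r n *\<^sub>R q \<in> lower_epi" for n
  proof -
    define k2 where "k2 = nat \<lfloor>real (Suc n) * s\<rfloor>"
    have "real (Suc n) * s \<le> real (Suc n) * 1" using s by (intro mult_left_mono) auto
    from floor_mono[OF this] have "\<lfloor>real (Suc n) * s\<rfloor> \<le> int (Suc n)"
      by (simp only: mult_1_right floor_of_nat)
    then have k2: "k2 \<le> Suc n" by (simp add: k2_def)
    define k1 where "k1 = Suc n - k2"
    have k: "k1 + k2 = Suc n" using k2 by (simp add: k1_def)
    have rn: "r n = real k2 / real (k1 + k2)" by (simp only: r_def k k2_def[symmetric])
    have rn': "1 - r n = real k1 / real (k1 + k2)"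
      unfolding rn using \<open>k1 + k2 = Suc n\<close> by (simp only: of_nat_add) (simp add: field_simps del: of_nat_Suc)
    obtain v1 c1 v2 c2 where pq: "p = (v1, c1)" "q = (v2, c2)" by (cases p, cases q)
    have "0 < k1 + k2" using k by simp
    then show ?thesis using lower_epi_rational_convex[of v1 c1 v2 c2 k1 k2] E
      unfolding rn' unfolding rn pq by simp
  qed
  have "r \<longlonglongrightarrow> s"
  proof (rule tendsto_sandwich)
    have f: "real (nat \<lfloor>real (Suc n) * s\<rfloor>) = of_int \<lfloor>real (Suc n) * s\<rfloor>" for n using s by simp
    show "\<forall>\<^sub>F n in sequentially. s - 1 / real (Suc n) \<le> r n"
    proof (rule always_eventually, rule allI)
      fix n
      have "real (Suc n) * s - 1 \<le> of_int \<lfloor>real (Suc n) * s\<rfloor>" by linarith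
      then have "(real (Suc n) * s - 1) / real (Suc n) \<le> r n" unfolding r_def f by (intro divide_right_mono) auto
      then show "s - 1 / real (Suc n) \<le> r n" by (simp add: diff_divide_distrib del: of_nat_Suc)
    qed
    show "\<forall>\<^sub>F n in sequentially. r n \<le> s"
    proof (rule always_eventually, rule allI)
      fix n
      have "of_int \<lfloor>real (Suc n) * s\<rfloor> \<le> real (Suc n) * s" by linarith
      then show "r n \<le> s" unfolding r_def f by (simp add: pos_divide_le_eq mult.commute del: of_nat_Suc)
    qed
    have "(\<lambda>n. s - 1 / real (Suc n)) \<longlonglongrightarrow> s - 0" by (intro tendsto_intros lim_1_over_n[THEN LIMSEQ_Suc])
    then show "(\<lambda>n. s - 1 / real (Suc n)) \<longlonglongrightarrow> s" by simp
  qed simp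
  then have "(\<lambda>n. (1 - r n) *\<^sub>R p + r n *\<^sub>R q) \<longlonglongrightarrow> (1 - s) *\<^sub>R p + s *\<^sub>R q"
    by (intro tendsto_intros)
  then show "(1 - s) *\<^sub>R p + s *\<^sub>R q \<in> lower_epi"
    using closed_sequentially[OF closed_lower_epi, of "\<lambda>n. (1 - r n) *\<^sub>R p + r n *\<^sub>R q"] r by blast
qed

end

section \<open>Cramer's lower bound by separation\<close>

context iid_law
begin

lemma law_total: "emeasure \<mu> UNIV = 1"
  using prob_space.emeasure_space_1[OF iid_law.axioms(1)[OF iid_law_axioms]] by simp

text \<open>Monotone convergence over growing balls keeps the strict inequality on some ball, where
  the integral is finite even if the full one is not.\<close>

lemma truncated_mgf:
  assumes "ennreal (exp \<theta>) < (\<integral>\<^sup>+y. ennreal (exp (u \<bullet> y)) \<partial>\<mu>)"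
  obtains R \<theta>' where "\<theta> < \<theta>'"
    "(\<integral>\<^sup>+y. ennreal (exp (u \<bullet> y)) * indicator (cball 0 R) y \<partial>\<mu>) = ennreal (exp \<theta>')"
proof -
  have [measurable]: "cball (0::'a) r \<in> sets borel" for r by simp
  let ?f = "\<lambda>i y. ennreal (exp (u \<bullet> y)) * indicator (cball 0 (real i)) y"
  have sup: "(SUP i. ?f i y) = ennreal (exp (u \<bullet> y))" for y
  proof (rule antisym)
    show "(SUP i. ?f i y) \<le> ennreal (exp (u \<bullet> y))" by (rule SUP_least) (simp split: split_indicator)
    obtain i :: nat where "norm y \<le> real i" using real_arch_simple by blast
    then show "ennreal (exp (u \<bullet> y)) \<le> (SUP i. ?f i y)" by (intro SUP_upper2[of i]) auto
  qed
  have "(\<integral>\<^sup>+y. (SUP i. ?f i y) \<partial>\<mu>) = (SUP i. \<integral>\<^sup>+y. ?f i y \<partial>\<mu>)"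
  proof (rule nn_integral_monotone_convergence_SUP)
    show "?f i \<in> borel_measurable \<mu>" for i by (rule measurable_law) measurable
  qed (auto intro!: incseq_SucI le_funI split: split_indicator)
  then have "ennreal (exp \<theta>) < (SUP i. \<integral>\<^sup>+y. ?f i y \<partial>\<mu>)" using assms unfolding sup by simp
  then obtain i where i: "ennreal (exp \<theta>) < (\<integral>\<^sup>+y. ?f i y \<partial>\<mu>)" unfolding less_SUP_iff by blast
  have "(\<integral>\<^sup>+y. ?f i y \<partial>\<mu>) \<le> (\<integral>\<^sup>+y. ennreal (exp (norm u * real i)) \<partial>\<mu>)"
  proof (rule nn_integral_mono)
    fix y
    have "u \<bullet> y \<le> norm u * real i" if "norm y \<le> real i"
      using norm_cauchy_schwarz[of u y] mult_left_mono[OF that norm_ge_zero[of u]] by linarith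
    then show "?f i y \<le> ennreal (exp (norm u * real i))" by (auto split: split_indicator)
  qed
  also have "\<dots> < \<infinity>" by (simp add: law_total)
  finally have fin: "(\<integral>\<^sup>+y. ?f i y \<partial>\<mu>) < \<infinity>" .
  define l where "l = enn2real (\<integral>\<^sup>+y. ?f i y \<partial>\<mu>)"
  have l: "(\<integral>\<^sup>+y. ?f i y \<partial>\<mu>) = ennreal l" using fin by (simp add: l_def)
  then have "exp \<theta> < l" using i by (simp add: ennreal_less_iff)
  then have "0 < l" using less_trans[OF exp_gt_zero] by blast
  then have "exp (ln l) = l" by simp
  moreover from this have "\<theta> < ln l" using \<open>exp \<theta> < l\<close> by (metis exp_less_cancel_iff)
  ultimately show ?thesis using that[of "ln l" "real i"] l by simp
qed

text \<open>Pigeonhole instead of a change of measure: the truncated exponential moment of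
  \<open>psum m\<close> equals \<open>exp (m * \<theta>')\<close>, while the mean lies in a ball
  covered by finitely many small ones. One of these carries enough of the moment to give its
  probability a lower bound.\<close>

lemma lower_epi_from_mgf:
  assumes "ennreal (exp \<theta>) < (\<integral>\<^sup>+y. ennreal (exp (u \<bullet> y)) \<partial>\<mu>)"
  shows "\<exists>w. (w, u \<bullet> w - \<theta>) \<in> lower_epi"
proof -
  obtain R \<theta>' where \<theta>': "\<theta> < \<theta>'"
    and L: "(\<integral>\<^sup>+y. ennreal (exp (u \<bullet> y)) * indicator (cball 0 R) y \<partial>\<mu>) = ennreal (exp \<theta>')"
    by (rule truncated_mgf[OF assms])
  have [measurable]: "cball (0::'a) R \<in> sets borel" by simp
  have mf: "(\<lambda>y. ennreal (exp (u \<bullet> y)) * indicator (cball 0 R) y) \<in> borel_measurable borel" by measurable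
  have "\<exists>w\<in>cball 0 R. \<exists>m>0. exp (- real m * (u \<bullet> w - \<theta> + norm u * \<epsilon>)) \<le> nearP m (real m *\<^sub>R w) (real m * \<epsilon>)"
    if \<epsilon>: "\<epsilon> > 0" for \<epsilon>
  proof -
    have "cball 0 R \<subseteq> (\<Union>w\<in>cball (0::'a) R. ball w \<epsilon>)" using \<epsilon> by force
    then obtain W where W: "W \<subseteq> cball (0::'a) R" "finite W" "cball 0 R \<subseteq> (\<Union>w\<in>W. ball w \<epsilon>)"
      using compactE_image[OF compact_cball, of "cball 0 R" "\<lambda>w. ball w \<epsilon>" 0 R] by (metis open_ball)
    let ?g = "\<lambda>m w. exp (real m * (u \<bullet> w + norm u * \<epsilon>))"
    let ?B = "\<lambda>m w. {x. norm (psum m x - real m *\<^sub>R w) \<le> real m * \<epsilon>}"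
    have up: "exp (real m * \<theta>') \<le> (\<Sum>w\<in>W. ?g m w * nearP m (real m *\<^sub>R w) (real m * \<epsilon>))" if m: "0 < m" for m
    proof -
      have pt: "(\<Prod>i<m. ennreal (exp (u \<bullet> x i)) * indicator (cball 0 R) (x i))
          \<le> (\<Sum>w\<in>W. ennreal (?g m w) * indicator (?B m w) x)" for x
      proof (cases "\<forall>i<m. x i \<in> cball 0 R")
        case True
        then have "norm (psum m x) \<le> real m * R"
          unfolding psum_def using sum_norm_le[of "{..<m}" x "\<lambda>_. R"] by simp
        then have "psum m x /\<^sub>R real m \<in> cball 0 R" using m by (simp add: field_simps)
        then obtain w where w: "w \<in> W" "norm (psum m x /\<^sub>R real m - w) < \<epsilon>"
          using W(3) by (force simp: dist_norm norm_minus_commute)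
        have eq: "psum m x - real m *\<^sub>R w = real m *\<^sub>R (psum m x /\<^sub>R real m - w)"
          using m by (simp add: scaleR_diff_right)
        have nb: "norm (psum m x - real m *\<^sub>R w) \<le> real m * \<epsilon>"
          unfolding eq using w(2) m by (simp add: mult_left_mono)
        have "u \<bullet> (psum m x - real m *\<^sub>R w) \<le> norm u * (real m * \<epsilon>)"
          using norm_cauchy_schwarz mult_left_mono[OF nb norm_ge_zero[of u]] order_trans by blast
        then have "u \<bullet> psum m x \<le> real m * (u \<bullet> w + norm u * \<epsilon>)"
          by (simp add: inner_diff_right algebra_simps)
        then have "ennreal (exp (u \<bullet> psum m x)) \<le> ennreal (?g m w) * indicator (?B m w) x"
          using nb by simp
        also have "\<dots> \<le> (\<Sum>w\<in>W. ennreal (?g m w) * indicator (?B m w) x)"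
          using w(1) W(2) by (intro member_le_sum) auto
        finally show ?thesis using True by (simp add: prod_exp_inner[symmetric])
      next
        case False
        then obtain i where "i < m" "x i \<notin> cball 0 R" by blast
        then have "(\<Prod>i<m. ennreal (exp (u \<bullet> x i)) * indicator (cball 0 R) (x i)) = 0"
          by (intro prod_zero) (auto intro!: bexI[of _ i])
        then show ?thesis by (simp only:) simp
      qed
      have "ennreal (exp (real m * \<theta>')) = (\<integral>\<^sup>+x. (\<Prod>i<m. ennreal (exp (u \<bullet> x i)) * indicator (cball 0 R) (x i)) \<partial>S)"
        using nn_integral_prod_iid[OF mf, of m] L
        by (simp add: ennreal_power exp_of_nat_mult)
      also have "\<dots> \<le> (\<integral>\<^sup>+x. (\<Sum>w\<in>W. ennreal (?g m w) * indicator (?B m w) x) \<partial>S)"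
        by (intro nn_integral_mono pt)
      also have "\<dots> = (\<Sum>w\<in>W. ennreal (?g m w) * emeasure S (?B m w))"
        by (subst nn_integral_sum) (auto intro!: sum.cong nn_integral_cmult_indicator)
      also have "\<dots> = ennreal (\<Sum>w\<in>W. ?g m w * nearP m (real m *\<^sub>R w) (real m * \<epsilon>))"
        by (subst sum_ennreal[symmetric])
           (auto simp: nearP_def P.emeasure_eq_measure ennreal_mult intro!: sum.cong)
      finally show ?thesis
        by (subst (asm) ennreal_le_iff) (auto intro!: sum_nonneg simp: nearP_def)
    qed
    \<comment> \<open>For long enough \<open>m\<close> the gap between \<open>\<theta>'\<close> and
      \<open>\<theta>\<close> outweighs the number of balls.\<close>
    have "exp (\<theta>' - \<theta>) > 1" using \<theta>' by simp
    then obtain q where q: "real (card W) < exp (\<theta>' - \<theta>) ^ q" using real_arch_pow by blast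
    define m where "m = Suc q"
    have "exp (\<theta>' - \<theta>) ^ q \<le> exp (\<theta>' - \<theta>) ^ m" using \<theta>' by (intro power_increasing) (auto simp: m_def)
    moreover have "exp (\<theta>' - \<theta>) ^ m = exp (real m * \<theta>' - real m * \<theta>)"
      by (simp add: exp_of_nat_mult[symmetric] algebra_simps)
    ultimately have "real (card W) < exp (real m * \<theta>' - real m * \<theta>)" using q by linarith
    then have big: "real (card W) * exp (real m * \<theta>) < exp (real m * \<theta>')"
      by (simp add: exp_diff pos_less_divide_eq)
    have "\<exists>w\<in>W. exp (real m * \<theta>) \<le> ?g m w * nearP m (real m *\<^sub>R w) (real m * \<epsilon>)"
    proof (rule ccontr)
      assume "\<not> ?thesis"
      then have "(\<Sum>w\<in>W. ?g m w * nearP m (real m *\<^sub>R w) (real m * \<epsilon>)) \<le> (\<Sum>w\<in>W. exp (real m * \<theta>))"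
        by (intro sum_mono) (auto simp: not_le less_imp_le)
      then show False using up[of m] big by (simp add: m_def)
    qed
    then obtain w where w: "w \<in> W" "exp (real m * \<theta>) \<le> ?g m w * nearP m (real m *\<^sub>R w) (real m * \<epsilon>)" by blast
    have "exp (- real m * (u \<bullet> w - \<theta> + norm u * \<epsilon>)) = exp (real m * \<theta>) / ?g m w"
      by (simp add: exp_diff[symmetric] algebra_simps)
    also have "\<dots> \<le> nearP m (real m *\<^sub>R w) (real m * \<epsilon>)"
      using w(2) by (simp add: pos_divide_le_eq mult.commute)
    finally have "exp (- real m * (u \<bullet> w - \<theta> + norm u * \<epsilon>)) \<le> nearP m (real m *\<^sub>R w) (real m * \<epsilon>)" .
    moreover have "0 < m" by (simp add: m_def)
    ultimately show ?thesis using w(1) W(1) by blast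
  qed
  note approx = this
  \<comment> \<open>The center depends on \<open>\<epsilon>\<close>; for
    \<open>\<epsilon> = 1 / Suc k\<close> the centers stay in a compact ball and a subsequence
    converges.\<close>
  have "\<forall>k. \<exists>w\<in>cball 0 R. \<exists>m>0. exp (- real m * (u \<bullet> w - \<theta> + norm u * (1 / real (Suc k)))) \<le> nearP m (real m *\<^sub>R w) (real m * (1 / real (Suc k)))"
    by (intro allI approx) simp
  then obtain W m where W: "\<And>k. W k \<in> cball (0::'a) R" and m: "\<And>k. 0 < m k"
    and near: "\<And>k. exp (- real (m k) * (u \<bullet> W k - \<theta> + norm u * (1 / real (Suc k)))) \<le> nearP (m k) (real (m k) *\<^sub>R W k) (real (m k) * (1 / real (Suc k)))"
    by metis
  obtain w r where w: "strict_mono r" "(W \<circ> r) \<longlonglongrightarrow> w"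
    using compact_cball[of "0::'a" R] W unfolding compact_def by blast
  have "(w, u \<bullet> w - \<theta>) \<in> lower_epi"
  proof (rule lower_epi_limit)
    fix \<delta> :: real assume \<delta>: "\<delta> > 0"
    have lims: "(\<lambda>k. 1 / real (Suc (r k))) \<longlonglongrightarrow> 0"
      using LIMSEQ_subseq_LIMSEQ[OF lim_1_over_n[THEN LIMSEQ_Suc] w(1)] by (simp add: o_def)
    have "(\<lambda>k. u \<bullet> W (r k) + norm u * (1 / real (Suc (r k)))) \<longlonglongrightarrow> u \<bullet> w + norm u * 0"
      using w(2) by (intro tendsto_intros lims) (simp add: o_def)
    then have "\<forall>\<^sub>F k in sequentially. u \<bullet> W (r k) + norm u * (1 / real (Suc (r k))) < u \<bullet> w + \<delta>"
      using \<delta> by (intro order_tendstoD) auto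
    moreover have "\<forall>\<^sub>F k in sequentially. 1 / real (Suc (r k)) < \<delta>"
      using lims \<delta> by (intro order_tendstoD) auto
    moreover have "\<forall>\<^sub>F k in sequentially. dist ((W \<circ> r) k) w < \<delta>"
      using w(2) \<delta> by (rule tendstoD)
    ultimately have "\<forall>\<^sub>F k in sequentially. u \<bullet> W (r k) + norm u * (1 / real (Suc (r k))) < u \<bullet> w + \<delta> \<and>
        1 / real (Suc (r k)) < \<delta> \<and> dist ((W \<circ> r) k) w < \<delta>" by eventually_elim simp
    then obtain k where k: "u \<bullet> W (r k) + norm u * (1 / real (Suc (r k))) < u \<bullet> w + \<delta>"
      "1 / real (Suc (r k)) < \<delta>" "dist (W (r k)) w < \<delta>"
      unfolding eventually_sequentially by auto
    let ?c = "u \<bullet> W (r k) - \<theta> + norm u * (1 / real (Suc (r k)))" and ?m = "m (r k)"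
    have "exp (- real ?m * (?c + \<delta>)) \<le> exp (- real ?m * ?c)"
      using \<delta> by (auto intro!: mult_left_mono)
    also note near[of "r k"]
    also have "nearP ?m (real ?m *\<^sub>R W (r k)) (real ?m * (1 / real (Suc (r k)))) \<le> nearP ?m (real ?m *\<^sub>R W (r k)) (real ?m * \<delta>)"
      using mult_left_mono[OF less_imp_le[OF k(2)], of "real ?m"] by (intro nearP_mono) (simp del: of_nat_Suc)
    finally show "\<exists>v' c' m. norm (v' - w) \<le> \<delta> \<and> c' \<le> u \<bullet> w - \<theta> + \<delta> \<and> 0 < m \<and>
      exp (- real m * (c' + \<delta>)) \<le> nearP m (real m *\<^sub>R v') (real m * \<delta>)"
      using k m[of "r k"] by (intro exI[of _ "W (r k)"] exI[of _ ?c] exI[of _ ?m]) (auto simp: dist_norm)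
  qed
  then show ?thesis by blast
qed

text \<open>The half of the epigraph identity that follows from Chernoff's bound, since a ball lies
  in a half-space. It provides a velocity of finite rate for
  \<open>tight_rate_function_Jt\<close>.\<close>

lemma rate_le_lower_epi:
  assumes "(w, c) \<in> lower_epi"
  shows "rate w \<le> ereal c"
  unfolding rate_def rate_I_le_iff
proof
  fix u assume "u \<in> Laplace_dom \<mu> (\<lambda>x. x)"
  then have u: "u \<in> law_dom" by (simp add: law_dom_def)
  have "u \<bullet> w - \<Lambda> u \<le> c + e" if "e > 0" for e
  proof -
    define \<delta> where "\<delta> = e / (1 + norm u)"
    have nu: "0 < 1 + norm u" by (simp add: add_pos_nonneg)
    have "(1 + norm u) * \<delta> = e" using nu by (simp add: \<delta>_def)
    then have \<delta>2: "\<delta> + norm u * \<delta> = e" by (simp add: distrib_right)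
    have \<delta>: "\<delta> > 0" using that nu by (simp add: \<delta>_def)
    obtain m where m: "0 < m" "exp (- real m * (c + \<delta>)) \<le> nearP m (real m *\<^sub>R w) (real m * \<delta>)"
      using lower_epiD[OF assms \<delta>] by blast
    have "nearP m (real m *\<^sub>R w) (real m * \<delta>) \<le> Pr {x. real m * (u \<bullet> w - norm u * \<delta>) \<le> u \<bullet> psum m x}"
      unfolding nearP_def
    proof (intro P.finite_measure_mono subsetI CollectI psum_halfspace_event)
      fix x assume "x \<in> {x. norm (psum m x - real m *\<^sub>R w) \<le> real m * \<delta>}"
      then have "norm u * norm (psum m x - real m *\<^sub>R w) \<le> norm u * (real m * \<delta>)" by (simp add: mult_left_mono)
      then have "\<bar>u \<bullet> (psum m x - real m *\<^sub>R w)\<bar> \<le> norm u * (real m * \<delta>)"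
        using Cauchy_Schwarz_ineq2 order_trans by blast
      then show "real m * (u \<bullet> w - norm u * \<delta>) \<le> u \<bullet> psum m x"
        by (simp add: inner_diff_right algebra_simps)
    qed
    also have "\<dots> \<le> exp (real m * \<Lambda> u - real m * (u \<bullet> w - norm u * \<delta>))" by (rule chernoff[OF u])
    finally have "exp (- real m * (c + \<delta>)) \<le> exp (real m * \<Lambda> u - real m * (u \<bullet> w - norm u * \<delta>))" using m(2) by linarith
    then have "real m * (u \<bullet> w - \<Lambda> u) \<le> real m * (c + (\<delta> + norm u * \<delta>))" by (simp add: algebra_simps)
    then show ?thesis using m(1) \<delta>2 by simp
  qed
  then show "u \<bullet> w - log_mgf \<mu> (\<lambda>x. x) u \<le> c" unfolding \<Lambda>_def[symmetric] by (rule field_le_epsilon)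
qed

lemma lower_epi_nonempty: "\<exists>p. p \<in> lower_epi"
proof -
  have "ennreal (exp (- 1)) < (\<integral>\<^sup>+y. ennreal (exp (0 \<bullet> y)) \<partial>\<mu>)"
    by (simp add: law_total ennreal_less_one_iff)
  then show ?thesis using lower_epi_from_mgf by blast
qed

text \<open>The set \<^term>\<open>lower_epi\<close> is closed and convex. If it missed \<open>(v, c)\<close>, a separating hyperplane
  would provide \<open>u\<close> and \<open>\<theta>\<close> such that \<open>exp \<theta>\<close> is below the moment generating function at \<open>u\<close> but no
  \<open>(w, u \<bullet> w - \<theta>)\<close> belongs to the set.\<close>

lemma cramer_lower:
  assumes rv: "rate v \<le> ereal c"
  shows "(v, c) \<in> lower_epi"
proof (rule ccontr)
  assume "(v, c) \<notin> lower_epi"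
  then obtain p \<beta> where sep: "p \<bullet> (v, c) < \<beta>" "\<And>q. q \<in> lower_epi \<Longrightarrow> \<beta> < p \<bullet> q"
    using separating_hyperplane_closed_point[OF convex_lower_epi closed_lower_epi] by metis
  obtain a b where p: "p = (a, b)" by (cases p)
  have sep1: "a \<bullet> v + b * c < \<beta>" using sep(1) by (simp add: p)
  have sep2: "\<beta> < a \<bullet> w + b * c'" if "(w, c') \<in> lower_epi" for w c' using sep(2)[OF that] by (simp add: p)
  \<comment> \<open>The set is closed under raising the level, which a negative vertical coefficient
    would contradict.\<close>
  have b: "0 \<le> b"
  proof (rule ccontr)
    assume "\<not> 0 \<le> b"
    then have b: "b < 0" by simp
    obtain w c' where E: "(w, c') \<in> lower_epi" using lower_epi_nonempty by auto
    define K where "K = (\<bar>a \<bullet> w + b * c' - \<beta>\<bar> + 1) / (- b)"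
    have K: "K \<ge> 0" unfolding K_def using b by (intro divide_nonneg_pos) auto
    have bK: "b * K = - (\<bar>a \<bullet> w + b * c' - \<beta>\<bar> + 1)" using b by (simp add: K_def)
    have "\<beta> < a \<bullet> w + b * (c' + K)" using K by (intro sep2 lower_epi_up[OF E]) simp
    then show False using bK by (simp add: distrib_left)
  qed
  \<comment> \<open>The hyperplane may be vertical (\<open>b = 0\<close>). Raising \<open>b\<close>
    by \<open>l\<close> turns it into the graph of an affine function: \<open>l\<close> spends at
    most half of the gap at \<open>(v, c)\<close>, and over the set, where levels are nonnegative,
    the separation can only improve.\<close>
  define l where "l = (\<beta> - (a \<bullet> v + b * c)) / (2 * (\<bar>c\<bar> + 1))"
  have l: "l > 0" using sep1 by (simp add: l_def)
  have "l * c \<le> l * (\<bar>c\<bar> + 1)" using l by (intro mult_left_mono) auto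
  also have "\<dots> = (\<beta> - (a \<bullet> v + b * c)) / 2"
    unfolding l_def by (simp add: field_simps add_pos_nonneg)
  also have "\<dots> < \<beta> - (a \<bullet> v + b * c)" using sep1 by simp
  finally have lc: "l * c < \<beta> - (a \<bullet> v + b * c)" .
  define b' where "b' = b + l"
  have b': "b' > 0" using b l by (simp add: b'_def)
  have s1: "a \<bullet> v + b' * c < \<beta>" using lc by (simp add: b'_def algebra_simps)
  have s2: "\<beta> < a \<bullet> w + b' * c'" if "(w, c') \<in> lower_epi" for w c'
  proof -
    have "0 \<le> l * c'" using lower_epi_nonneg[OF that] l by simp
    then show ?thesis using sep2[OF that] by (simp add: b'_def algebra_simps)
  qed
  \<comment> \<open>The hyperplane solved for the level: the graph of
    \<open>u \<bullet> w - \<theta>\<close> passes strictly above \<open>(v, c)\<close> and strictly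
    below the set.\<close>
  define u where "u = - (a /\<^sub>R b')"
  define \<theta> where "\<theta> = - (\<beta> / b')"
  have ui: "u \<bullet> w = - (a \<bullet> w / b')" for w by (simp add: u_def divide_inverse mult.commute)
  have t1: "c < u \<bullet> v - \<theta>" using s1 b' by (simp add: ui \<theta>_def field_simps)
  have t2: "u \<bullet> w - \<theta> < c'" if "(w, c') \<in> lower_epi" for w c'
    using s2[OF that] b' by (simp add: ui \<theta>_def field_simps)
  have "ennreal (exp \<theta>) < (\<integral>\<^sup>+y. ennreal (exp (u \<bullet> y)) \<partial>\<mu>)"
  proof (rule ccontr)
    assume "\<not> ?thesis"
    then have le: "(\<integral>\<^sup>+y. ennreal (exp (u \<bullet> y)) \<partial>\<mu>) \<le> ennreal (exp \<theta>)" by simp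
    then have u: "u \<in> law_dom" by (simp add: law_dom_def Laplace_dom_def le_less_trans ennreal_less_top)
    then have "\<Lambda> u \<le> \<theta>" using le by (simp add: mgf_eq)
    moreover have "u \<bullet> v - \<Lambda> u \<le> c"
      using rv u unfolding rate_def rate_I_le_iff by (auto simp: \<Lambda>_def law_dom_def)
    ultimately show False using t1 by linarith
  qed
  then obtain w where "(w, u \<bullet> w - \<theta>) \<in> lower_epi" using lower_epi_from_mgf by blast
  then show False using t2 by fastforce
qed

section \<open>Tubes around a motion of constant velocity, and independent groups of steps\<close>

definition tube :: "'a \<Rightarrow> nat \<Rightarrow> real \<Rightarrow> real \<Rightarrow> (nat \<Rightarrow> 'a) set" where
  "tube v l \<epsilon> C = {x. (\<forall>k\<le>l. norm (psum k x - real k *\<^sub>R v) \<le> real k * \<epsilon> + C) \<and> (\<forall>i<l. norm (x i) \<le> C)}"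

lemma bounded_event: "{x. \<forall>i<m. norm (x i) \<le> R} \<in> sets S"
proof (induction m)
  case 0
  then show ?case using sets.top[of S] by simp
next
  case (Suc m)
  have "{x. norm (x m) \<le> R} = (\<lambda>x. x m) -` cball 0 R \<inter> space S" by auto
  also have "\<dots> \<in> sets S" by (rule measurable_sets[OF measurable_coord]) simp
  finally have "{x. \<forall>i<m. norm (x i) \<le> R} \<inter> {x. norm (x m) \<le> R} \<in> sets S" using Suc by (intro sets.Int)
  also have "{x. \<forall>i<m. norm (x i) \<le> R} \<inter> {x. norm (x m) \<le> R} = {x. \<forall>i<Suc m. norm (x i) \<le> R}"
    by (auto simp: less_Suc_eq)
  finally show ?case .
qed

lemma tube_event: "tube v l \<epsilon> C \<in> sets S"
proof -
  have "(\<Inter>k\<in>{..l}. {x. norm (psum k x - real k *\<^sub>R v) \<le> real k * \<epsilon> + C}) \<in> sets S"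
    by (intro sets.finite_INT) (auto simp: psum_near_event)
  then have "(\<Inter>k\<in>{..l}. {x. norm (psum k x - real k *\<^sub>R v) \<le> real k * \<epsilon> + C}) \<inter> {x. \<forall>i<l. norm (x i) \<le> C} \<in> sets S"
    using bounded_event by (rule sets.Int)
  also have "(\<Inter>k\<in>{..l}. {x. norm (psum k x - real k *\<^sub>R v) \<le> real k * \<epsilon> + C}) \<inter> {x. \<forall>i<l. norm (x i) \<le> C} = tube v l \<epsilon> C"
    by (auto simp: tube_def)
  finally show ?thesis .
qed

lemma tube_dep: "(\<And>i. i < l \<Longrightarrow> x i = y i) \<Longrightarrow> x \<in> tube v l \<epsilon> C \<Longrightarrow> y \<in> tube v l \<epsilon> C"
proof -
  assume xy: "\<And>i. i < l \<Longrightarrow> x i = y i" and x: "x \<in> tube v l \<epsilon> C"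
  have "psum k x = psum k y" if "k \<le> l" for k using xy that by (intro psum_cong) auto
  then show "y \<in> tube v l \<epsilon> C" using x xy by (auto simp: tube_def)
qed

text \<open>Repeat one block length \<open>m\<close> for which Cramer's bound holds. Deviations add
  up linearly over complete blocks and stay bounded inside a block, so \<open>C\<close> does not
  depend on \<open>l\<close>. The bound on single steps later controls the variation and the path
  between integer times.\<close>

lemma tube_bound:
  assumes rv: "rate v \<le> ereal c" and \<epsilon>: "\<epsilon> > 0" and \<eta>: "\<eta> > 0"
  obtains C where "\<And>l. exp (- real l * (c + \<eta>) - C) \<le> Pr (tube v l \<epsilon> C)"
proof -
  have E: "(v, c) \<in> lower_epi" by (rule cramer_lower[OF rv])
  have c0: "0 \<le> c" by (rule lower_epi_nonneg[OF E])
  define \<delta> where "\<delta> = min \<epsilon> (\<eta> / 2)"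
  have \<delta>: "\<delta> > 0" "\<delta> \<le> \<epsilon>" "\<delta> < \<eta>" using \<epsilon> \<eta> by (auto simp: \<delta>_def)
  obtain m where m: "0 < m" "exp (- real m * (c + \<delta>)) \<le> nearP m (real m *\<^sub>R v) (real m * \<delta>)"
    using lower_epiD[OF E \<delta>(1)] by blast
  \<comment> \<open>Bounding the steps is free in the limit of large \<open>R\<close>: the strict
    gap between \<open>\<delta>\<close> and \<open>\<eta>\<close> absorbs the loss.\<close>
  define G where "G R = {x. norm (psum m x - real m *\<^sub>R v) \<le> real m * \<epsilon>} \<inter> {x. \<forall>i<m. norm (x i) \<le> R}" for R
  have G_event: "G R \<in> sets S" for R unfolding G_def by (intro sets.Int bounded_event psum_near_event)
  have "\<exists>R::nat. exp (- real m * (c + \<eta>)) < Pr (G (real R))"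
  proof -
    have "(\<Union>R. G (real R)) = {x. norm (psum m x - real m *\<^sub>R v) \<le> real m * \<epsilon>}"
    proof (intro subset_antisym subsetI)
      fix x assume x: "x \<in> {x. norm (psum m x - real m *\<^sub>R v) \<le> real m * \<epsilon>}"
      obtain R :: nat where R: "(\<Sum>i<m. norm (x i)) \<le> real R" using real_arch_simple by blast
      have "norm (x i) \<le> real R" if "i < m" for i
        using member_le_sum[of i "{..<m}" "\<lambda>i. norm (x i)"] that R by force
      then show "x \<in> (\<Union>R. G (real R))" using x by (auto simp: G_def)
    qed (auto simp: G_def)
    moreover have "(\<lambda>R. Pr (G (real R))) \<longlonglongrightarrow> Pr (\<Union>R. G (real R))"
    proof (rule P.finite_Lim_measure_incseq)
      show "range (\<lambda>R. G (real R)) \<subseteq> P.events" using G_event by auto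
      show "incseq (\<lambda>R. G (real R))"
        by (rule incseq_SucI) (auto simp: G_def intro: order_trans)
    qed
    moreover have "exp (- real m * (c + \<eta>)) < exp (- real m * (c + \<delta>))" using m(1) \<delta>(3) by simp
    moreover have "nearP m (real m *\<^sub>R v) (real m * \<delta>) \<le> nearP m (real m *\<^sub>R v) (real m * \<epsilon>)"
      using \<delta>(2) by (intro nearP_mono) (simp add: mult_left_mono)
    moreover from calculation(3,4) m(2) have "exp (- real m * (c + \<eta>)) < nearP m (real m *\<^sub>R v) (real m * \<epsilon>)"
      by linarith
    ultimately have "\<forall>\<^sub>F R in sequentially. exp (- real m * (c + \<eta>)) < Pr (G (real R))"
      by (intro order_tendstoD(1)[where y = "nearP m (real m *\<^sub>R v) (real m * \<epsilon>)"]) (auto simp: nearP_def)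
    then show ?thesis unfolding eventually_sequentially by auto
  qed
  then obtain R :: nat where R: "exp (- real m * (c + \<eta>)) \<le> Pr (G (real R))"
    using order_less_imp_le by blast
  \<comment> \<open>Large enough to dominate a single step, the deviation inside a block, and the
    exponent of one block.\<close>
  define C where "C = real m * (real R + norm v + c + \<eta>)"
  have C1: "real m * (real R + norm v) \<le> C" "real m * (c + \<eta>) \<le> C"
    using c0 \<eta> by (auto simp: C_def intro!: mult_left_mono)
  have "real R \<le> 1 * (real R + norm v)" by simp
  also have "\<dots> \<le> real m * (real R + norm v)" using m(1) by (intro mult_right_mono) auto
  finally have C2: "real R \<le> C" using C1 by linarith
  have short: "norm (psum k x - real k *\<^sub>R v) \<le> C" if "x \<in> G (real R)" "k \<le> m" for x k
  proof -
    have "norm (psum k x) \<le> real k * real R"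
      unfolding psum_def using that sum_norm_le[of "{..<k}" x "\<lambda>_. real R"] by (auto simp: G_def)
    then have "norm (psum k x - real k *\<^sub>R v) \<le> real k * real R + real k * norm v"
      using norm_triangle_ineq4[of "psum k x" "real k *\<^sub>R v"] by simp
    also have "\<dots> = real k * (real R + norm v)" by (simp add: distrib_left)
    also have "\<dots> \<le> real m * (real R + norm v)" using that by (intro mult_right_mono) auto
    finally show ?thesis using C1 by linarith
  qed
  \<comment> \<open>Induction by blocks of length \<open>m\<close>. A remainder shorter than
    \<open>m\<close> is covered by the event for one full block, which explains the additive term in
    the exponent.\<close>
  have main: "exp (- real l * (c + \<eta>) - real m * (c + \<eta>)) \<le> Pr (tube v l \<epsilon> C)" for l
  proof (induction l rule: less_induct)
    case (less l)
    show ?case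
    proof (cases "l < m")
      case True
      have "G (real R) \<subseteq> tube v l \<epsilon> C"
      proof
        fix x assume x: "x \<in> G (real R)"
        have "norm (psum k x - real k *\<^sub>R v) \<le> real k * \<epsilon> + C" if "k \<le> l" for k
          using short[OF x, of k] that True \<epsilon> by (simp add: add_increasing)
        moreover have "norm (x i) \<le> C" if "i < l" for i
        proof -
          have "norm (x i) \<le> real R" using x that True by (auto simp: G_def)
          then show ?thesis using C2 by linarith
        qed
        ultimately show "x \<in> tube v l \<epsilon> C" by (simp add: tube_def)
      qed
      then have "Pr (G (real R)) \<le> Pr (tube v l \<epsilon> C)" by (intro P.finite_measure_mono tube_event)
      moreover have "exp (- real l * (c + \<eta>) - real m * (c + \<eta>)) \<le> exp (- real m * (c + \<eta>))"
        using c0 \<eta> by simp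
      ultimately show ?thesis using R by linarith
    next
      case False
      define l' where "l' = l - m"
      have l': "l = m + l'" "l' < l" using False m(1) by (auto simp: l'_def)
      have "exp (- real l * (c + \<eta>) - real m * (c + \<eta>))
          = exp (- real m * (c + \<eta>)) * exp (- real l' * (c + \<eta>) - real m * (c + \<eta>))"
        by (simp add: l' exp_add[symmetric] algebra_simps)
      also have "\<dots> \<le> Pr (G (real R)) * Pr (tube v l' \<epsilon> C)"
        using R less[OF l'(2)] by (intro mult_mono) auto
      also have "\<dots> = Pr {x. x \<in> G (real R) \<and> shift m x \<in> tube v l' \<epsilon> C}"
      proof (rule Pr_concat[OF G_event tube_event, symmetric])
        show "y \<in> G (real R)" if "\<And>i. i < m \<Longrightarrow> x i = y i" "x \<in> G (real R)" for x y
          using that psum_cong[of m x y, OF that(1)] by (auto simp: G_def)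
      qed
      also have "\<dots> \<le> Pr (tube v l \<epsilon> C)"
      proof (intro P.finite_measure_mono tube_event subsetI)
        fix x assume "x \<in> {x. x \<in> G (real R) \<and> shift m x \<in> tube v l' \<epsilon> C}"
        then have x: "x \<in> G (real R)" and sx: "shift m x \<in> tube v l' \<epsilon> C" by auto
        have "norm (psum k x - real k *\<^sub>R v) \<le> real k * \<epsilon> + C" if k: "k \<le> l" for k
        proof (cases "k \<le> m")
          case True
          then show ?thesis using short[OF x True] \<epsilon> by (simp add: add_increasing)
        next
          case False
          define k' where "k' = k - m"
          have k': "k = m + k'" "k' \<le> l'" using False k l' by (auto simp: k'_def)
          have "psum k x - real k *\<^sub>R v = (psum m x - real m *\<^sub>R v) + (psum k' (shift m x) - real k' *\<^sub>R v)"
            unfolding k'(1) psum_add by (simp add: scaleR_add_left)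
          then have "norm (psum k x - real k *\<^sub>R v)
              \<le> norm (psum m x - real m *\<^sub>R v) + norm (psum k' (shift m x) - real k' *\<^sub>R v)"
            by (simp only: norm_triangle_ineq)
          also have "\<dots> \<le> real m * \<epsilon> + (real k' * \<epsilon> + C)"
            using x sx k'(2) by (intro add_mono) (auto simp: G_def tube_def)
          finally show ?thesis by (simp add: k'(1) algebra_simps)
        qed
        moreover have "norm (x i) \<le> C" if "i < l" for i
        proof (cases "i < m")
          case True
          then have "norm (x i) \<le> real R" using x by (auto simp: G_def)
          then show ?thesis using C2 by linarith
        next
          case False
          then have "x i = shift m x (i - m)" by (simp add: shift_def)
          moreover have "i - m < l'" using that False l' by simp
          ultimately show ?thesis using sx by (simp add: tube_def)
        qed
        ultimately show "x \<in> tube v l \<epsilon> C" by (simp add: tube_def)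
      qed
      finally show ?thesis .
    qed
  qed
  show ?thesis
  proof (rule that)
    fix l
    have "exp (- real l * (c + \<eta>) - C) \<le> exp (- real l * (c + \<eta>) - real m * (c + \<eta>))" using C1 by simp
    then show "exp (- real l * (c + \<eta>) - C) \<le> Pr (tube v l \<epsilon> C)" using main[of l] by linarith
  qed
qed

text \<open>Iterated \<open>Pr_concat\<close>. Groups may be empty, because in the lower bound two
  nodes can round to the same step when \<open>n\<close> is small.\<close>

lemma Pr_groups:
  assumes k: "k 0 = 0" "\<And>j. j < m \<Longrightarrow> k j \<le> k (Suc j)"
    and A: "\<And>j. j < m \<Longrightarrow> A j \<in> sets S"
    and dep: "\<And>j x y. j < m \<Longrightarrow> (\<And>i. i < k (Suc j) - k j \<Longrightarrow> x i = y i) \<Longrightarrow> x \<in> A j \<Longrightarrow> y \<in> A j"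
  shows "{x. \<forall>j<m. shift (k j) x \<in> A j} \<in> sets S \<and> Pr {x. \<forall>j<m. shift (k j) x \<in> A j} = (\<Prod>j<m. Pr (A j))"
  using k(2) A dep
proof (induction m)
  case 0
  then show ?case using P.prob_space sets.top[of S] by simp
next
  case (Suc m)
  let ?D = "{x. \<forall>j<m. shift (k j) x \<in> A j}"
  have IH: "?D \<in> sets S \<and> Pr ?D = (\<Prod>j<m. Pr (A j))"
  proof (rule Suc.IH)
    show "y \<in> A j" if "j < m" "\<And>i. i < k (Suc j) - k j \<Longrightarrow> x i = y i" "x \<in> A j" for j x y
      using Suc.prems(3)[of j x y] that by simp
  qed (use Suc.prems in auto)
  have eq: "{x. \<forall>j<Suc m. shift (k j) x \<in> A j} = {x. x \<in> ?D \<and> shift (k m) x \<in> A m}"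
    by (auto simp: less_Suc_eq)
  have mono: "k i \<le> k j" if "i \<le> j" "j \<le> Suc m" for i j
    using that
  proof (induction j)
    case (Suc j)
    then show ?case using \<open>\<And>j. j < Suc m \<Longrightarrow> k j \<le> k (Suc j)\<close>[of j] by (cases "i = Suc j") auto
  qed simp
  have "Pr {x. x \<in> ?D \<and> shift (k m) x \<in> A m} = Pr ?D * Pr (A m)"
  proof (rule Pr_concat)
    show "y \<in> ?D" if xy: "\<And>i. i < k m \<Longrightarrow> x i = y i" and x: "x \<in> ?D" for x y
    proof (intro CollectI allI impI)
      fix j assume j: "j < m"
      show "shift (k j) y \<in> A j"
      proof (rule Suc.prems(3)[of j "shift (k j) x"])
        fix i assume "i < k (Suc j) - k j"
        then have "k j + i < k m" using mono[of "Suc j" m] j by simp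
        then show "shift (k j) x i = shift (k j) y i" using xy by (simp add: shift_def)
      qed (use j x in auto)
    qed
  qed (use IH Suc.prems in auto)
  moreover have "{x. x \<in> ?D \<and> shift (k m) x \<in> A m} \<in> sets S"
  proof -
    have "?D \<inter> (shift (k m) -` A m \<inter> space S) \<in> sets S"
      using IH Suc.prems(2)[of m] by (intro sets.Int measurable_sets[OF measurable_shift]) auto
    also have "?D \<inter> (shift (k m) -` A m \<inter> space S) = {x. x \<in> ?D \<and> shift (k m) x \<in> A m}" by auto
    finally show ?thesis .
  qed
  ultimately show ?case using IH unfolding eq by simp
qed

section \<open>Exponential moments and the control of variation\<close>

lemma exp_moment:
  assumes "0 \<in> interior law_dom"
  obtains l c where "l > 0" "c \<ge> 0" "(\<integral>\<^sup>+y. ennreal (exp (l * norm y)) \<partial>\<mu>) \<le> ennreal (exp c)"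
proof -
  obtain r where r: "r > 0" "ball 0 r \<subseteq> law_dom" using assms by (auto simp: mem_interior)
  \<comment> \<open>The norm is at most \<open>DIM('a)\<close> times the largest coordinate, so
    \<open>exp (l * norm y)\<close> is dominated by the exponentials along the axes in both
    directions, at vectors of length \<open>r / 2\<close>.\<close>
  define l where "l = r / (2 * real DIM('a))"
  have l: "l > 0" using r(1) by (simp add: l_def)
  let ?d = "l * real DIM('a)"
  have d: "0 < ?d" "?d < r" using r(1) by (auto simp: l_def)
  have dom: "?d *\<^sub>R b \<in> law_dom" "(- ?d) *\<^sub>R b \<in> law_dom" if "b \<in> Basis" for b
    using d that by (auto intro!: subsetD[OF r(2)])
  have le: "exp (l * norm y) \<le> (\<Sum>b\<in>Basis. exp ((?d *\<^sub>R b) \<bullet> y) + exp (((- ?d) *\<^sub>R b) \<bullet> y))" for y :: 'a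
  proof -
    define B where "B = Max ((\<lambda>b. \<bar>y \<bullet> b\<bar>) ` Basis)"
    have "B \<in> (\<lambda>b. \<bar>y \<bullet> b\<bar>) ` Basis" unfolding B_def by (intro Max_in) auto
    then obtain b where b: "b \<in> Basis" "B = \<bar>y \<bullet> b\<bar>" by auto
    have "norm y \<le> (\<Sum>b\<in>Basis. \<bar>y \<bullet> b\<bar>)" by (rule norm_le_l1)
    also have "\<dots> \<le> (\<Sum>b\<in>(Basis :: 'a set). B)" unfolding B_def by (intro sum_mono Max_ge) auto
    finally have "norm y \<le> real DIM('a) * \<bar>y \<bullet> b\<bar>" using b by simp
    then have "l * norm y \<le> ?d * \<bar>y \<bullet> b\<bar>" using l by (simp add: mult.assoc mult_left_mono)
    then have "exp (l * norm y) \<le> exp (?d * \<bar>y \<bullet> b\<bar>)" by simp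
    also have "\<dots> \<le> exp ((?d *\<^sub>R b) \<bullet> y) + exp (((- ?d) *\<^sub>R b) \<bullet> y)"
      by (cases "0 \<le> y \<bullet> b") (auto simp: inner_commute[of y] add_increasing add_increasing2)
    also have "\<dots> \<le> (\<Sum>b\<in>Basis. exp ((?d *\<^sub>R b) \<bullet> y) + exp (((- ?d) *\<^sub>R b) \<bullet> y))"
      using b(1) by (intro member_le_sum) auto
    finally show ?thesis .
  qed
  have "(\<integral>\<^sup>+y. ennreal (exp (l * norm y)) \<partial>\<mu>)
      \<le> (\<integral>\<^sup>+y. (\<Sum>b\<in>Basis. ennreal (exp ((?d *\<^sub>R b) \<bullet> y)) + ennreal (exp (((- ?d) *\<^sub>R b) \<bullet> y))) \<partial>\<mu>)"
  proof (rule nn_integral_mono)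
    fix y :: 'a
    have "ennreal (\<Sum>b\<in>Basis. exp ((?d *\<^sub>R b) \<bullet> y) + exp (((- ?d) *\<^sub>R b) \<bullet> y))
        = (\<Sum>b\<in>Basis. ennreal (exp ((?d *\<^sub>R b) \<bullet> y)) + ennreal (exp (((- ?d) *\<^sub>R b) \<bullet> y)))"
      by (subst sum_ennreal[symmetric]) (auto intro!: sum.cong add_nonneg_nonneg)
    then show "ennreal (exp (l * norm y))
        \<le> (\<Sum>b\<in>Basis. ennreal (exp ((?d *\<^sub>R b) \<bullet> y)) + ennreal (exp (((- ?d) *\<^sub>R b) \<bullet> y)))"
      using ennreal_leI[OF le[of y]] by simp
  qed
  also have "\<dots> = (\<Sum>b\<in>Basis. (\<integral>\<^sup>+y. ennreal (exp ((?d *\<^sub>R b) \<bullet> y)) \<partial>\<mu>) + (\<integral>\<^sup>+y. ennreal (exp (((- ?d) *\<^sub>R b) \<bullet> y)) \<partial>\<mu>))"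
  proof -
    have m: "(\<lambda>y. ennreal (exp (u \<bullet> y))) \<in> borel_measurable \<mu>" for u by (rule measurable_law) measurable
    show ?thesis
      by (subst nn_integral_sum) (intro borel_measurable_add m, intro sum.cong refl nn_integral_add m)
  qed
  also have "\<dots> < \<infinity>"
  proof -
    have "(\<integral>\<^sup>+y. ennreal (exp (u \<bullet> y)) \<partial>\<mu>) < \<infinity>" if "u \<in> law_dom" for u
      using that by (simp add: law_dom_def Laplace_dom_def)
    from this[OF dom(1)] this[OF dom(2)] show ?thesis by simp
  qed
  finally have fin: "(\<integral>\<^sup>+y. ennreal (exp (l * norm y)) \<partial>\<mu>) < \<infinity>" .
  let ?I = "\<integral>\<^sup>+y. ennreal (exp (l * norm y)) \<partial>\<mu>"
  have "(\<integral>\<^sup>+y. 1 \<partial>\<mu>) \<le> ?I" using l by (intro nn_integral_mono) (simp add: ennreal_1[symmetric] del: ennreal_1)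
  then have "1 \<le> ?I" by (simp add: law_total)
  then have ge: "1 \<le> enn2real ?I" using fin by (metis enn2real_mono enn2real_1 infinity_ennreal_def)
  then have "?I = ennreal (exp (ln (enn2real ?I)))" using fin by simp
  then show ?thesis using that[of l "ln (enn2real ?I)"] l ge by simp
qed

text \<open>Evaluate the supremum at the vector of length \<open>l\<close> in the direction of
  \<open>v\<close>. This linear growth is what makes the cost dominate the variation.\<close>

lemma rate_ge_norm:
  assumes l: "l > 0" and c: "(\<integral>\<^sup>+y. ennreal (exp (l * norm y)) \<partial>\<mu>) \<le> ennreal (exp c)"
  shows "ereal (l * norm v - c) \<le> rate v"
proof -
  let ?u = "l *\<^sub>R sgn v"
  have "?u \<bullet> y \<le> l * norm y" for y
  proof -
    have "sgn v \<bullet> y \<le> norm (sgn v) * norm y" by (rule norm_cauchy_schwarz)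
    also have "\<dots> \<le> 1 * norm y" by (intro mult_right_mono) (auto simp: norm_sgn)
    finally show ?thesis using l by simp
  qed
  then have "(\<integral>\<^sup>+y. ennreal (exp (?u \<bullet> y)) \<partial>\<mu>) \<le> (\<integral>\<^sup>+y. ennreal (exp (l * norm y)) \<partial>\<mu>)"
    by (intro nn_integral_mono) simp
  then have le: "(\<integral>\<^sup>+y. ennreal (exp (?u \<bullet> y)) \<partial>\<mu>) \<le> ennreal (exp c)" using c by (rule order_trans)
  then have u: "?u \<in> law_dom" by (simp add: law_dom_def Laplace_dom_def le_less_trans ennreal_less_top)
  have "\<Lambda> ?u \<le> c" using le unfolding mgf_eq[OF u] by simp
  moreover have "?u \<bullet> v = l * norm v"
    by (cases "v = 0") (simp_all add: sgn_div_norm dot_square_norm power2_eq_square)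
  ultimately have "l * norm v - c \<le> ?u \<bullet> v - \<Lambda> ?u" by linarith
  then have "ereal (l * norm v - c) \<le> ereal (?u \<bullet> v - \<Lambda> ?u)" unfolding ereal_less_eq .
  also have "\<dots> \<le> rate v" unfolding rate_def \<Lambda>_def using u by (intro rate_I_ge) (simp add: law_dom_def)
  finally show ?thesis .
qed

lemma variation_event: "{x. c \<le> (\<Sum>i<n. norm (x i))} \<in> sets S"
proof -
  have "(\<lambda>x. \<Sum>i<n. norm (x i)) \<in> borel_measurable S" by measurable
  from measurable_sets[OF this, of "{c..}"] show ?thesis by (simp add: vimage_def)
qed

text \<open>Markov's inequality for the exponential of the summed norms; a larger \<open>R\<close>
  makes the exponent as negative as desired.\<close>

lemma variation_tail:
  assumes l: "l > 0" and c: "(\<integral>\<^sup>+y. ennreal (exp (l * norm y)) \<partial>\<mu>) \<le> ennreal (exp c)"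
  shows "Pr {x. real n * R \<le> (\<Sum>i<n. norm (x i))} \<le> exp (real n * (c - l * R))"
proof -
  have "emeasure S {x\<in>space S. 1 \<le> ennreal (exp (- (l * (real n * R)))) * (\<Prod>i<n. ennreal (exp (l * norm (x i))))}
      \<le> ennreal (exp (- (l * (real n * R)))) * (\<integral>\<^sup>+x. (\<Prod>i<n. ennreal (exp (l * norm (x i)))) * indicator (space S) x \<partial>S)"
    by (rule nn_integral_Markov_inequality) (use sets.top[of S] in auto)
  also have "(\<integral>\<^sup>+x. (\<Prod>i<n. ennreal (exp (l * norm (x i)))) * indicator (space S) x \<partial>S)
      = (\<integral>\<^sup>+y. ennreal (exp (l * norm y)) \<partial>\<mu>) ^ n"
    using nn_integral_prod_iid[of "\<lambda>y. ennreal (exp (l * norm y))" n] by simp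
  also have "ennreal (exp (- (l * (real n * R)))) * (\<integral>\<^sup>+y. ennreal (exp (l * norm y)) \<partial>\<mu>) ^ n
      \<le> ennreal (exp (- (l * (real n * R)))) * ennreal (exp c) ^ n"
    using c by (intro mult_left_mono power_mono) auto
  also have "\<dots> = ennreal (exp (real n * (c - l * R)))"
    by (simp add: ennreal_power ennreal_mult[symmetric] exp_of_nat_mult[symmetric] exp_add[symmetric] algebra_simps)
  also have "{x\<in>space S. 1 \<le> ennreal (exp (- (l * (real n * R)))) * (\<Prod>i<n. ennreal (exp (l * norm (x i))))}
      = {x. real n * R \<le> (\<Sum>i<n. norm (x i))}"
    using l by (auto simp: prod_ennreal exp_sum[symmetric] ennreal_mult[symmetric] exp_add[symmetric]
        sum_distrib_left[symmetric] ennreal_1[symmetric] simp del: ennreal_1)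
  finally show ?thesis by (simp add: P.emeasure_eq_measure)
qed

end

section \<open>Large deviations of functionals of the paths\<close>

text \<open>A vertical slice of the closed epigraph is closed, so its infimum is attained, and it is
  closed under raising the level.\<close>

lemma lsc_reg_le_iff: "lsc_reg J y \<le> c \<longleftrightarrow> (y, c) \<in> closure {(z, c). J z \<le> c}"
proof
  let ?E = "{(z, c). J z \<le> c}"
  show "lsc_reg J y \<le> c" if "(y, c) \<in> closure ?E" unfolding lsc_reg_def using that by (intro Inf_lower) simp
  assume le: "lsc_reg J y \<le> c"
  have "closed ((\<lambda>c. (y, c)) -` closure ?E)"
    by (intro closed_vimage closed_closure continuous_intros)
  then have cl: "closed {c. (y, c) \<in> closure ?E}" by (simp add: vimage_def)
  have "(y, \<infinity>) \<in> closure ?E" by (rule subsetD[OF closure_subset]) simp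
  then have "{c. (y, c) \<in> closure ?E} \<noteq> {}" by blast
  from closed_contains_Inf_cl[OF cl this] have E: "(y, lsc_reg J y) \<in> closure ?E" by (simp add: lsc_reg_def)
  \<comment> \<open>Raising levels to at least \<open>c\<close> is continuous and preserves the
    epigraph, hence also its closure.\<close>
  have "(\<lambda>p. (fst p, max (snd p) c)) ` closure ?E \<subseteq> closure ?E"
  proof (rule image_closure_subset)
    show "continuous_on (closure ?E) (\<lambda>p. (fst p, max (snd p) c))" by (intro continuous_intros)
    have "(\<lambda>p. (fst p, max (snd p) c)) ` ?E \<subseteq> ?E" by (auto simp: le_max_iff_disj)
    then show "(\<lambda>p. (fst p, max (snd p) c)) ` ?E \<subseteq> closure ?E" using closure_subset by blast
  qed simp
  then show "(y, c) \<in> closure ?E" using E le by (force simp: max_def)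
qed

lemma closed_lsc_reg_sublevel: "closed {y. lsc_reg J y \<le> c}"
proof -
  have "closed ((\<lambda>y. (y, c)) -` closure {(z, c). J z \<le> c})"
    by (intro closed_vimage closed_closure continuous_intros)
  then show ?thesis by (simp add: lsc_reg_le_iff vimage_def)
qed

lemma lsc_reg_le: "lsc_reg J y \<le> J y"
  unfolding lsc_reg_le_iff by (rule subsetD[OF closure_subset]) simp

lemma lsc_reg_nbhd:
  assumes "open G" "y \<in> G" "lsc_reg J y \<le> c" "c < d"
  shows "\<exists>z\<in>G. J z < d"
proof -
  have "(y, c) \<in> closure {(z, c). J z \<le> c}" using assms(3) by (simp add: lsc_reg_le_iff)
  moreover have "open (G \<times> {..<d})" by (intro open_Times assms(1)) simp
  ultimately have "(G \<times> {..<d}) \<inter> {(z, c). J z \<le> c} \<noteq> {}"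
    using assms(2,4) by (subst open_Int_closure_eq_empty[symmetric]) auto
  then show ?thesis by (auto intro: le_less_trans)
qed

text \<open>Over an open set the regularization does not lower the infimum, so the lower bound of
  the LDP can be proved for \<open>J\<close> itself.\<close>

lemma INF_open_le_lsc_reg:
  assumes "open G"
  shows "(INF y\<in>G. J y) \<le> (INF y\<in>G. lsc_reg J y)"
proof (rule INF_greatest, rule ccontr)
  fix y assume y: "y \<in> G" "\<not> (INF y\<in>G. J y) \<le> lsc_reg J y"
  from y(2) have "lsc_reg J y < (INF y\<in>G. J y)" by (simp only: not_le)
  then obtain z where "z \<in> G" "J z < (INF y\<in>G. J y)"
    using lsc_reg_nbhd[OF assms y(1) order.refl, of J "INF y\<in>G. J y"] by blast
  then show False using INF_lower[of z G J] by simp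
qed

lemma lsc_reg_nonneg: "(\<And>y. 0 \<le> J y) \<Longrightarrow> 0 \<le> lsc_reg J y"
proof (rule ccontr)
  assume J: "\<And>y. 0 \<le> J y" and "\<not> 0 \<le> lsc_reg J y"
  then obtain z where "J z < 0" using lsc_reg_nbhd[OF open_UNIV UNIV_I order.refl, of J y 0] by (auto simp: not_le)
  then show False using J[of z] by simp
qed

text \<open>\<open>R a \<kappa>\<close> reads: \<open>\<kappa>\<close> is an admissible code of
  \<open>a\<close>. It is a relation since encoding involves choices; one representative per code
  supplies the centers.\<close>

lemma totally_bounded_from_codes:
  fixes f :: "'b \<Rightarrow> 'y::metric_space"
  assumes "finite C" "\<And>a. a \<in> A \<Longrightarrow> \<exists>\<kappa>\<in>C. R a \<kappa>"
    and "\<And>a b \<kappa>. a \<in> A \<Longrightarrow> b \<in> A \<Longrightarrow> R a \<kappa> \<Longrightarrow> R b \<kappa> \<Longrightarrow> dist (f a) (f b) < e"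
  shows "\<exists>k. finite k \<and> f ` A \<subseteq> (\<Union>x\<in>k. ball x e)"
proof (intro exI conjI subsetI)
  let ?g = "\<lambda>\<kappa>. f (SOME a. a \<in> A \<and> R a \<kappa>)"
  show "finite (?g ` C)" using assms(1) by simp
  fix y assume "y \<in> f ` A"
  then obtain a where a: "a \<in> A" "y = f a" by blast
  obtain \<kappa> where \<kappa>: "\<kappa> \<in> C" "R a \<kappa>" using assms(2)[OF a(1)] by blast
  have "(SOME a. a \<in> A \<and> R a \<kappa>) \<in> A \<and> R (SOME a. a \<in> A \<and> R a \<kappa>) \<kappa>"
    by (rule someI[of _ a]) (use a \<kappa> in simp)
  then have "dist (?g \<kappa>) y < e" using assms(3)[of "SOME a. a \<in> A \<and> R a \<kappa>" a \<kappa>] a \<kappa> by simp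
  then show "y \<in> (\<Union>x\<in>?g ` C. ball x e)" using \<kappa>(1) by auto
qed

text \<open>Completeness of the target enters here, through
  \<open>complete_eq_closed\<close>.\<close>

lemma compact_closure_totally_bounded:
  fixes S :: "'y::complete_space set"
  assumes "\<And>e. e > 0 \<Longrightarrow> \<exists>k. finite k \<and> S \<subseteq> (\<Union>x\<in>k. ball x e)"
  shows "compact (closure S)"
  unfolding compact_eq_totally_bounded complete_eq_closed
proof (intro conjI allI impI)
  show "closed (closure S)" by (rule closed_closure)
  fix e :: real assume e: "e > 0"
  then obtain k where k: "finite k" "S \<subseteq> (\<Union>x\<in>k. ball x (e / 2))" using assms[of "e / 2"] by auto
  have "closure S \<subseteq> (\<Union>x\<in>k. ball x e)"
  proof
    fix y assume "y \<in> closure S"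
    then obtain z where z: "z \<in> S" "dist z y < e / 2" using e unfolding closure_approachable by (meson half_gt_zero)
    then obtain x where "x \<in> k" "dist x z < e / 2" using k(2) by auto
    then show "y \<in> (\<Union>x\<in>k. ball x e)" using z dist_triangle[of x y z] by force
  qed
  then show "\<exists>k. finite k \<and> closure S \<subseteq> (\<Union>x\<in>k. ball x e)" using k(1) by blast
qed

text \<open>The number of groups from \<open>grouping_exists\<close> is bounded in terms of
  \<open>R\<close> and \<open>\<delta>\<close> alone, uniformly in \<open>N\<close>.\<close>

lemma pw_linear_coarse:
  fixes w :: "nat \<Rightarrow> 'a::real_normed_vector"
  assumes t: "nodes t N" and R: "(\<Sum>i<N. norm (w i)) \<le> R" and \<delta>: "\<delta> > 0"
    and N0: "2 * R / \<delta> + 1 \<le> real N0"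
  obtains k m where "m \<le> N0" "grouping k m N" "k \<in> {..m} \<rightarrow>\<^sub>E {..N}"
    "\<And>s. dist (pw_linear t w N s) (pw_linear (t \<circ> k) (groupsum w k) m s) \<le> 2 * \<delta>"
    "(\<Sum>j<m. norm (groupsum w k j)) \<le> R"
proof -
  obtain k0 m where k0: "grouping k0 m N" "real m * \<delta> \<le> 2 * (\<Sum>i<N. norm (w i)) + \<delta>"
    "\<And>j. j < m \<Longrightarrow> k0 (Suc j) = Suc (k0 j) \<or> groupsum (\<lambda>i. norm (w i)) k0 j \<le> \<delta>"
    using grouping_exists[OF \<delta>, of "\<lambda>i. norm (w i)" N] by auto
  \<comment> \<open>The restriction puts \<open>k\<close> into a finite set of extensional
    functions, so that it can serve as part of a code.\<close>
  define k where "k = restrict k0 {..m}"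
  have k: "grouping k m N" using k0(1) by (simp add: grouping_def k_def)
  have "real m * \<delta> \<le> 2 * R + \<delta>" using k0(2) R by linarith
  then have "real m \<le> 2 * R / \<delta> + 1" using \<delta> by (simp add: field_simps)
  then have m: "m \<le> N0" using N0 by linarith
  have "k \<in> {..m} \<rightarrow>\<^sub>E {..N}"
    using grouping_le[OF k0(1), of _ m] k0(1) by (auto simp: k_def grouping_def)
  moreover have "dist (pw_linear t w N s) (pw_linear (t \<circ> k) (groupsum w k) m s) \<le> 2 * \<delta>" for s
    by (rule pw_linear_coarse_dist[OF t k]) (use k0(3) \<delta> in \<open>auto simp: k_def groupsum_def\<close>)
  moreover have "(\<Sum>j<m. norm (groupsum w k j)) \<le> R"
  proof -
    have "(\<Sum>j<m. norm (groupsum w k j)) \<le> (\<Sum>j<m. groupsum (\<lambda>i. norm (w i)) k j)"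
      by (intro sum_mono norm_groupsum_le)
    also have "\<dots> = (\<Sum>i<N. norm (w i))"
      using groupsum_partial[OF k, of m "\<lambda>i. norm (w i)"] k by (simp add: grouping_def)
    finally show ?thesis using R by linarith
  qed
  ultimately show ?thesis using that m k by blast
qed

lemma finite_centers:
  fixes R :: real
  assumes "\<delta> > 0"
  obtains C :: "'a::euclidean_space set" where "finite C" "cball 0 R \<subseteq> (\<Union>c\<in>C. cball c \<delta>)"
proof -
  have "cball (0::'a) R \<subseteq> (\<Union>c\<in>cball 0 R. ball c \<delta>)" using assms by force
  then obtain C where "C \<subseteq> cball (0::'a) R" "finite C" "cball 0 R \<subseteq> (\<Union>c\<in>C. ball c \<delta>)"
    using compactE_image[OF compact_cball, of "cball 0 R" "\<lambda>w. ball w \<delta>" "0::'a" R] by (metis open_ball)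
  then show ?thesis using that[of C] ball_subset_cball[of _ \<delta>] by blast
qed

section \<open>Compactness of images of paths, and the rate function\<close>

locale path_functional = iid_law \<mu> for \<mu> :: "'a::euclidean_space measure" +
  fixes F :: "(real \<Rightarrow> 'a) \<Rightarrow> 'y::complete_space"
  assumes dom: "0 \<in> interior law_dom"
    and F_cont: "h \<in> BV01 \<Longrightarrow> e > 0 \<Longrightarrow> \<exists>\<delta>>0. \<forall>g\<in>BV01. rho1' g h < \<delta> \<longrightarrow> dist (F g) (F h) < e"
    and F_unif: "R > 0 \<Longrightarrow> e > 0 \<Longrightarrow> \<exists>\<delta>>0. \<forall>h\<in>{h\<in>BV01. var01 h \<le> ennreal R}.
           \<forall>g\<in>{h\<in>BV01. var01 h \<le> ennreal R}. rho1' g h < \<delta> \<longrightarrow> dist (F g) (F h) < e"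
begin

lemma F_unifE:
  assumes "R > 0" "e > 0"
  obtains \<delta> where "\<delta> > 0" "\<And>g h. g \<in> BV01 \<Longrightarrow> h \<in> BV01 \<Longrightarrow> var01 g \<le> ennreal R \<Longrightarrow> var01 h \<le> ennreal R \<Longrightarrow>
    rho1' g h < \<delta> \<Longrightarrow> dist (F g) (F h) < e"
  using F_unif[OF assms] by blast

abbreviation cost :: "(real \<Rightarrow> 'a) \<Rightarrow> ennreal" where "cost \<equiv> I_D \<mu> (\<lambda>x. x)"

definition Jt :: "'y \<Rightarrow> ereal" where "Jt = J_tilde \<mu> (\<lambda>x. x) F"

lemma Jt_nonneg: "0 \<le> Jt y"
  unfolding Jt_def J_tilde_def by (intro INF_greatest) simp

lemma Jt_le: "h \<in> BV01 \<Longrightarrow> Jt (F h) \<le> enn2ereal (cost h)"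
  unfolding Jt_def J_tilde_def by (intro INF_lower) simp

lemma Jt_lessE:
  assumes "Jt y < c"
  obtains h where "h \<in> BV01" "F h = y" "enn2ereal (cost h) < c"
  using assms unfolding Jt_def J_tilde_def INF_less_iff by blast

text \<open>\<open>rate_ge_norm\<close> summed over the slots of a partition: \<open>l\<close> times
  the variation is at most the cost plus \<open>c\<close>.\<close>

lemma var01_le_cost:
  obtains l c where "l > 0" "c \<ge> 0"
    "\<And>h r. h \<in> BV01 \<Longrightarrow> 0 \<le> r \<Longrightarrow> cost h \<le> ennreal r \<Longrightarrow> var01 h \<le> ennreal ((r + c) / l)"
proof -
  obtain l c where lc: "l > 0" "c \<ge> 0" "(\<integral>\<^sup>+y. ennreal (exp (l * norm y)) \<partial>\<mu>) \<le> ennreal (exp c)"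
    using exp_moment[OF dom] by metis
  have "var01 h \<le> ennreal ((r + c) / l)" if h: "h \<in> BV01" "0 \<le> r" "cost h \<le> ennreal r" for h r
    unfolding var01_def
  proof (rule SUP_least)
    fix T assume T: "T \<in> partitions01"
    then obtain t N where t: "nodes t N" "t ` {..N} = insert 0 (insert 1 T)" using partition_nodes by blast
    let ?w = "\<lambda>j. start0 h (t (Suc j)) - start0 h (t j)" and ?d = "\<lambda>j. t (Suc j) - t j"
    have each: "ennreal (l * norm (?w j)) \<le> e2ennreal (rate_I \<mu> (\<lambda>x. x) (?w j /\<^sub>R ?d j)) * ennreal (?d j) + ennreal (c * ?d j)"
      if j: "j < N" for j
    proof -
      have d: "?d j > 0" using nodes_step[OF t(1) j] by simp
      have "ennreal (l * norm (?w j /\<^sub>R ?d j) - c) \<le> e2ennreal (rate_I \<mu> (\<lambda>x. x) (?w j /\<^sub>R ?d j))"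
        using e2ennreal_mono[OF rate_ge_norm[OF lc(1,3), of "?w j /\<^sub>R ?d j"]] by (simp add: rate_def)
      then have "ennreal (l * norm (?w j /\<^sub>R ?d j)) \<le> e2ennreal (rate_I \<mu> (\<lambda>x. x) (?w j /\<^sub>R ?d j)) + ennreal c"
        using lc(2) by (simp add: ennreal_minus[symmetric] ennreal_minus_le_iff add.commute)
      then have "ennreal (l * norm (?w j /\<^sub>R ?d j)) * ennreal (?d j)
          \<le> (e2ennreal (rate_I \<mu> (\<lambda>x. x) (?w j /\<^sub>R ?d j)) + ennreal c) * ennreal (?d j)" by (rule mult_right_mono) simp
      moreover have "ennreal (l * norm (?w j /\<^sub>R ?d j)) * ennreal (?d j) = ennreal (l * norm (?w j))"
        using d lc(1) by (simp add: ennreal_mult[symmetric] divide_simps)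
      moreover have "ennreal c * ennreal (?d j) = ennreal (c * ?d j)"
        using d lc(2) by (simp add: ennreal_mult)
      ultimately show ?thesis by (simp add: distrib_right)
    qed
    have "ennreal (l * (\<Sum>j<N. norm (?w j))) = (\<Sum>j<N. ennreal (l * norm (?w j)))"
      using lc(1) by (subst sum_ennreal) (auto simp: sum_distrib_left)
    also have "\<dots> \<le> (\<Sum>j<N. e2ennreal (rate_I \<mu> (\<lambda>x. x) (?w j /\<^sub>R ?d j)) * ennreal (?d j) + ennreal (c * ?d j))"
      using each by (intro sum_mono) auto
    also have "\<dots> = pw_cost \<mu> (\<lambda>x. x) t ?w N + ennreal (\<Sum>j<N. c * ?d j)"
    proof -
      have "(\<Sum>j<N. ennreal (c * ?d j)) = ennreal (\<Sum>j<N. c * ?d j)"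
        using lc(2) less_imp_le[OF nodes_step[OF t(1)]] by (intro sum_ennreal) auto
      then show ?thesis by (simp add: sum.distrib pw_cost_def)
    qed
    also have "(\<Sum>j<N. c * ?d j) = c"
      using t(1) sum_lessThan_telescope[of t N] by (simp add: sum_distrib_left[symmetric] nodes_def)
    also have "pw_cost \<mu> (\<lambda>x. x) t ?w N + ennreal c \<le> ennreal r + ennreal c"
      using pw_cost_le_I_D[OF T t, of \<mu> "\<lambda>x. x" h] h(3) by (intro add_mono) auto
    also have "\<dots> = ennreal (r + c)" using h(2) lc(2) by simp
    finally have "l * (\<Sum>j<N. norm (?w j)) \<le> r + c" using h(2) lc(2) by (subst (asm) ennreal_le_iff) auto
    then have "(\<Sum>j<N. norm (?w j)) \<le> (r + c) / l" using lc(1) by (simp add: field_simps)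
    then show "(\<integral>\<^sup>+ s\<in>{0..1}. ennreal (norm (vector_derivative (pl h T) (at s))) \<partial>lborel) \<le> ennreal ((r + c) / l)"
      unfolding pl_eq_pw_linear[OF t] var_pw_linear[OF t(1)] by (rule ennreal_leI)
  qed
  then show ?thesis using that lc by blast
qed

definition polygons :: "real \<Rightarrow> (real \<Rightarrow> 'a) set" where
  "polygons R = {pw_linear t w N | t w N. nodes t N \<and> (\<Sum>i<N. norm (w i)) \<le> R}"

text \<open>Two polygons with the same code are joined by four errors below \<open>e / 4\<close>:
  coarsening the first, moving its nodes, exchanging its increments, and undoing the coarsening of
  the second.\<close>

lemma compact_polygons:
  assumes R: "R > 0"
  shows "compact (closure (F ` polygons R))"
proof (rule compact_closure_totally_bounded)
  fix e :: real assume e: "e > 0"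
  have e4: "e / 4 > 0" using e by simp
  obtain \<delta> where \<delta>: "\<delta> > 0" "\<And>g h. g \<in> BV01 \<Longrightarrow> h \<in> BV01 \<Longrightarrow> var01 g \<le> ennreal R \<Longrightarrow> var01 h \<le> ennreal R \<Longrightarrow>
    rho1' g h < \<delta> \<Longrightarrow> dist (F g) (F h) < e / 4" using F_unifE[OF R e4] by blast
  have close: "dist (F (pw_linear t w N)) (F (pw_linear t' w' N')) < e / 4"
    if "nodes t N" "nodes t' N'" "(\<Sum>i<N. norm (w i)) \<le> R" "(\<Sum>i<N'. norm (w' i)) \<le> R"
      "rho1' (pw_linear t w N) (pw_linear t' w' N') < \<delta>" for t t' w w' N N'
    using that by (intro \<delta>(2) pw_linear_BV01 order_trans[OF var01_pw_linear_le] ennreal_leI)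
  define N0 where "N0 = nat \<lceil>2 * R / (\<delta> / 4) + 1\<rceil>"
  have N0: "2 * R / (\<delta> / 4) + 1 \<le> real N0" unfolding N0_def by linarith
  \<comment> \<open>Increments near the same center differ by at most \<open>2 * \<delta>2\<close>,
    and up to \<open>N0\<close> of them must stay below \<open>\<delta>\<close> in total.\<close>
  define \<delta>2 where "\<delta>2 = \<delta> / (4 * (real N0 + 1))"
  have \<delta>2: "\<delta>2 > 0" "2 * real N0 * \<delta>2 < \<delta>" "\<delta>2 < \<delta>"
  proof -
    show pos: "\<delta>2 > 0" using \<delta>(1) by (simp add: \<delta>2_def add_nonneg_pos)
    have "\<delta> = \<delta>2 * (4 * (real N0 + 1))" by (simp add: \<delta>2_def)
    then have eq: "\<delta> = 4 * (real N0 * \<delta>2) + 4 * \<delta>2" by (simp add: algebra_simps)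
    have "0 \<le> real N0 * \<delta>2" using pos by simp
    then show "2 * real N0 * \<delta>2 < \<delta>" "\<delta>2 < \<delta>" unfolding mult.assoc using eq pos by linarith+
  qed
  obtain Cs :: "'a set" where Cs: "finite Cs" "cball 0 R \<subseteq> (\<Union>c\<in>Cs. cball c \<delta>2)" using finite_centers[OF \<delta>2(1)] by blast
  define C where "C = {..N0} \<times> (\<Union>m\<in>{..N0}. {..m} \<rightarrow>\<^sub>E {0..\<lfloor>1 / \<delta>2\<rfloor>}) \<times> (\<Union>m\<in>{..N0}. {..<m} \<rightarrow>\<^sub>E Cs)"
  \<comment> \<open>A code records the number of slots, the node times rounded to multiples of
    \<open>\<delta>2\<close>, and the centers of the increments of some coarse polygon with image
    near \<open>F g\<close>.\<close>
  define Q where "Q g \<kappa> = (case \<kappa> of (m, \<tau>, c) \<Rightarrow> \<exists>t w. nodes t m \<and> (\<Sum>i<m. norm (w i)) \<le> R \<and> m \<le> N0 \<and>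
    dist (F g) (F (pw_linear t w m)) < e / 4 \<and> (\<forall>j\<le>m. \<lfloor>t j / \<delta>2\<rfloor> = \<tau> j) \<and> (\<forall>j<m. w j \<in> cball (c j) \<delta>2))" for g \<kappa>
  show "\<exists>k. finite k \<and> F ` polygons R \<subseteq> (\<Union>x\<in>k. ball x e)"
  proof (rule totally_bounded_from_codes[where C = C and R = Q])
    show "finite C" unfolding C_def using Cs(1) by (auto intro!: finite_cartesian_product finite_PiE)
  next
    fix g assume "g \<in> polygons R"
    then obtain t w N where g: "g = pw_linear t w N" "nodes t N" "(\<Sum>i<N. norm (w i)) \<le> R" by (auto simp: polygons_def)
    have d4: "\<delta> / 4 > 0" using \<delta>(1) by simp
    obtain k m where k: "m \<le> N0" "grouping k m N" "k \<in> {..m} \<rightarrow>\<^sub>E {..N}"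
      "\<And>s. dist (pw_linear t w N s) (pw_linear (t \<circ> k) (groupsum w k) m s) \<le> 2 * (\<delta> / 4)"
      "(\<Sum>j<m. norm (groupsum w k j)) \<le> R" using pw_linear_coarse[OF g(2,3) d4 N0] by metis
    have tk: "nodes (t \<circ> k) m" by (rule grouping_nodes[OF g(2) k(2)])
    have "rho1' (pw_linear t w N) (pw_linear (t \<circ> k) (groupsum w k) m) \<le> 2 * (\<delta> / 4)"
      by (rule rho1'_pw_linear_le_sup[OF g(2) tk k(4)])
    then have cl: "dist (F g) (F (pw_linear (t \<circ> k) (groupsum w k) m)) < e / 4"
      unfolding g(1) using \<delta>(1) by (intro close g(2,3) tk k(5)) auto
    have "\<exists>c\<in>Cs. groupsum w k j \<in> cball c \<delta>2" if "j < m" for j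
    proof -
      have "norm (groupsum w k j) \<le> R"
        using member_le_sum[of j "{..<m}" "\<lambda>j. norm (groupsum w k j)"] k(5) that by force
      then have "groupsum w k j \<in> cball 0 R" by simp
      then show ?thesis using Cs(2) by blast
    qed
    then obtain c where c: "\<And>j. j < m \<Longrightarrow> c j \<in> Cs" "\<And>j. j < m \<Longrightarrow> groupsum w k j \<in> cball (c j) \<delta>2" by metis
    let ?\<kappa> = "(m, restrict (\<lambda>j. \<lfloor>(t \<circ> k) j / \<delta>2\<rfloor>) {..m}, restrict c {..<m})"
    have "\<lfloor>(t \<circ> k) j / \<delta>2\<rfloor> \<in> {0..\<lfloor>1 / \<delta>2\<rfloor>}" if "j \<le> m" for j
      using nodes_range[OF tk that] \<delta>2(1) by (auto intro!: floor_mono divide_right_mono)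
    then have "restrict (\<lambda>j. \<lfloor>(t \<circ> k) j / \<delta>2\<rfloor>) {..m} \<in> {..m} \<rightarrow>\<^sub>E {0..\<lfloor>1 / \<delta>2\<rfloor>}"
      by (intro restrict_PiE_iff[THEN iffD2]) auto
    moreover have "restrict c {..<m} \<in> {..<m} \<rightarrow>\<^sub>E Cs" using c(1) by (intro restrict_PiE_iff[THEN iffD2]) auto
    ultimately have "?\<kappa> \<in> C" using k(1) unfolding C_def by blast
    moreover have "Q g ?\<kappa>" unfolding Q_def using tk k(1,5) cl c(2)
      by (auto intro!: exI[of _ "t \<circ> k"] exI[of _ "groupsum w k"])
    ultimately show "\<exists>\<kappa>\<in>C. Q g \<kappa>" by blast
  next
    fix g g' \<kappa> assume Q: "Q g \<kappa>" "Q g' \<kappa>"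
    obtain m \<tau> c where \<kappa>: "\<kappa> = (m, \<tau>, c)" by (cases \<kappa>)
    from Q obtain t w t' w' where m: "m \<le> N0" and t: "nodes t m" "nodes t' m"
      and w: "(\<Sum>i<m. norm (w i)) \<le> R" "(\<Sum>i<m. norm (w' i)) \<le> R"
      and gd: "dist (F g) (F (pw_linear t w m)) < e / 4" "dist (F g') (F (pw_linear t' w' m)) < e / 4"
      and tj: "\<And>j. j \<le> m \<Longrightarrow> \<lfloor>t j / \<delta>2\<rfloor> = \<tau> j" "\<And>j. j \<le> m \<Longrightarrow> \<lfloor>t' j / \<delta>2\<rfloor> = \<tau> j"
      and wj: "\<And>j. j < m \<Longrightarrow> w j \<in> cball (c j) \<delta>2" "\<And>j. j < m \<Longrightarrow> w' j \<in> cball (c j) \<delta>2"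
      unfolding Q_def \<kappa> prod.case by blast
    have "\<bar>t j - t' j\<bar> \<le> \<delta>2" if "j \<le> m" for j
    proof -
      have "\<bar>t j / \<delta>2 - t' j / \<delta>2\<bar> \<le> 1" using tj[OF that] by linarith
      then have "\<bar>(t j - t' j) / \<delta>2\<bar> \<le> 1" by (simp add: diff_divide_distrib)
      then show ?thesis using \<delta>2(1) by (simp add: abs_divide)
    qed
    then have "rho1' (pw_linear t w m) (pw_linear t' w m) \<le> \<delta>2" by (rule rho1'_pw_linear_retime[OF t])
    then have d1: "dist (F (pw_linear t w m)) (F (pw_linear t' w m)) < e / 4"
      using \<delta>2 by (intro close t w) auto
    have "norm (w j - w' j) \<le> 2 * \<delta>2" if "j < m" for j
      using wj[OF that] dist_triangle3[of "w j" "w' j" "c j"] by (simp add: dist_norm)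
    then have "(\<Sum>j<m. norm (w j - w' j)) \<le> (\<Sum>j<m. 2 * \<delta>2)" by (intro sum_mono) auto
    also have "\<dots> \<le> 2 * real N0 * \<delta>2" using m \<delta>2(1) by (simp add: mult_right_mono)
    finally have "rho1' (pw_linear t' w m) (pw_linear t' w' m) \<le> 2 * real N0 * \<delta>2"
      by (intro rho1'_pw_linear_le_sup t order_trans[OF pw_linear_dist])
    then have d2: "dist (F (pw_linear t' w m)) (F (pw_linear t' w' m)) < e / 4"
      using \<delta>2 by (intro close t w) auto
    show "dist (F g) (F g') < e"
      using gd d1 d2 dist_triangle[of "F g" "F g'" "F (pw_linear t w m)"]
        dist_triangle[of "F (pw_linear t w m)" "F g'" "F (pw_linear t' w m)"]
        dist_triangle[of "F (pw_linear t' w m)" "F g'" "F (pw_linear t' w' m)"]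
      by (simp add: dist_commute[of _ "F g'"])
  qed
qed

lemma BV01_pl_approx:
  assumes h: "h \<in> BV01" and e: "e > 0"
  obtains T where "T \<in> partitions01" "dist (F (pl h T)) (F h) < e"
proof -
  obtain \<delta> where \<delta>: "\<delta> > 0" "\<And>g. g \<in> BV01 \<Longrightarrow> rho1' g h < \<delta> \<Longrightarrow> dist (F g) (F h) < e" using F_cont[OF h e] by blast
  have "h \<in> D01" using h by (simp add: BV01_def)
  then obtain T where "T \<in> partitions01" "rho1' (pl h T) h < \<delta>" using D01_pl_approx[OF _ \<delta>(1)] by blast
  then show ?thesis using that \<delta>(2) pl_BV01 by blast
qed

text \<open>The polygons \<open>pl h T\<close> approximating \<open>h\<close> have variation at most
  \<open>var01 h\<close>, by the definition of \<open>var01\<close> as a supremum.\<close>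

lemma F_in_closure_polygons:
  assumes h: "h \<in> BV01" and R: "0 \<le> R" "var01 h \<le> ennreal R"
  shows "F h \<in> closure (F ` polygons R)"
  unfolding closure_approachable
proof (intro allI impI)
  fix e :: real assume "e > 0"
  then obtain T where T: "T \<in> partitions01" "dist (F (pl h T)) (F h) < e" using BV01_pl_approx[OF h] by blast
  obtain t N where t: "nodes t N" "t ` {..N} = insert 0 (insert 1 T)" using partition_nodes[OF T(1)] by blast
  let ?w = "\<lambda>j. start0 h (t (Suc j)) - start0 h (t j)"
  have "ennreal (\<Sum>j<N. norm (?w j)) \<le> var01 h"
    unfolding var01_def by (rule SUP_upper2[OF T(1)]) (simp add: pl_eq_pw_linear[OF t] var_pw_linear[OF t(1)])
  from order_trans[OF this R(2)] have "(\<Sum>j<N. norm (?w j)) \<le> R" unfolding ennreal_le_iff[OF R(1)] .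
  then have "pl h T \<in> polygons R" unfolding polygons_def pl_eq_pw_linear[OF t] using t(1) by blast
  then show "\<exists>y\<in>F ` polygons R. dist y (F h) < e" using T(2) by blast
qed

lemma tight_rate_function_Jt: "tight_rate_function (lsc_reg Jt)"
  unfolding tight_rate_function_def
proof (intro conjI allI)
  show "0 \<le> lsc_reg Jt y" for y by (rule lsc_reg_nonneg[OF Jt_nonneg])
  show "closed {y. lsc_reg Jt y \<le> c}" for c by (rule closed_lsc_reg_sublevel)
  show "\<exists>y. lsc_reg Jt y \<noteq> \<infinity>"
  proof -
    \<comment> \<open>The straight path whose velocity has finite rate has finite cost.\<close>
    obtain w c where "(w, c) \<in> lower_epi" using lower_epi_nonempty by auto
    then have rc: "rate w \<le> ereal c" by (rule rate_le_lower_epi)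
    let ?t = "\<lambda>j. real j / real 1"
    have t: "nodes ?t 1" by (rule uniform_nodes) simp
    have "e2ennreal (rate w) \<le> ennreal c" using e2ennreal_mono[OF rc] by simp
    then have "pw_cost \<mu> (\<lambda>x. x) ?t (\<lambda>_. w) 1 \<le> ennreal c" by (simp add: pw_cost_def rate_def)
    from order_trans[OF I_D_pw_linear_le[OF t] this] have "cost (pw_linear ?t (\<lambda>_. w) 1) < \<infinity>"
      by (rule le_less_trans) simp
    then have "enn2ereal (cost (pw_linear ?t (\<lambda>_. w) 1)) < \<infinity>"
      by (metis enn2ereal_top infinity_ennreal_def less_ennreal.rep_eq)
    moreover have "lsc_reg Jt (F (pw_linear ?t (\<lambda>_. w) 1)) \<le> enn2ereal (cost (pw_linear ?t (\<lambda>_. w) 1))"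
      by (rule order_trans[OF lsc_reg_le[of Jt] Jt_le[OF pw_linear_BV01[OF t]]])
    ultimately have "lsc_reg Jt (F (pw_linear ?t (\<lambda>_. w) 1)) < \<infinity>" by (simp only: le_less_trans)
    then show ?thesis by (intro exI[of _ "F (pw_linear ?t (\<lambda>_. w) 1)"]) simp
  qed
  show "compact {y. lsc_reg Jt y \<le> ereal r}" for r
  proof -
    obtain l c where lc: "l > 0" "c \<ge> 0"
      "\<And>h r. h \<in> BV01 \<Longrightarrow> 0 \<le> r \<Longrightarrow> cost h \<le> ennreal r \<Longrightarrow> var01 h \<le> ennreal ((r + c) / l)" using var01_le_cost by blast
    \<comment> \<open>Strictly above \<open>r\<close>, as \<open>lsc_reg_nbhd\<close> requires, and
      nonnegative, so that it can bound a cost in \<open>ennreal\<close>.\<close>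
    define r' where "r' = \<bar>r\<bar> + 1"
    define R where "R = (r' + c) / l"
    have R: "R > 0" using lc by (simp add: R_def r'_def)
    have "{y. lsc_reg Jt y \<le> ereal r} \<subseteq> closure (F ` polygons R)"
    proof
      fix y assume "y \<in> {y. lsc_reg Jt y \<le> ereal r}"
      then have y: "lsc_reg Jt y \<le> ereal r" by simp
      \<comment> \<open>Near \<open>y\<close> there are images of paths of cost below
        \<open>r'\<close>, and these are in turn limits of images of polygons.\<close>
      have "y \<in> closure (closure (F ` polygons R))"
        unfolding closure_approachable[of y]
      proof (intro allI impI)
        fix e :: real assume "e > 0"
        then obtain z where z: "z \<in> ball y e" "Jt z < ereal r'"
        proof -
          have "y \<in> ball y e" "ereal r < ereal r'" using \<open>e > 0\<close> by (auto simp: r'_def)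
          then show ?thesis using lsc_reg_nbhd[OF open_ball _ y, of y e "ereal r'"] that by blast
        qed
        obtain h where h: "h \<in> BV01" "F h = z" "enn2ereal (cost h) < ereal r'" using Jt_lessE[OF z(2)] by blast
        have "0 \<le> r'" by (simp add: r'_def)
        then have "enn2ereal (cost h) \<le> enn2ereal (ennreal r')" using less_imp_le[OF h(3)] by (simp only: enn2ereal_ennreal)
        then have "cost h \<le> ennreal r'" by (simp add: less_eq_ennreal.rep_eq)
        then have "var01 h \<le> ennreal R" unfolding R_def by (intro lc(3) h(1)) (simp_all add: r'_def)
        then have "z \<in> closure (F ` polygons R)" using F_in_closure_polygons[OF h(1)] R h(2) by auto
        then show "\<exists>z\<in>closure (F ` polygons R). dist z y < e" using z(1) by (auto simp: dist_commute)
      qed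
      then show "y \<in> closure (F ` polygons R)" by simp
    qed
    then show ?thesis
      using compact_Int_closed[OF compact_polygons[OF R] closed_lsc_reg_sublevel[of Jt "ereal r"]]
      by (simp add: Int_absorb1)
  qed
qed

end

section \<open>The walk on the canonical space, and the probability of a cell\<close>

definition poly_walk :: "nat \<Rightarrow> (nat \<Rightarrow> 'a::real_vector) \<Rightarrow> real \<Rightarrow> 'a" where
  "poly_walk n x = poly_path (\<lambda>i x. x i) n x"

definition step_walk :: "nat \<Rightarrow> (nat \<Rightarrow> 'a::real_vector) \<Rightarrow> real \<Rightarrow> 'a" where
  "step_walk n x = step_path (\<lambda>i x. x i) n x"

lemma poly_pw_linear: "0 < n \<Longrightarrow> poly_walk n x = pw_linear (\<lambda>j. real j / real n) (\<lambda>j. x j /\<^sub>R real n) n"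
  unfolding poly_walk_def by (rule poly_path_eq_pw_linear)

lemma sum_norm_scaled: "(\<Sum>i<n. norm (x i /\<^sub>R real n)) = (\<Sum>i<n. norm (x i)) / real n"
  for x :: "nat \<Rightarrow> 'a::real_normed_vector"
  by (simp add: sum_distrib_left[symmetric] divide_inverse_commute)

lemma var01_poly_le: "0 < n \<Longrightarrow> var01 (poly_walk n x) \<le> ennreal ((\<Sum>i<n. norm (x i)) / real n)"
  for x :: "nat \<Rightarrow> 'a::euclidean_space"
  unfolding poly_pw_linear sum_norm_scaled[symmetric] by (rule var01_pw_linear_le[OF uniform_nodes])

lemma poly_BV01: "0 < n \<Longrightarrow> poly_walk n x \<in> BV01" for x :: "nat \<Rightarrow> 'a::euclidean_space"
  unfolding poly_pw_linear by (rule pw_linear_BV01[OF uniform_nodes])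

lemma compact_closed_separated:
  fixes A D :: "'y::metric_space set"
  assumes "compact A" "closed D" "A \<inter> D = {}"
  shows "\<exists>d>0. \<forall>y\<in>A. \<forall>z\<in>D. d \<le> dist y z"
proof (cases "A = {} \<or> D = {}")
  case False
  have "continuous_on A (\<lambda>y. infdist y D)" by (intro continuous_intros)
  then obtain y where y: "y \<in> A" "\<And>z. z \<in> A \<Longrightarrow> infdist y D \<le> infdist z D"
    using continuous_attains_inf[OF assms(1)] False by blast
  have "0 < infdist y D" using y(1) assms False by (intro infdist_pos_not_in_closed) auto
  moreover have "infdist y D \<le> dist a z" if "a \<in> A" "z \<in> D" for a z
    using y(2)[OF that(1)] infdist_le[OF that(2), of a] by linarith
  ultimately show ?thesis by blast
qed (auto intro: exI[of _ 1])

lemma groupsum_shift: "groupsum x k j = psum (k (Suc j) - k j) (shift (k j) x)"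
proof -
  have "(\<Sum>i\<in>{k j..<k (Suc j)}. x i) = (\<Sum>i<k (Suc j) - k j. x (k j + i))"
    by (rule sum.reindex_bij_witness[of _ "\<lambda>i. k j + i" "\<lambda>i. i - k j"]) auto
  then show ?thesis by (simp add: groupsum_def psum_def shift_def)
qed

context path_functional
begin

text \<open>The groups are independent. For each of them \<open>convex_chernoff\<close> finds an
  increment in the ball whose rate is paid for by the probability, even if the group is a single
  step. These increments form a polygon in the cell of cost at most minus the logarithm of the cell
  probability over \<open>n\<close>, and by \<open>good\<close> that cost exceeds
  \<open>a\<close>.\<close>

lemma cell_bound:
  assumes n: "0 < n" and k: "grouping k m n"
    and good: "\<And>w. (\<And>j. j < m \<Longrightarrow> w j \<in> cball (c j) \<delta>) \<Longrightarrow>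
      ereal a < Jt (F (pw_linear ((\<lambda>j. real j / real n) \<circ> k) w m))"
  shows "{x. \<forall>j<m. groupsum (\<lambda>i. x i /\<^sub>R real n) k j \<in> cball (c j) \<delta>} \<in> sets S"
    and "Pr {x. \<forall>j<m. groupsum (\<lambda>i. x i /\<^sub>R real n) k j \<in> cball (c j) \<delta>} \<le> exp (- real n * a)"
proof -
  define l where "l j = k (Suc j) - k j" for j
  have l: "0 < l j" if "j < m" for j using k that by (simp add: grouping_def l_def)
  define A where "A j = {x. psum (l j) x /\<^sub>R real n \<in> cball (c j) \<delta>}" for j
  have A: "A j \<in> sets S" for j unfolding A_def by (rule psum_mean_event) simp
  have eq: "{x. \<forall>j<m. groupsum (\<lambda>i. x i /\<^sub>R real n) k j \<in> cball (c j) \<delta>} = {x. \<forall>j<m. shift (k j) x \<in> A j}"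
  proof -
    have "groupsum (\<lambda>i. x i /\<^sub>R real n) k j = psum (l j) (shift (k j) x) /\<^sub>R real n" for x :: "nat \<Rightarrow> 'a" and j
      unfolding groupsum_shift by (simp add: l_def psum_def shift_def scaleR_sum_right)
    then show ?thesis by (simp add: A_def)
  qed
  have groups: "{x. \<forall>j<m. shift (k j) x \<in> A j} \<in> sets S \<and> Pr {x. \<forall>j<m. shift (k j) x \<in> A j} = (\<Prod>j<m. Pr (A j))"
  proof (rule Pr_groups)
    show "y \<in> A j" if "\<And>i. i < k (Suc j) - k j \<Longrightarrow> x i = y i" "x \<in> A j" for j x y
      using that psum_cong[of "l j" x y] by (simp add: A_def l_def)
  qed (use k A in \<open>auto simp: grouping_def less_imp_le\<close>)
  then show "{x. \<forall>j<m. groupsum (\<lambda>i. x i /\<^sub>R real n) k j \<in> cball (c j) \<delta>} \<in> sets S" unfolding eq by blast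
  have "(\<Prod>j<m. Pr (A j)) \<le> exp (- real n * a)"
  \<comment> \<open>If some group has probability 0, so has the cell; otherwise all logarithms are
    meaningful.\<close>
  proof (cases "\<forall>j<m. 0 < Pr (A j)")
    case False
    then obtain j where "j < m" "Pr (A j) = 0" by (auto simp: not_less order.antisym)
    then have "(\<Prod>j<m. Pr (A j)) = 0" by (intro prod_zero) auto
    then show ?thesis by (simp only:) simp
  next
    case True
    have "\<exists>w\<in>cball (c j) \<delta>. rate ((real n / real (l j)) *\<^sub>R w) \<le> ereal (- ln (Pr (A j)) / real (l j))"
      if j: "j < m" for j
    proof -
      \<comment> \<open>Increments are measured in units of \<open>1 / n\<close>, whereas
        \<open>convex_chernoff\<close> speaks of the mean over the \<open>l j\<close> steps of the
        group.\<close>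
      let ?C = "(\<lambda>w. (real n / real (l j)) *\<^sub>R w) ` cball (c j) \<delta>"
      have mem: "psum (l j) x /\<^sub>R real (l j) \<in> ?C \<longleftrightarrow> x \<in> A j" for x
      proof -
        have "psum (l j) x /\<^sub>R real (l j) = (real n / real (l j)) *\<^sub>R (psum (l j) x /\<^sub>R real n)"
          using n by (simp add: divide_inverse)
        moreover have inj: "inj (\<lambda>w::'a. (real n / real (l j)) *\<^sub>R w)" using n l[OF j] by (auto intro!: injI)
        ultimately show ?thesis by (simp only: A_def inj_image_mem_iff[OF inj] mem_Collect_eq)
      qed
      then have eqA: "{x. psum (l j) x /\<^sub>R real (l j) \<in> ?C} = A j" by auto
      have "compact ?C" "convex ?C" by (intro compact_scaling convex_scaling compact_cball convex_cball)+
      then show ?thesis using convex_chernoff[of ?C "l j"] l[OF j] True j unfolding eqA by auto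
    qed
    then obtain w where w: "\<And>j. j < m \<Longrightarrow> w j \<in> cball (c j) \<delta>"
      "\<And>j. j < m \<Longrightarrow> rate ((real n / real (l j)) *\<^sub>R w j) \<le> ereal (- ln (Pr (A j)) / real (l j))" by metis
    let ?t = "(\<lambda>j. real j / real n) \<circ> k"
    have t: "nodes ?t m" by (rule grouping_nodes[OF uniform_nodes[OF n] k])
    have d: "?t (Suc j) - ?t j = real (l j) / real n" if "j < m" for j
      using l[OF that] by (simp add: l_def of_nat_diff diff_divide_distrib)
    have lnp: "ln (Pr (A j)) \<le> 0" if "j < m" for j
      using True that by simp
    have summand: "e2ennreal (rate_I \<mu> (\<lambda>x. x) (w j /\<^sub>R (?t (Suc j) - ?t j))) * ennreal (?t (Suc j) - ?t j)
        \<le> ennreal (- ln (Pr (A j)) / real n)" if j: "j < m" for j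
    proof -
      have "e2ennreal (rate ((real n / real (l j)) *\<^sub>R w j)) \<le> ennreal (- ln (Pr (A j)) / real (l j))"
        using e2ennreal_mono[OF w(2)[OF j]] by simp
      then have "e2ennreal (rate ((real n / real (l j)) *\<^sub>R w j)) * ennreal (real (l j) / real n)
          \<le> ennreal (- ln (Pr (A j)) / real (l j)) * ennreal (real (l j) / real n)" by (rule mult_right_mono) simp
      also have "\<dots> = ennreal (- ln (Pr (A j)) / real n)"
        using l[OF j] n lnp[OF j] by (subst ennreal_mult[symmetric]) (auto intro: divide_nonpos_nonneg)
      also have "(real n / real (l j)) *\<^sub>R w j = w j /\<^sub>R (real (l j) / real n)" by simp
      finally show ?thesis unfolding d[OF j] rate_def .
    qed
    have nonneg: "0 \<le> - ln (Pr (A j)) / real n" if "j < m" for j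
      using n lnp[OF that] by (auto intro: divide_nonpos_nonneg)
    have "cost (pw_linear ?t w m) \<le> pw_cost \<mu> (\<lambda>x. x) ?t w m" by (rule I_D_pw_linear_le[OF t])
    also have "\<dots> \<le> (\<Sum>j<m. ennreal (- ln (Pr (A j)) / real n))"
      unfolding pw_cost_def using summand by (intro sum_mono) auto
    also have "\<dots> = ennreal (\<Sum>j<m. - ln (Pr (A j)) / real n)" using nonneg by (intro sum_ennreal) auto
    finally have "enn2ereal (cost (pw_linear ?t w m)) \<le> enn2ereal (ennreal (\<Sum>j<m. - ln (Pr (A j)) / real n))"
      by (simp add: less_eq_ennreal.rep_eq)
    also have "\<dots> = ereal (\<Sum>j<m. - ln (Pr (A j)) / real n)" using nonneg by (intro enn2ereal_ennreal sum_nonneg) auto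
    finally have "ereal a < ereal (\<Sum>j<m. - ln (Pr (A j)) / real n)"
      using good[of w] w(1) Jt_le[OF pw_linear_BV01[OF t], of w] by (meson less_le_trans)
    then have "a < (\<Sum>j<m. - ln (Pr (A j)) / real n)" by simp
    also have "\<dots> = (\<Sum>j<m. - ln (Pr (A j))) / real n" by (rule sum_divide_distrib[symmetric])
    finally have "real n * a < (\<Sum>j<m. - ln (Pr (A j)))" using n by (simp add: pos_less_divide_eq mult.commute)
    then have "(\<Sum>j<m. ln (Pr (A j))) \<le> - real n * a" by (simp add: sum_negf)
    moreover have "(\<Prod>j<m. Pr (A j)) = exp (\<Sum>j<m. ln (Pr (A j)))" using True by (simp add: exp_sum)
    ultimately show ?thesis by simp
  qed
  then show "Pr {x. \<forall>j<m. groupsum (\<lambda>i. x i /\<^sub>R real n) k j \<in> cball (c j) \<delta>} \<le> exp (- real n * a)"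
    unfolding eq using groups by simp
qed

end

text \<open>The two interpolations of the walk enter only through these four properties, so one
  proof covers both. \<open>Q_near\<close> ties either of them to the polygon.\<close>

locale walk_path = path_functional \<mu> F for \<mu> :: "'a::euclidean_space measure" and F :: "(real \<Rightarrow> 'a) \<Rightarrow> 'y::complete_space" +
  fixes Q :: "nat \<Rightarrow> (nat \<Rightarrow> 'a) \<Rightarrow> real \<Rightarrow> 'a"
  assumes Q_BV01: "0 < n \<Longrightarrow> Q n x \<in> BV01"
    and var01_Q: "0 < n \<Longrightarrow> var01 (Q n x) \<le> ennreal ((\<Sum>i<n. norm (x i)) / real n)"
    and Q_near: "0 < n \<Longrightarrow> rho1' (poly_walk n x) (Q n x) \<le> 1 / real n"
    and Q_meas: "0 < n \<Longrightarrow> (\<lambda>x. F (Q n x)) \<in> borel_measurable S"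
begin

lemma poly_close:
  assumes "R > 0" "e > 0"
  shows "\<forall>\<^sub>F n in sequentially. 0 < n \<and> (\<forall>x. (\<Sum>i<n. norm (x i)) \<le> real n * R \<longrightarrow> dist (F (poly_walk n x)) (F (Q n x)) < e)"
proof -
  obtain \<delta> where \<delta>: "\<delta> > 0" "\<And>g h. g \<in> BV01 \<Longrightarrow> h \<in> BV01 \<Longrightarrow> var01 g \<le> ennreal R \<Longrightarrow> var01 h \<le> ennreal R \<Longrightarrow>
    rho1' g h < \<delta> \<Longrightarrow> dist (F g) (F h) < e" using F_unifE[OF assms] by blast
  have "\<forall>\<^sub>F n in sequentially. 1 / real n < \<delta>" using lim_1_over_n \<delta>(1) by (rule order_tendstoD)
  then show ?thesis using eventually_gt_at_top[of 0]
  proof eventually_elim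
    case (elim n)
    have "dist (F (poly_walk n x)) (F (Q n x)) < e" if x: "(\<Sum>i<n. norm (x i)) \<le> real n * R" for x
    proof (rule \<delta>(2)[OF poly_BV01[OF elim(2)] Q_BV01[OF elim(2)]])
      have "(\<Sum>i<n. norm (x i)) / real n \<le> R" using x elim(2) by (simp add: pos_divide_le_eq mult.commute)
      then show "var01 (poly_walk n x) \<le> ennreal R" "var01 (Q n x) \<le> ennreal R"
        using var01_poly_le[OF elim(2), of x] var01_Q[OF elim(2), of x] ennreal_leI order_trans by blast+
      show "rho1' (poly_walk n x) (Q n x) < \<delta>" using Q_near[OF elim(2), of x] elim(1) by linarith
    qed
    then show ?case using elim(2) by blast
  qed
qed

text \<open>A path of bounded variation is determined up to a small error by the increments over boundedly
  many groups of steps, rounded to a finite grid; there are polynomially many such cells.\<close>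

lemma upper_bound:
  assumes B: "closed B" and a: "\<And>y. y \<in> B \<Longrightarrow> ereal a < lsc_reg Jt y"
  shows "\<exists>K N. \<forall>\<^sub>F n in sequentially. Pr {x. F (Q n x) \<in> B} \<le> K * (real n + 1) ^ N * exp (- real n * a)"
proof -
  obtain l c where lc: "l > 0" "c \<ge> 0" "(\<integral>\<^sup>+y. ennreal (exp (l * norm y)) \<partial>\<mu>) \<le> ennreal (exp c)"
    using exp_moment[OF dom] by metis
  \<comment> \<open>Beyond variation \<open>R\<close> the tail bound of
    \<open>variation_tail\<close> is at most \<open>exp (- n * a)\<close>.\<close>
  define R where "R = (\<bar>a\<bar> + c) / l + 1"
  have R: "R > 0" using lc by (simp add: R_def add_nonneg_pos)
  have "l * R = \<bar>a\<bar> + c + l" using lc(1) by (simp only: R_def distrib_left) simp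
  then have Ra: "c - l * R \<le> - a" using lc(1) by linarith
  let ?K = "closure (F ` polygons R)"
  have "compact (B \<inter> ?K)" using compact_Int_closed[OF compact_polygons[OF R] B] by (simp add: Int_commute)
  moreover have "closed {y. lsc_reg Jt y \<le> ereal a}" by (rule closed_lsc_reg_sublevel)
  moreover have "(B \<inter> ?K) \<inter> {y. lsc_reg Jt y \<le> ereal a} = {}" using a by fastforce
  \<comment> \<open>While the variation is at most \<open>R\<close>, images of the walk lie in
    \<open>?K\<close>. The compact part of \<open>B\<close> has a positive distance \<open>d\<close>
    from the closed sublevel set, and \<open>d\<close> is the budget for all discretization
    errors.\<close>
  ultimately obtain d where d: "d > 0" "\<And>y z. y \<in> B \<inter> ?K \<Longrightarrow> lsc_reg Jt z \<le> ereal a \<Longrightarrow> d \<le> dist y z"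
    using compact_closed_separated[of "B \<inter> ?K" "{y. lsc_reg Jt y \<le> ereal a}"] by blast
  have d4: "d / 4 > 0" and R1: "R + 1 > 0" using d(1) R by auto
  \<comment> \<open>\<open>R + 1\<close> because replacing increments by others in the same cell may
    raise the variation, by at most 1 in view of \<open>\<delta>2\<close>.\<close>
  obtain \<delta> where \<delta>: "\<delta> > 0" "\<And>g h. g \<in> BV01 \<Longrightarrow> h \<in> BV01 \<Longrightarrow> var01 g \<le> ennreal (R + 1) \<Longrightarrow> var01 h \<le> ennreal (R + 1) \<Longrightarrow>
    rho1' g h < \<delta> \<Longrightarrow> dist (F g) (F h) < d / 4" using F_unifE[OF R1 d4] by blast
  define N0 where "N0 = nat \<lceil>2 * R / (\<delta> / 4) + 1\<rceil>"
  have N0: "2 * R / (\<delta> / 4) + 1 \<le> real N0" unfolding N0_def by linarith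
  define \<delta>2 where "\<delta>2 = min \<delta> 1 / (4 * (real N0 + 1))"
  have \<delta>2: "\<delta>2 > 0" "2 * real N0 * \<delta>2 < \<delta>" "2 * real N0 * \<delta>2 \<le> 1"
  proof -
    show pos: "\<delta>2 > 0" using \<delta>(1) by (simp add: \<delta>2_def add_nonneg_pos)
    have "min \<delta> 1 = \<delta>2 * (4 * (real N0 + 1))" by (simp add: \<delta>2_def)
    then have eq: "min \<delta> 1 = 4 * (real N0 * \<delta>2) + 4 * \<delta>2" by (simp add: algebra_simps)
    have "0 \<le> real N0 * \<delta>2" using pos by simp
    then show "2 * real N0 * \<delta>2 < \<delta>" "2 * real N0 * \<delta>2 \<le> 1" unfolding mult.assoc using eq pos by linarith+
  qed
  obtain Cs :: "'a set" where Cs: "finite Cs" "cball 0 R \<subseteq> (\<Union>c\<in>Cs. cball c \<delta>2)" using finite_centers[OF \<delta>2(1)] by blast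
  define cell where "cell n = (\<lambda>(m, k, c). {x :: nat \<Rightarrow> 'a. \<forall>j<m. groupsum (\<lambda>i. x i /\<^sub>R real n) k j \<in> cball (c j) \<delta>2})" for n
  \<comment> \<open>Exactly the cells to which \<open>cell_bound\<close> applies;
    \<open>cover\<close> shows that they suffice, apart from paths of large variation.\<close>
  define good where "good n = (\<lambda>(m, k, c). grouping k m n \<and> (\<forall>w. (\<forall>j<m. w j \<in> cball (c j) \<delta>2) \<longrightarrow>
      ereal a < Jt (F (pw_linear ((\<lambda>j. real j / real n) \<circ> k) w m))))" for n
  define codes where "codes n = {..N0} \<times> (\<Union>m\<in>{..N0}. {..m} \<rightarrow>\<^sub>E {..n}) \<times> (\<Union>m\<in>{..N0}. {..<m} \<rightarrow>\<^sub>E Cs)" for n :: nat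
  have fin: "finite (codes n)" for n unfolding codes_def using Cs(1) by (auto intro!: finite_cartesian_product finite_PiE)
  \<comment> \<open>The summand 1 is for the event of large variation; the rest is the constant in
    the count of codes.\<close>
  define K where "K = 1 + real (N0 + 1) * real (N0 + 1) * (real (N0 + 1) * real (card Cs + 1) ^ N0)"
  have card: "real (card (codes n)) \<le> (K - 1) * (real n + 1) ^ (N0 + 1)" for n
  proof -
    have 1: "card (\<Union>m\<in>{..N0}. {..m} \<rightarrow>\<^sub>E {..n}) \<le> (N0 + 1) * (n + 1) ^ (N0 + 1)"
    proof -
      have "card (\<Union>m\<in>{..N0}. {..m} \<rightarrow>\<^sub>E {..n}) \<le> (\<Sum>m\<in>{..N0}. card ({..m} \<rightarrow>\<^sub>E {..n}))" by (rule card_UN_le) simp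
      also have "\<dots> \<le> (\<Sum>m\<in>{..N0}. (n + 1) ^ (N0 + 1))"
        by (intro sum_mono) (auto simp: card_PiE simp del: power_Suc intro!: power_increasing)
      finally show ?thesis by simp
    qed
    have 2: "card (\<Union>m\<in>{..N0}. {..<m} \<rightarrow>\<^sub>E Cs) \<le> (N0 + 1) * (card Cs + 1) ^ N0"
    proof -
      have "card (\<Union>m\<in>{..N0}. {..<m} \<rightarrow>\<^sub>E Cs) \<le> (\<Sum>m\<in>{..N0}. card ({..<m} \<rightarrow>\<^sub>E Cs))" by (rule card_UN_le) simp
      also have "\<dots> \<le> (\<Sum>m\<in>{..N0}. (card Cs + 1) ^ N0)"
        by (intro sum_mono) (auto simp: card_PiE intro!: order_trans[OF power_mono power_increasing])
      finally show ?thesis by simp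
    qed
    have "card (codes n) \<le> (N0 + 1) * (((N0 + 1) * (n + 1) ^ (N0 + 1)) * ((N0 + 1) * (card Cs + 1) ^ N0))"
      unfolding codes_def card_cartesian_product using 1 2 by (intro mult_mono) auto
    then have "real (card (codes n)) \<le> real ((N0 + 1) * (((N0 + 1) * (n + 1) ^ (N0 + 1)) * ((N0 + 1) * (card Cs + 1) ^ N0)))"
      by (simp only: of_nat_le_iff)
    also have "\<dots> = (K - 1) * (real n + 1) ^ (N0 + 1)" by (simp add: K_def algebra_simps)
    finally show ?thesis .
  qed
  have "\<forall>\<^sub>F n in sequentially. Pr {x. F (Q n x) \<in> B} \<le> K * (real n + 1) ^ (N0 + 1) * exp (- real n * a)"
    using poly_close[OF R d4]
  proof eventually_elim
    case (elim n)
    then have n: "0 < n" by blast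
    let ?u = "\<lambda>j. real j / real n"
    let ?T = "{x. real n * R \<le> (\<Sum>i<n. norm (x i))}"
    let ?G = "{p\<in>codes n. good n p}"
    have cover: "{x. F (Q n x) \<in> B} \<subseteq> ?T \<union> (\<Union>p\<in>?G. cell n p)"
    proof (rule subsetI, rule UnCI)
      fix x assume "x \<in> {x. F (Q n x) \<in> B}" and "x \<notin> (\<Union>p\<in>?G. cell n p)"
      then have xB: "F (Q n x) \<in> B" and none: "\<And>p. p \<in> codes n \<Longrightarrow> good n p \<Longrightarrow> x \<notin> cell n p" by auto
      show "x \<in> ?T"
      proof (rule ccontr)
        assume "x \<notin> ?T"
        then have TV: "(\<Sum>i<n. norm (x i)) \<le> real n * R" by simp
        then have TV': "(\<Sum>i<n. norm (x i)) / real n \<le> R" using n by (simp add: pos_divide_le_eq mult.commute)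
        have dQ: "dist (F (poly_walk n x)) (F (Q n x)) < d / 4" using elim TV by blast
        have QK: "F (Q n x) \<in> B \<inter> ?K"
          using xB F_in_closure_polygons[OF Q_BV01[OF n], of R] R order_trans[OF var01_Q[OF n] ennreal_leI[OF TV']] by auto
        let ?w = "\<lambda>j. x j /\<^sub>R real n"
        have wR: "(\<Sum>i<n. norm (?w i)) \<le> R" using TV' unfolding sum_norm_scaled .
        have d4': "\<delta> / 4 > 0" using \<delta>(1) by simp
        note un = uniform_nodes[OF n]
        obtain k m where k: "m \<le> N0" "grouping k m n" "k \<in> {..m} \<rightarrow>\<^sub>E {..n}"
          "\<And>s. dist (pw_linear ?u ?w n s) (pw_linear (?u \<circ> k) (groupsum ?w k) m s) \<le> 2 * (\<delta> / 4)"
          "(\<Sum>j<m. norm (groupsum ?w k j)) \<le> R" using pw_linear_coarse[OF un wR d4' N0] by metis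
        have tk: "nodes (?u \<circ> k) m" by (rule grouping_nodes[OF un k(2)])
        have var: "var01 (pw_linear t w N) \<le> ennreal (R + 1)" if "nodes t N" "(\<Sum>i<N. norm (w i)) \<le> R + 1" for t w N
          using that by (intro order_trans[OF var01_pw_linear_le] ennreal_leI)
        have "rho1' (pw_linear ?u ?w n) (pw_linear (?u \<circ> k) (groupsum ?w k) m) \<le> 2 * (\<delta> / 4)"
          by (rule rho1'_pw_linear_le_sup[OF un tk k(4)])
        then have d1: "dist (F (poly_walk n x)) (F (pw_linear (?u \<circ> k) (groupsum ?w k) m)) < d / 4"
          unfolding poly_pw_linear[OF n] using \<delta>(1) wR k(5)
          by (intro \<delta>(2) pw_linear_BV01 un tk var) auto
        have "\<exists>c\<in>Cs. groupsum ?w k j \<in> cball c \<delta>2" if "j < m" for j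
        proof -
          have "norm (groupsum ?w k j) \<le> R"
            using member_le_sum[of j "{..<m}" "\<lambda>j. norm (groupsum ?w k j)"] k(5) that by force
          then have "groupsum ?w k j \<in> cball 0 R" by simp
          then show ?thesis using Cs(2) by blast
        qed
        then obtain c where c: "\<And>j. j < m \<Longrightarrow> c j \<in> Cs" "\<And>j. j < m \<Longrightarrow> groupsum ?w k j \<in> cball (c j) \<delta>2" by metis
        let ?p = "(m, k, restrict c {..<m})"
        have "restrict c {..<m} \<in> {..<m} \<rightarrow>\<^sub>E Cs" using c(1) by (intro restrict_PiE_iff[THEN iffD2]) auto
        then have "?p \<in> codes n" using k(1,3) unfolding codes_def by blast
        moreover have "x \<in> cell n ?p" using c(2) by (auto simp: cell_def)
        moreover have "good n ?p"
          unfolding good_def prod.case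
        proof (intro conjI allI impI k(2))
          fix w assume w: "\<forall>j<m. w j \<in> cball (restrict c {..<m} j) \<delta>2"
          have "norm (groupsum ?w k j - w j) \<le> 2 * \<delta>2" if "j < m" for j
          proof -
            have "dist (c j) (w j) \<le> \<delta>2" "dist (c j) (groupsum ?w k j) \<le> \<delta>2" using w that c(2)[OF that] by auto
            then show ?thesis using dist_triangle3[of "groupsum ?w k j" "w j" "c j"] unfolding dist_norm by linarith
          qed
          then have "(\<Sum>j<m. norm (groupsum ?w k j - w j)) \<le> (\<Sum>j<m. 2 * \<delta>2)" by (intro sum_mono) auto
          also have "\<dots> \<le> 2 * real N0 * \<delta>2" using k(1) \<delta>2(1) by (simp add: mult_right_mono)
          finally have sm: "(\<Sum>j<m. norm (groupsum ?w k j - w j)) \<le> 2 * real N0 * \<delta>2" .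
          have "(\<Sum>j<m. norm (w j)) \<le> (\<Sum>j<m. norm (groupsum ?w k j) + norm (groupsum ?w k j - w j))"
          proof (rule sum_mono)
            fix j
            show "norm (w j) \<le> norm (groupsum ?w k j) + norm (groupsum ?w k j - w j)"
              using norm_triangle_ineq4[of "groupsum ?w k j" "groupsum ?w k j - w j"] by simp
          qed
          also have "\<dots> \<le> R + 1" using sm k(5) \<delta>2(3) by (simp add: sum.distrib)
          finally have wR1: "(\<Sum>j<m. norm (w j)) \<le> R + 1" .
          have "rho1' (pw_linear (?u \<circ> k) (groupsum ?w k) m) (pw_linear (?u \<circ> k) w m) \<le> 2 * real N0 * \<delta>2"
            by (intro rho1'_pw_linear_le_sup tk order_trans[OF pw_linear_dist sm])
          then have "dist (F (pw_linear (?u \<circ> k) (groupsum ?w k) m)) (F (pw_linear (?u \<circ> k) w m)) < d / 4"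
            using \<delta>2(2) wR1 k(5) by (intro \<delta>(2) pw_linear_BV01 tk var) auto
          \<comment> \<open>Interpolation, coarsening and rounding each cost less than
            \<open>d / 4\<close>, so the polygon's image cannot reach the sublevel set at distance
            \<open>d\<close>.\<close>
          then have "dist (F (Q n x)) (F (pw_linear (?u \<circ> k) w m)) < d"
            using dQ d1 d(1) dist_triangle[of "F (Q n x)" "F (pw_linear (?u \<circ> k) w m)" "F (poly_walk n x)"]
              dist_triangle[of "F (poly_walk n x)" "F (pw_linear (?u \<circ> k) w m)" "F (pw_linear (?u \<circ> k) (groupsum ?w k) m)"]
            by (simp add: dist_commute[of "F (Q n x)" "F (poly_walk n x)"])
          then have "ereal a < lsc_reg Jt (F (pw_linear (?u \<circ> k) w m))"
            using d(2)[OF QK, of "F (pw_linear (?u \<circ> k) w m)"] by (meson not_le)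
          then show "ereal a < Jt (F (pw_linear (?u \<circ> k) w m))" using lsc_reg_le by (rule less_le_trans)
        qed
        ultimately show False using none by blast
      qed
    qed
    have cells: "cell n p \<in> sets S \<and> Pr (cell n p) \<le> exp (- real n * a)" if "good n p" for p
    proof -
      obtain m k c where p: "p = (m, k, c)" by (cases p) auto
      show ?thesis using that cell_bound[OF n, of k m c \<delta>2 a] unfolding p good_def cell_def prod.case by blast
    qed
    have U: "(\<Union>p\<in>?G. cell n p) \<in> sets S" using fin cells by (intro sets.finite_UN) auto
    have "Pr {x. F (Q n x) \<in> B} \<le> Pr (?T \<union> (\<Union>p\<in>?G. cell n p))"
      using cover U variation_event by (intro P.finite_measure_mono sets.Un)
    also have "\<dots> \<le> Pr ?T + Pr (\<Union>p\<in>?G. cell n p)"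
      using U variation_event by (intro measure_Un_le)
    finally have split: "Pr {x. F (Q n x) \<in> B} \<le> Pr ?T + Pr (\<Union>p\<in>?G. cell n p)" .
    have "Pr (\<Union>p\<in>?G. cell n p) \<le> (\<Sum>p\<in>?G. Pr (cell n p))"
      using fin cells by (intro P.finite_measure_subadditive_finite) auto
    also have "\<dots> \<le> (\<Sum>p\<in>?G. exp (- real n * a))" using cells by (intro sum_mono) auto
    also have "\<dots> = real (card ?G) * exp (- real n * a)" by simp
    also have "\<dots> \<le> real (card (codes n)) * exp (- real n * a)"
      using fin by (intro mult_right_mono) (auto intro!: card_mono)
    also have "\<dots> \<le> ((K - 1) * (real n + 1) ^ (N0 + 1)) * exp (- real n * a)"
      using card by (intro mult_right_mono) auto
    finally have cellsum: "Pr (\<Union>p\<in>?G. cell n p) \<le> ((K - 1) * (real n + 1) ^ (N0 + 1)) * exp (- real n * a)" .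
    have "Pr ?T \<le> exp (real n * (c - l * R))" by (rule variation_tail[OF lc(1,3)])
    also have "\<dots> \<le> 1 * exp (- real n * a)"
      using mult_left_mono[OF Ra, of "real n"] by simp
    also have "\<dots> \<le> (real n + 1) ^ (N0 + 1) * exp (- real n * a)"
      using one_le_power[of "real n + 1" "N0 + 1"] by (intro mult_right_mono) auto
    finally have "Pr ?T \<le> (real n + 1) ^ (N0 + 1) * exp (- real n * a)" .
    then have "Pr {x. F (Q n x) \<in> B} \<le> (real n + 1) ^ (N0 + 1) * exp (- real n * a)
        + ((K - 1) * (real n + 1) ^ (N0 + 1)) * exp (- real n * a)" using split cellsum by linarith
    also have "\<dots> = K * (real n + 1) ^ (N0 + 1) * exp (- real n * a)" by (simp add: left_diff_distrib)
    finally show ?case .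
  qed
  then show ?thesis by blast
qed

end

section \<open>Measurability of the functionals\<close>

context iid_law
begin

text \<open>For countably many Euclidean factors the product sigma-algebra is the Borel algebra of
  the product topology.\<close>

lemma borel_product_measurable:
  fixes f :: "(nat \<Rightarrow> 'a) \<Rightarrow> 'z::topological_space"
  assumes "continuous_on UNIV f"
  shows "f \<in> borel_measurable S"
proof -
  have "sets S = sets (Pi\<^sub>M UNIV (\<lambda>_. borel :: 'a measure))" by (rule sets_PiM_cong) (auto simp: sets_law)
  also have "\<dots> = sets borel" by (rule sets_PiM_equal_borel)
  finally have "sets S = sets borel" .
  then show ?thesis using borel_measurable_continuous_onI[OF assms] measurable_cong_sets[of S borel borel borel] by blast
qed

end

context path_functional
begin

text \<open>Only finitely many increments matter, and \<open>rho1'\<close> is at most the sum of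
  their changes, so the composition with \<open>F\<close> is continuous.\<close>

lemma F_pw_linear_measurable:
  assumes t: "nodes t N" and w: "\<And>j. j < N \<Longrightarrow> continuous_on UNIV (\<lambda>x. w x j)"
  shows "(\<lambda>x. F (pw_linear t (w x) N)) \<in> borel_measurable S"
proof (rule borel_product_measurable)
  show "continuous_on UNIV (\<lambda>x. F (pw_linear t (w x) N))"
    unfolding continuous_on_def
  proof
    fix x :: "nat \<Rightarrow> 'a"
    have "((\<lambda>y. \<Sum>j<N. norm (w y j - w x j)) \<longlongrightarrow> (\<Sum>j<N. norm (w x j - w x j))) (at x)"
      using w by (intro tendsto_intros) (auto simp: continuous_on_def)
    then have lim: "((\<lambda>y. \<Sum>j<N. norm (w y j - w x j)) \<longlongrightarrow> 0) (at x)" by simp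
    show "((\<lambda>x. F (pw_linear t (w x) N)) \<longlongrightarrow> F (pw_linear t (w x) N)) (at x)"
    proof (rule tendstoI)
      fix e :: real assume "e > 0"
      then obtain \<delta> where \<delta>: "\<delta> > 0" "\<And>g. g \<in> BV01 \<Longrightarrow> rho1' g (pw_linear t (w x) N) < \<delta> \<Longrightarrow> dist (F g) (F (pw_linear t (w x) N)) < e"
        using F_cont[OF pw_linear_BV01[OF t]] by metis
      have "\<forall>\<^sub>F y in at x. (\<Sum>j<N. norm (w y j - w x j)) < \<delta>" using lim \<delta>(1) by (rule order_tendstoD)
      then show "\<forall>\<^sub>F y in at x. dist (F (pw_linear t (w y) N)) (F (pw_linear t (w x) N)) < e"
      proof eventually_elim
        case (elim y)
        have "rho1' (pw_linear t (w y) N) (pw_linear t (w x) N) \<le> (\<Sum>j<N. norm (w y j - w x j))"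
          by (intro rho1'_pw_linear_le_sup t pw_linear_dist)
        then show ?case using elim by (intro \<delta>(2) pw_linear_BV01 t) auto
      qed
    qed
  qed
qed

lemma F_poly_measurable: "0 < n \<Longrightarrow> (\<lambda>x. F (poly_walk n x)) \<in> borel_measurable S"
  unfolding poly_pw_linear by (intro F_pw_linear_measurable uniform_nodes continuous_intros) auto

text \<open>A pointwise limit of measurable maps: \<open>F\<close> of the polygons of the step path
  along deterministic partitions refining its jump times.\<close>

lemma F_step_measurable:
  assumes n: "0 < n"
  shows "(\<lambda>x. F (step_walk n x)) \<in> borel_measurable S"
proof (rule borel_measurable_LIMSEQ_metric)
  define r where "r m = windows (\<lambda>j. real j / real (n * Suc m)) (1 / (3 * real (n * Suc m)))" for m
  define T where "T m = r m ` {1..2 * (n * Suc m) + 1}" for m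
  have r: "nodes (r m) (2 * (n * Suc m) + 1)" for m
  proof -
    have gap: "real j / real M + 2 * (1 / (3 * real M)) < real (Suc j) / real M" if "0 < M" for j M
      using that by (simp add: field_simps)
    have M: "nodes (windows (\<lambda>j. real j / real M) (1 / (3 * real M))) (2 * M + 1)" if "0 < M" for M
      using that by (intro nodes_windows uniform_nodes gap) auto
    have "0 < n * Suc m" using n by simp
    from M[OF this] show ?thesis unfolding r_def .
  qed
  have T: "T m \<in> partitions01" "r m ` {..2 * (n * Suc m) + 1} = insert 0 (insert 1 (T m))" for m
    unfolding T_def by (rule nodes_partition[OF r])+
  show "(\<lambda>x. F (pl (step_walk n x) (T m))) \<in> borel_measurable S" for m
    unfolding pl_eq_pw_linear[OF r T(2)]
  proof (rule F_pw_linear_measurable[OF r])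
    have sum: "continuous_on UNIV (\<lambda>x :: nat \<Rightarrow> 'a. \<Sum>i<k. x i)" for k
      using continuous_on_sum[of "{..<k}" UNIV "\<lambda>i x. x i :: 'a"] by simp
    have "continuous_on UNIV (\<lambda>x :: nat \<Rightarrow> 'a. start0 (step_walk n x) p)" for p
    proof (cases "p \<noteq> 0 \<and> p \<in> {0..1}")
      case True
      then have eq: "(\<lambda>x :: nat \<Rightarrow> 'a. start0 (step_walk n x) p) = (\<lambda>x. (1 / real n) *\<^sub>R (\<Sum>i<nat \<lfloor>real n * p\<rfloor>. x i))"
        by (simp add: start0_def step_walk_def step_path_def Ssum_def)
      show ?thesis unfolding eq by (intro continuous_on_scaleR continuous_on_const sum)
    next
      case False
      then have eq: "(\<lambda>x :: nat \<Rightarrow> 'a. start0 (step_walk n x) p) = (\<lambda>x. 0)"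
        by (auto simp: start0_def step_walk_def step_path_def)
      show ?thesis unfolding eq by (rule continuous_on_const)
    qed
    note path = this
    show "continuous_on UNIV (\<lambda>x :: nat \<Rightarrow> 'a. start0 (step_walk n x) (r m (Suc j)) - start0 (step_walk n x) (r m j))" for j
      by (rule continuous_on_diff[OF path path])
  qed
  fix x :: "nat \<Rightarrow> 'a"
  have BV: "step_walk n x \<in> BV01" unfolding step_walk_def by (rule step_path_BV01[OF n])
  show "(\<lambda>m. F (pl (step_walk n x) (T m))) \<longlonglongrightarrow> F (step_walk n x)"
  proof (rule tendstoI)
    fix e :: real assume "e > 0"
    then obtain \<delta> where \<delta>: "\<delta> > 0" "\<And>g. g \<in> BV01 \<Longrightarrow> rho1' g (step_walk n x) < \<delta> \<Longrightarrow> dist (F g) (F (step_walk n x)) < e"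
      using F_cont[OF BV] by metis
    have "\<forall>\<^sub>F m in sequentially. 1 / real (Suc m) < \<delta>"
      using lim_1_over_n[THEN LIMSEQ_Suc] \<delta>(1) by (rule order_tendstoD)
    then show "\<forall>\<^sub>F m in sequentially. dist (F (pl (step_walk n x) (T m))) (F (step_walk n x)) < e"
    proof eventually_elim
      case (elim m)
      have "rho1' (pl (step_walk n x) (T m)) (step_walk n x) \<le> 1 / real (n * Suc m)"
        unfolding step_walk_def T_def r_def by (rule step_path_pl_approx[OF n]) simp
      also have "\<dots> \<le> 1 / real (Suc m)"
      proof (rule frac_le)
        have "Suc m \<le> n * Suc m" using mult_le_mono1[of 1 n "Suc m"] n by simp
        then show "real (Suc m) \<le> real (n * Suc m)" by (simp only: of_nat_le_iff)
      qed auto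
      finally show ?case using elim by (intro \<delta>(2) pl_BV01 T(1)) auto
    qed
  qed
qed

end

section \<open>The lower bound for open sets\<close>

context walk_path
begin

lemma psum_groups:
  fixes x :: "nat \<Rightarrow> 'a"
  assumes "k 0 = 0" "\<And>i. i < j \<Longrightarrow> k i \<le> k (Suc i)"
  shows "psum (k j) x = (\<Sum>i<j. psum (k (Suc i) - k i) (shift (k i) x))"
  using assms(2)
proof (induction j)
  case (Suc j)
  have "k (Suc j) = k j + (k (Suc j) - k j)" using Suc.prems[of j] by simp
  then have "psum (k (Suc j)) x = psum (k j) x + psum (k (Suc j) - k j) (shift (k j) x)" using psum_add by metis
  then show ?case using Suc by simp
qed (simp add: assms(1))

lemma poly_near_psum:
  assumes n: "0 < n" and s: "0 \<le> s" "s \<le> 1" and C: "\<And>i. i < n \<Longrightarrow> norm (x i) \<le> C" "0 \<le> C"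
  defines "q \<equiv> nat \<lfloor>real n * s\<rfloor>"
  shows "norm (poly_walk n x s - psum q x /\<^sub>R real n) \<le> C / real n"
proof -
  have f: "real q = of_int \<lfloor>real n * s\<rfloor>" using s by (simp add: q_def)
  have q: "real q \<le> real n * s" "real n * s < real q + 1" unfolding f by linarith+
  have "poly_walk n x s - psum q x /\<^sub>R real n = ((real n * s - real q) / real n) *\<^sub>R x q"
    using s f unfolding poly_walk_def poly_path_def by (simp add: Ssum_def psum_def q_def scaleR_add_right divide_inverse)
  then have eq: "norm (poly_walk n x s - psum q x /\<^sub>R real n) = (real n * s - real q) * norm (x q) / real n"
    using q n by simp
  show ?thesis
  proof (cases "q < n")
    case True
    have "(real n * s - real q) * norm (x q) \<le> 1 * C"
      using q C(1)[OF True] C(2) by (intro mult_mono) auto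
    then show ?thesis unfolding eq using n by (simp add: divide_right_mono)
  next
    case False
    have "real n * s \<le> real n" using s by (simp add: mult_left_le)
    then have "real n * s = real q" using q False by linarith
    then show ?thesis unfolding eq using C(2) by simp
  qed
qed

text \<open>The tube constants do not depend on the lengths of the blocks. After division by
  \<open>n\<close> they vanish, both in the exponent and in the distance to the approximating
  polygon.\<close>

lemma lower_bound:
  assumes G: "open G" and h: "h \<in> BV01" "F h \<in> G" and \<iota>: "cost h \<le> ennreal \<iota>" "0 \<le> \<iota>" and \<zeta>: "\<zeta> > 0"
  shows "\<forall>\<^sub>F n in sequentially. exp (- real n * (\<iota> + \<zeta>)) \<le> Pr {x. F (Q n x) \<in> G}"
proof -
  obtain e where e: "e > 0" "ball (F h) e \<subseteq> G" using G h(2) by (meson open_contains_ball)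
  have e3: "e / 3 > 0" using e by simp
  obtain T where T: "T \<in> partitions01" "dist (F (pl h T)) (F h) < e / 3" using BV01_pl_approx[OF h(1) e3] by blast
  obtain t N where t: "nodes t N" "t ` {..N} = insert 0 (insert 1 T)" using partition_nodes[OF T(1)] by blast
  define w where "w j = start0 h (t (Suc j)) - start0 h (t j)" for j
  define d where "d j = t (Suc j) - t j" for j
  define v where "v j = w j /\<^sub>R d j" for j
  define g where "g = pw_linear t w N"
  have g: "pl h T = g" unfolding g_def w_def by (rule pl_eq_pw_linear[OF t])
  have d: "0 < d j" if "j < N" for j using nodes_step[OF t(1) that] by (simp add: d_def)
  have dv: "d j *\<^sub>R v j = w j" if "j < N" for j using d[OF that] by (simp add: v_def)
  have cst: "(\<Sum>j<N. e2ennreal (rate (v j)) * ennreal (d j)) \<le> ennreal \<iota>"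
    using order_trans[OF pw_cost_le_I_D[OF T(1) t] \<iota>(1)]
    unfolding pw_cost_def rate_def v_def d_def w_def .
  define c where "c j = enn2real (e2ennreal (rate (v j)))" for j
  have rfin: "e2ennreal (rate (v j)) = ennreal (c j)" if j: "j < N" for j
  proof -
    have "e2ennreal (rate (v j)) * ennreal (d j) \<le> (\<Sum>j<N. e2ennreal (rate (v j)) * ennreal (d j))"
      using j by (intro member_le_sum) auto
    also note cst
    finally have "e2ennreal (rate (v j)) * ennreal (d j) \<noteq> \<top>" by (auto simp: top_unique)
    then have "e2ennreal (rate (v j)) \<noteq> \<top>" using d[OF j] by (auto simp: ennreal_mult_eq_top_iff)
    then show ?thesis by (simp add: c_def less_top)
  qed
  have c0: "0 \<le> c j" for j by (simp add: c_def)
  have rc: "rate (v j) \<le> ereal (c j)" if "j < N" for j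
    unfolding rate_def rate_I_le_iff
    using e2ennreal_rate_I_ge[of _ \<mu> "\<lambda>x. x" "v j" "c j"] rfin[OF that] c0 by (simp add: rate_def)
  have csum: "(\<Sum>j<N. c j * d j) \<le> \<iota>"
  proof -
    have "ennreal (\<Sum>j<N. c j * d j) = (\<Sum>j<N. ennreal (c j * d j))"
      using c0 d by (intro sum_ennreal[symmetric]) (auto intro: mult_nonneg_nonneg less_imp_le)
    also have "\<dots> = (\<Sum>j<N. e2ennreal (rate (v j)) * ennreal (d j))"
      using c0 d rfin by (intro sum.cong) (auto simp: ennreal_mult less_imp_le)
    also note cst
    finally show ?thesis unfolding ennreal_le_iff[OF \<iota>(2)] .
  qed
  obtain \<delta> where \<delta>: "\<delta> > 0" "\<And>f. f \<in> BV01 \<Longrightarrow> rho1' f g < \<delta> \<Longrightarrow> dist (F f) (F g) < e / 3"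
    using F_cont[OF pw_linear_BV01[OF t(1)] e3] unfolding g_def by metis
  \<comment> \<open>Half of \<open>\<delta>\<close> is for the drift allowed by the tubes; the other
    half is left for errors of order \<open>1 / n\<close>.\<close>
  define \<epsilon> where "\<epsilon> = \<delta> / 2"
  have \<epsilon>: "\<epsilon> > 0" using \<delta>(1) by (simp add: \<epsilon>_def)
  have \<eta>: "\<zeta> / 2 > 0" using \<zeta> by simp
  have "\<exists>C. \<forall>l. exp (- real l * (c j + \<zeta> / 2) - C) \<le> Pr (tube (v j) l \<epsilon> C)" if "j < N" for j
    using tube_bound[OF rc[OF that] \<epsilon> \<eta>] by metis
  then obtain C where C: "\<And>j l. j < N \<Longrightarrow> exp (- real l * (c j + \<zeta> / 2) - C j) \<le> Pr (tube (v j) l \<epsilon> (C j))" by metis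
  \<comment> \<open>Bounds single steps as well as the accumulated tube constants; the summand 1
    makes it positive, as \<open>poly_close\<close> requires.\<close>
  define Csum where "Csum = (\<Sum>j<N. \<bar>C j\<bar>) + 1"
  have Csum: "C j \<le> Csum" if "j < N" for j
    using member_le_sum[of j "{..<N}" "\<lambda>j. \<bar>C j\<bar>"] that by (auto simp: Csum_def)
  have Csum0: "0 < Csum" by (simp add: Csum_def add_nonneg_pos sum_nonneg)
  \<comment> \<open>Rounding the nodes to multiples of \<open>1 / n\<close> displaces the polygon by
    at most \<open>V / n\<close>.\<close>
  define V where "V = (\<Sum>j<N. norm (v j))"
  define c' where "c' = (\<Sum>j<N. c j)"
  have c'0: "0 \<le> c'" using c0 by (simp add: c'_def sum_nonneg)
  have "\<forall>\<^sub>F n in sequentially. (2 * Csum + 2 * V) / real n < \<delta> / 2"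
    using lim_const_over_n[of "2 * Csum + 2 * V"] \<delta>(1) by (intro order_tendstoD) auto
  moreover have "\<forall>\<^sub>F n in sequentially. 2 * (c' + Csum) / \<zeta> < real n"
    using filterlim_real_sequentially by (simp add: filterlim_at_top_dense)
  ultimately show ?thesis using poly_close[OF Csum0 e3]
  proof eventually_elim
    case (elim n)
    then have n: "0 < n" by blast
    define k where "k j = nat \<lfloor>real n * t j\<rfloor>" for j
    have k: "real (k j) \<le> real n * t j" "real n * t j < real (k j) + 1" if "j \<le> N" for j
    proof -
      have "0 \<le> t j" using nodes_range[OF t(1) that] by simp
      then have f: "real (k j) = of_int \<lfloor>real n * t j\<rfloor>" by (simp add: k_def)
      show "real (k j) \<le> real n * t j" "real n * t j < real (k j) + 1" unfolding f by linarith+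
    qed
    have k0: "k 0 = 0" "k N = n" using t(1) by (auto simp: k_def nodes_def)
    have kmono: "k i \<le> k j" if "i \<le> j" "j \<le> N" for i j
      unfolding k_def using nodes_le[OF t(1) that] by (intro nat_mono floor_mono mult_left_mono) auto
    define l where "l j = k (Suc j) - k j" for j
    have l: "real (l j) = real (k (Suc j)) - real (k j)" if "j < N" for j
      using kmono[of j "Suc j"] that by (simp add: l_def of_nat_diff)
    have lb: "\<bar>real (l j) - real n * d j\<bar> \<le> 1" if "j < N" for j
      using k[of j] k[of "Suc j"] that unfolding l[OF that] d_def by (simp add: right_diff_distrib abs_le_iff)
    define A where "A j = tube (v j) (l j) \<epsilon> (C j)" for j
    let ?D = "{x. \<forall>j<N. shift (k j) x \<in> A j}"
    have D: "?D \<in> sets S \<and> Pr ?D = (\<Prod>j<N. Pr (A j))"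
    proof (rule Pr_groups)
      show "y \<in> A j" if "\<And>i. i < k (Suc j) - k j \<Longrightarrow> x i = y i" "x \<in> A j" for j x y
        using that unfolding A_def l_def by (rule tube_dep)
    qed (use k0 kmono in \<open>auto simp: A_def tube_event\<close>)
    have "exp (- real n * (\<iota> + \<zeta>)) \<le> exp (\<Sum>j<N. - real (l j) * (c j + \<zeta> / 2) - C j)"
    proof -
      have "(\<Sum>j<N. real (l j)) = real n"
      proof -
        have "(\<Sum>j<N. real (l j)) = (\<Sum>j<N. real (k (Suc j)) - real (k j))" using l by (intro sum.cong) auto
        also have "\<dots> = real n" using sum_lessThan_telescope[of "\<lambda>j. real (k j)" N] k0 by simp
        finally show ?thesis .
      qed
      moreover have "(\<Sum>j<N. real (l j) * c j) \<le> real n * \<iota> + c'"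
      proof -
        have "(\<Sum>j<N. real (l j) * c j) \<le> (\<Sum>j<N. (real n * d j + 1) * c j)"
        proof (intro sum_mono mult_right_mono c0)
          fix j assume "j \<in> {..<N}"
          then show "real (l j) \<le> real n * d j + 1" using lb[of j] by (auto simp: abs_le_iff)
        qed
        also have "\<dots> = real n * (\<Sum>j<N. c j * d j) + c'"
          by (simp add: c'_def sum_distrib_left sum.distrib algebra_simps)
        finally show ?thesis using mult_left_mono[OF csum, of "real n"] by simp
      qed
      moreover have "(\<Sum>j<N. C j) \<le> Csum" unfolding Csum_def by (intro add_increasing2 sum_mono) auto
      moreover have "c' + Csum \<le> real n * (\<zeta> / 2)"
        using elim(2) \<zeta> by (simp add: field_simps)
      ultimately have "(\<Sum>j<N. real (l j) * c j) + (\<Sum>j<N. real (l j)) * (\<zeta> / 2) + (\<Sum>j<N. C j) \<le> real n * (\<iota> + \<zeta>)"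
        by (simp add: distrib_left)
      moreover have "(\<Sum>j<N. - real (l j) * (c j + \<zeta> / 2) - C j)
          = - ((\<Sum>j<N. real (l j) * c j) + (\<Sum>j<N. real (l j)) * (\<zeta> / 2) + (\<Sum>j<N. C j))"
        by (simp add: sum_subtractf sum_negf sum.distrib distrib_left sum_distrib_right)
      ultimately show ?thesis by simp
    qed
    also have "\<dots> = (\<Prod>j<N. exp (- real (l j) * (c j + \<zeta> / 2) - C j))" by (simp add: exp_sum)
    also have "\<dots> \<le> (\<Prod>j<N. Pr (A j))" unfolding A_def using C by (intro prod_mono) auto
    also have "\<dots> = Pr ?D" using D by simp
    also have "\<dots> \<le> Pr {x. F (Q n x) \<in> G}"
    proof (rule P.finite_measure_mono)
      have "(\<lambda>x. F (Q n x)) -` G \<inter> space S \<in> sets S" using Q_meas[OF n] G by (intro measurable_sets[of _ _ borel]) auto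
      then show "{x. F (Q n x) \<in> G} \<in> P.events" by (simp add: vimage_def)
      show "?D \<subseteq> {x. F (Q n x) \<in> G}"
      proof (intro subsetI CollectI)
        fix x assume x: "x \<in> ?D"
        have tb: "norm (psum q (shift (k j) x) - real q *\<^sub>R v j) \<le> real q * \<epsilon> + C j" if "j < N" "q \<le> l j" for j q
          using x that by (auto simp: A_def tube_def)
        have bd: "norm (x i) \<le> Csum" if i: "i < n" for i
        proof -
          \<comment> \<open>The block containing step \<open>i\<close>; the least index is taken
            because blocks may be empty.\<close>
          define j where "j = (LEAST j. i < k (Suc j))"
          obtain N' where N': "N = Suc N'" using nodes_pos[OF t(1)] by (cases N) auto
          have ex: "i < k (Suc N')" using i k0 N' by simp
          have j1: "i < k (Suc j)" unfolding j_def using ex by (rule LeastI)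
          have jN: "j < N" using Least_le[of "\<lambda>j. i < k (Suc j)", OF ex] N' by (simp add: j_def)
          have j2: "k j \<le> i"
          proof (cases j)
            case (Suc j')
            then have "\<not> i < k (Suc j')" using not_less_Least[of j' "\<lambda>j. i < k (Suc j)"] by (simp add: j_def)
            then show ?thesis using Suc by simp
          qed (simp add: k0)
          have "i - k j < l j" using j1 j2 by (simp add: l_def)
          then have "norm (shift (k j) x (i - k j)) \<le> C j" using x jN by (auto simp: A_def tube_def)
          then show ?thesis using j2 Csum[OF jN] by (simp add: shift_def)
        qed
        have near: "dist (poly_walk n x s) (g s) \<le> \<epsilon> + (2 * Csum + 2 * V) / real n" if s: "s \<in> {0..1}" for s
        proof -
          obtain j where j: "j < N" "t j \<le> s" "s \<le> t (Suc j)" using nodes_slot_closed[OF t(1), of s] s by auto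
          define q where "q = nat \<lfloor>real n * s\<rfloor>"
          have qf: "real q = of_int \<lfloor>real n * s\<rfloor>" using s by (simp add: q_def)
          have q: "real q \<le> real n * s" "real n * s < real q + 1" unfolding qf by linarith+
          have kq: "k j \<le> q" "q \<le> k (Suc j)"
            unfolding k_def q_def using j by (auto intro!: nat_mono floor_mono mult_left_mono)
          define p where "p = q - k j"
          have p: "q = k j + p" "p \<le> l j" using kq by (auto simp: p_def l_def)
          \<comment> \<open>Unscaled position after following the prescribed velocities exactly over
            the rounded blocks: the tubes control \<open>psum q x - z\<close>, and rounding controls
            the distance of \<open>z\<close> from \<open>n\<close> times the polygon.\<close>
          define z where "z = (\<Sum>i<j. real (l i) *\<^sub>R v i) + real p *\<^sub>R v j"
          have "psum q x - z = (\<Sum>i<j. psum (l i) (shift (k i) x) - real (l i) *\<^sub>R v i) + (psum p (shift (k j) x) - real p *\<^sub>R v j)"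
            unfolding p(1) psum_add z_def using psum_groups[of k j x] k0 kmono j by (simp add: sum_subtractf l_def)
          then have "norm (psum q x - z) \<le> (\<Sum>i<j. norm (psum (l i) (shift (k i) x) - real (l i) *\<^sub>R v i))
              + norm (psum p (shift (k j) x) - real p *\<^sub>R v j)"
            by (simp only:) (intro norm_triangle_le add_mono norm_sum order.refl)
          also have "\<dots> \<le> (\<Sum>i<j. real (l i) * \<epsilon> + C i) + (real p * \<epsilon> + C j)"
            using tb j p(2) by (intro add_mono sum_mono) auto
          also have "\<dots> = ((\<Sum>i<j. real (l i)) + real p) * \<epsilon> + (\<Sum>i<Suc j. C i)"
            by (simp add: sum.distrib sum_distrib_right distrib_right)
          also have "(\<Sum>i<j. real (l i)) + real p = real q"
          proof -
            have "(\<Sum>i<j. real (l i)) = (\<Sum>i<j. real (k (Suc i)) - real (k i))" using l j by (intro sum.cong) auto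
            also have "\<dots> = real (k j)" using sum_lessThan_telescope[of "\<lambda>j. real (k j)" j] k0 by simp
            finally show ?thesis by (simp add: p(1))
          qed
          finally have "norm (psum q x - z) \<le> real q * \<epsilon> + (\<Sum>i<Suc j. C i)" .
          moreover have "(\<Sum>i<Suc j. C i) \<le> Csum"
          proof -
            have "(\<Sum>i<Suc j. C i) \<le> (\<Sum>i<Suc j. \<bar>C i\<bar>)" by (intro sum_mono) auto
            also have "\<dots> \<le> (\<Sum>i<N. \<bar>C i\<bar>)" using j by (intro sum_mono2) auto
            finally show ?thesis by (simp add: Csum_def)
          qed
          moreover have "real q * \<epsilon> \<le> real n * \<epsilon>"
          proof -
            have "real n * s \<le> real n" using s by (simp add: mult_left_le)
            then show ?thesis using q \<epsilon> by (intro mult_right_mono) auto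
          qed
          ultimately have 1: "norm (psum q x - z) \<le> real n * \<epsilon> + Csum" by linarith
          have gs: "real n *\<^sub>R g s = (\<Sum>i<j. (real n * d i) *\<^sub>R v i) + (real n * (s - t j)) *\<^sub>R v j"
          proof -
            have "g s = (\<Sum>i<j. d i *\<^sub>R v i) + (s - t j) *\<^sub>R v j"
              unfolding g_def pw_linear_slot[OF t(1) j] using dv j d[OF j(1)]
              by (simp add: v_def d_def divide_inverse)
            then show ?thesis by (simp add: scaleR_add_right scaleR_sum_right)
          qed
          have "z - real n *\<^sub>R g s = (\<Sum>i<j. (real (l i) - real n * d i) *\<^sub>R v i) + (real p - real n * (s - t j)) *\<^sub>R v j"
            unfolding z_def gs by (simp add: scaleR_diff_left sum_subtractf)
          then have "norm (z - real n *\<^sub>R g s) \<le> (\<Sum>i<j. norm ((real (l i) - real n * d i) *\<^sub>R v i))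
              + norm ((real p - real n * (s - t j)) *\<^sub>R v j)"
            by (simp only:) (intro norm_triangle_le add_mono norm_sum order.refl)
          also have "\<dots> \<le> (\<Sum>i<j. 1 * norm (v i)) + 1 * norm (v j)"
          proof (intro add_mono sum_mono)
            show "norm ((real (l i) - real n * d i) *\<^sub>R v i) \<le> 1 * norm (v i)" if "i \<in> {..<j}" for i
              unfolding norm_scaleR using lb[of i] that j by (intro mult_right_mono) auto
            have "real p = real q - real (k j)" by (simp add: p(1))
            then have "\<bar>real p - real n * (s - t j)\<bar> \<le> 1"
              using q k[of j] j by (simp add: right_diff_distrib abs_le_iff)
            then show "norm ((real p - real n * (s - t j)) *\<^sub>R v j) \<le> 1 * norm (v j)"
              unfolding norm_scaleR by (intro mult_right_mono) auto
          qed
          also have "\<dots> = (\<Sum>i<Suc j. norm (v i))" by simp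
          also have "\<dots> \<le> V" unfolding V_def using j by (intro sum_mono2) auto
          finally have 2: "norm (z - real n *\<^sub>R g s) \<le> V" .
          have "norm (psum q x - real n *\<^sub>R g s) \<le> real n * \<epsilon> + Csum + V"
            using norm_triangle_ineq[of "psum q x - z" "z - real n *\<^sub>R g s"] 1 2 by simp
          then have "norm ((psum q x - real n *\<^sub>R g s) /\<^sub>R real n) \<le> (real n * \<epsilon> + Csum + V) / real n"
            using n by (simp add: divide_inverse mult.commute mult_left_mono)
          moreover have "(psum q x - real n *\<^sub>R g s) /\<^sub>R real n = psum q x /\<^sub>R real n - g s"
            using n by (simp add: scaleR_diff_right)
          moreover have "norm (poly_walk n x s - psum q x /\<^sub>R real n) \<le> Csum / real n"
            unfolding q_def using s bd Csum0 by (intro poly_near_psum[OF n]) auto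
          ultimately have "norm (poly_walk n x s - g s) \<le> Csum / real n + (real n * \<epsilon> + Csum + V) / real n"
            using norm_triangle_ineq[of "poly_walk n x s - psum q x /\<^sub>R real n" "psum q x /\<^sub>R real n - g s"] by simp
          also have "\<dots> \<le> \<epsilon> + (2 * Csum + 2 * V) / real n"
          proof -
            have "0 \<le> V" unfolding V_def by (intro sum_nonneg) auto
            then have "0 \<le> V / real n" by simp
            then show ?thesis using n by (simp add: add_divide_distrib)
          qed
          finally show ?thesis by (simp add: dist_norm)
        qed
        have "rho1' (poly_walk n x) g \<le> \<epsilon> + (2 * Csum + 2 * V) / real n"
          unfolding poly_pw_linear[OF n] g_def
          by (rule rho1'_pw_linear_le_sup[OF uniform_nodes[OF n] t(1)])
             (use near in \<open>simp add: poly_pw_linear[OF n] g_def\<close>)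
        also have "\<dots> < \<delta>" using elim(1) unfolding \<epsilon>_def by linarith
        finally have "dist (F (poly_walk n x)) (F g) < e / 3" by (rule \<delta>(2)[OF poly_BV01[OF n]])
        moreover have "dist (F (poly_walk n x)) (F (Q n x)) < e / 3"
        proof -
          have "(\<Sum>i<n. norm (x i)) \<le> (\<Sum>i<n. Csum)" using bd by (intro sum_mono) auto
          then show ?thesis using elim(3) by simp
        qed
        ultimately have "dist (F h) (F (Q n x)) < e"
          using T(2) dist_triangle[of "F h" "F (Q n x)" "F g"] dist_triangle[of "F g" "F (Q n x)" "F (poly_walk n x)"]
          by (simp add: g dist_commute)
        then show "F (Q n x) \<in> G" using e(2) by auto
      qed
    qed
    finally show ?case .
  qed
qed

end

section \<open>Logarithmic asymptotics and the two bounds of the LDP\<close>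

lemma liminf_log_prob_ge:
  assumes "\<forall>\<^sub>F n in sequentially. exp (- real n * b) \<le> p n"
  shows "ereal (- b) \<le> liminf (\<lambda>n. ereal (1 / real n) * log_prob (p n))"
proof (rule Liminf_bounded)
  show "\<forall>\<^sub>F n in sequentially. ereal (- b) \<le> ereal (1 / real n) * log_prob (p n)"
    using assms eventually_gt_at_top[of 0]
  proof eventually_elim
    case (elim n)
    then have p: "0 < p n" using less_le_trans[OF exp_gt_zero] by blast
    then have "- real n * b \<le> ln (p n)" using elim(1) by (simp add: ln_ge_iff)
    then have "- b \<le> 1 / real n * ln (p n)" using elim(2) by (simp add: field_simps)
    then show ?case using p by (simp add: log_prob_def)
  qed
qed

text \<open>The polynomial factor disappears because \<open>ln n / n\<close> tends to 0.\<close>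

lemma limsup_log_prob_le:
  assumes p0: "\<And>n. 0 \<le> p n"
    and le: "\<forall>\<^sub>F n in sequentially. p n \<le> K * (real n + 1) ^ N * exp (- real n * a)"
  shows "limsup (\<lambda>n. ereal (1 / real n) * log_prob (p n)) \<le> ereal (- a)"
proof (rule ereal_le_epsilon2)
  fix e :: real assume e: "0 < e"
  define K' where "K' = max K 1"
  have K'0: "0 < K'" by (simp add: K'_def)
  have "(\<lambda>n. ln K' / real (Suc n) + real N * (ln (real (Suc n)) / real (Suc n))) \<longlonglongrightarrow> 0 + real N * 0"
    by (intro tendsto_intros lim_const_over_n[THEN LIMSEQ_Suc] lim_ln_over_n[THEN LIMSEQ_Suc])
  then have "\<forall>\<^sub>F n in sequentially. ln K' / real (Suc n) + real N * (ln (real (Suc n)) / real (Suc n)) < e / 2"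
    using e by (intro order_tendstoD) auto
  then have "\<forall>\<^sub>F n in sequentially. ereal (1 / real n) * log_prob (p n) \<le> ereal (- a) + ereal e"
    using le eventually_gt_at_top[of 0]
  proof eventually_elim
    case (elim n)
    show ?case
    proof (cases "p n = 0")
      case True
      then show ?thesis using elim(3) by (simp add: log_prob_def)
    next
      case False
      then have p: "0 < p n" using p0[of n] by simp
      have "p n \<le> K' * (real n + 1) ^ N * exp (- real n * a)"
        by (rule order_trans[OF elim(2)], intro mult_right_mono) (auto simp: K'_def)
      then have "ln (p n) \<le> ln (K' * (real n + 1) ^ N * exp (- real n * a))" using p by (intro ln_mono) auto
      also have "\<dots> = ln K' + real N * ln (real (Suc n)) - real n * a"
        using K'0 by (simp add: ln_mult ln_realpow add.commute)
      also have "ln K' + real N * ln (real (Suc n)) \<le> e / 2 * real (Suc n)"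
      proof -
        have "(ln K' + real N * ln (real (Suc n))) / real (Suc n) < e / 2"
          using elim(1) by (simp add: add_divide_distrib del: of_nat_Suc)
        then show ?thesis by (simp add: pos_divide_less_eq del: of_nat_Suc)
      qed
      finally have l: "ln (p n) \<le> e / 2 * real (Suc n) - real n * a" by simp
      have "e / 2 * real (Suc n) \<le> e / 2 * (2 * real n)" using elim(3) e by (intro mult_left_mono) auto
      then have "ln (p n) \<le> real n * (e - a)" using l by (simp add: algebra_simps)
      then have "1 / real n * ln (p n) \<le> e - a" using elim(3) by (simp add: field_simps)
      then show ?thesis using p by (simp add: log_prob_def)
    qed
  qed
  then show "limsup (\<lambda>n. ereal (1 / real n) * log_prob (p n)) \<le> ereal (- a) + ereal e"
    by (rule Limsup_bounded)
qed

context walk_path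
begin

abbreviation log_rate :: "'y set \<Rightarrow> nat \<Rightarrow> ereal" where
  "log_rate A n \<equiv> ereal (1 / real n) * log_prob (Pr {x. F (Q n x) \<in> A})"

lemma Q_event: "0 < n \<Longrightarrow> A \<in> sets borel \<Longrightarrow> {x. F (Q n x) \<in> A} \<in> sets S"
  using measurable_sets[OF Q_meas, of n A] by (simp add: vimage_def)

lemma LDP_lower:
  assumes A: "A \<in> sets borel"
  shows "- (INF y\<in>interior A. lsc_reg Jt y) \<le> liminf (log_rate A)"
proof -
  have "- liminf (log_rate A) \<le> enn2ereal (cost h)" if h: "h \<in> BV01" "F h \<in> interior A" for h
  proof (cases "cost h = \<top>")
    case False
    define \<iota> where "\<iota> = enn2real (cost h)"
    have \<iota>: "cost h = ennreal \<iota>" "0 \<le> \<iota>" using False by (simp_all add: \<iota>_def less_top)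
    have "- liminf (log_rate A) \<le> ereal \<iota>"
    proof (rule ereal_le_epsilon2)
      fix \<zeta> :: real assume \<zeta>: "0 < \<zeta>"
      have "\<forall>\<^sub>F n in sequentially. exp (- real n * (\<iota> + \<zeta>)) \<le> Pr {x. F (Q n x) \<in> A}"
        using lower_bound[OF open_interior h(1,2) eq_refl[OF \<iota>(1)] \<iota>(2) \<zeta>] eventually_gt_at_top[of 0]
      proof eventually_elim
        case (elim n)
        have "Pr {x. F (Q n x) \<in> interior A} \<le> Pr {x. F (Q n x) \<in> A}"
          using interior_subset Q_event[OF elim(2) A] by (intro P.finite_measure_mono) auto
        then show ?case using elim(1) by linarith
      qed
      from liminf_log_prob_ge[OF this] have "ereal (- (\<iota> + \<zeta>)) \<le> liminf (log_rate A)" .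
      then have "- ereal (\<iota> + \<zeta>) \<le> liminf (log_rate A)" by simp
      from ereal_uminus_le_reorder[THEN iffD1, OF this]
      show "- liminf (log_rate A) \<le> ereal \<iota> + ereal \<zeta>" by simp
    qed
    then show ?thesis using \<iota> by simp
  qed simp
  then have "- liminf (log_rate A) \<le> Jt y" if "y \<in> interior A" for y
    using that unfolding Jt_def J_tilde_def by (intro INF_greatest) auto
  then have "- liminf (log_rate A) \<le> (INF y\<in>interior A. Jt y)" by (intro INF_greatest)
  also have "\<dots> \<le> (INF y\<in>interior A. lsc_reg Jt y)" by (rule INF_open_le_lsc_reg) simp
  finally show ?thesis by (rule ereal_uminus_le_reorder[THEN iffD1])
qed

lemma LDP_upper:
  assumes A: "A \<in> sets borel"
  shows "limsup (log_rate A) \<le> - (INF y\<in>closure A. lsc_reg Jt y)"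
proof (rule ccontr)
  let ?I = "INF y\<in>closure A. lsc_reg Jt y"
  assume "\<not> limsup (log_rate A) \<le> - ?I"
  then have "- ?I < limsup (log_rate A)" by (simp only: not_le)
  then have "- limsup (log_rate A) < ?I" by (rule ereal_uminus_less_reorder[THEN iffD1])
  \<comment> \<open>A real level strictly between the two also covers the case of an infinite
    infimum.\<close>
  then obtain a where a: "- limsup (log_rate A) < ereal a" "ereal a < ?I" using ereal_dense2 by blast
  have "ereal a < lsc_reg Jt y" if "y \<in> closure A" for y using a(2) INF_lower[OF that] by (rule less_le_trans)
  then obtain K N where KN: "\<forall>\<^sub>F n in sequentially. Pr {x. F (Q n x) \<in> closure A} \<le> K * (real n + 1) ^ N * exp (- real n * a)"
    using upper_bound[OF closed_closure] by blast
  have "\<forall>\<^sub>F n in sequentially. Pr {x. F (Q n x) \<in> A} \<le> K * (real n + 1) ^ N * exp (- real n * a)"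
    using KN eventually_gt_at_top[of 0]
  proof eventually_elim
    case (elim n)
    have "Pr {x. F (Q n x) \<in> A} \<le> Pr {x. F (Q n x) \<in> closure A}"
      using closure_subset Q_event[OF elim(2) borel_closed[OF closed_closure]] by (intro P.finite_measure_mono) auto
    then show ?case using elim(1) by linarith
  qed
  then have "limsup (log_rate A) \<le> ereal (- a)" by (intro limsup_log_prob_le) auto
  then have "limsup (log_rate A) \<le> - ereal a" by simp
  then have "- (- ereal a) \<le> - limsup (log_rate A)" unfolding ereal_minus_le_minus .
  then show False using a(1) by simp
qed

end

lemma (in path_functional) walk_path_poly: "walk_path \<mu> F poly_walk"
proof unfold_locales
  fix n :: nat and x :: "nat \<Rightarrow> 'a" assume n: "0 < n"
  show "rho1' (poly_walk n x) (poly_walk n x) \<le> 1 / real n"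
    unfolding poly_pw_linear[OF n] by (rule rho1'_pw_linear_le_sup[OF uniform_nodes[OF n] uniform_nodes[OF n]]) simp
qed (auto simp: poly_BV01 var01_poly_le F_poly_measurable)

lemma (in path_functional) walk_path_step: "walk_path \<mu> F step_walk"
proof unfold_locales
  fix n :: nat and x :: "nat \<Rightarrow> 'a" assume n: "0 < n"
  show "step_walk n x \<in> BV01" unfolding step_walk_def by (rule step_path_BV01[OF n])
  show "var01 (step_walk n x) \<le> ennreal ((\<Sum>i<n. norm (x i)) / real n)" unfolding step_walk_def by (rule var01_step_path[OF n])
  show "rho1' (poly_walk n x) (step_walk n x) \<le> 1 / real n" unfolding poly_walk_def step_walk_def by (rule rho1'_poly_step[OF n])
qed (rule F_step_measurable)

section \<open>Transfer from the canonical space to the given random vectors\<close>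

lemma rate_I_distr:
  assumes [measurable]: "Y \<in> borel_measurable M"
  shows "rate_I M Y = rate_I (distr M borel Y) (\<lambda>x. x)"
    and "Laplace_dom M Y = Laplace_dom (distr M borel Y) (\<lambda>x. x)"
proof -
  have int: "(\<integral>\<^sup>+x. ennreal (exp (u \<bullet> x)) \<partial>distr M borel Y) = (\<integral>\<^sup>+\<omega>. ennreal (exp (u \<bullet> Y \<omega>)) \<partial>M)" for u
    by (rule nn_integral_distr) measurable
  show dom: "Laplace_dom M Y = Laplace_dom (distr M borel Y) (\<lambda>x. x)" by (simp only: Laplace_dom_def int)
  have "cumulant M Y = cumulant (distr M borel Y) (\<lambda>x. x)" by (simp only: cumulant_def[abs_def] int dom)
  then show "rate_I M Y = rate_I (distr M borel Y) (\<lambda>x. x)" by (simp only: rate_I_def[abs_def])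
qed

theorem theorem3p3:
  fixes M :: "'b measure"
    and X :: "nat \<Rightarrow> 'b \<Rightarrow> 'a::euclidean_space"
    and F :: "(real \<Rightarrow> 'a) \<Rightarrow> 'y::complete_space"
  assumes "prob_space M"
    and "prob_space.indep_vars M (\<lambda>_. borel) X UNIV"
    and "\<forall>i. distr M borel (X i) = distr M borel (X 0)"
    and "0 \<in> interior (Laplace_dom M (X 0))"
    and "\<forall>h\<in>BV01. \<forall>e>0. \<exists>\<delta>>0. \<forall>g\<in>BV01. rho1' g h < \<delta> \<longrightarrow> dist (F g) (F h) < e"
    and "\<forall>R>0. \<forall>e>0. \<exists>\<delta>>0. \<forall>h\<in>{h\<in>BV01. var01 h \<le> ennreal R}.
           \<forall>g\<in>{h\<in>BV01. var01 h \<le> ennreal R}. rho1' g h < \<delta> \<longrightarrow> dist (F g) (F h) < e"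
  shows "LDP M (\<lambda>n \<omega>. F (poly_path X n \<omega>)) (lsc_reg (J_tilde M (X 0) F))
       \<and> LDP M (\<lambda>n \<omega>. F (step_path X n \<omega>)) (lsc_reg (J_tilde M (X 0) F))"
proof -
  interpret M: prob_space M by (rule assms(1))
  define \<mu> where "\<mu> = distr M borel (X 0)"
  have X [measurable]: "X i \<in> borel_measurable M" for i
    using assms(2) by (auto simp: M.indep_vars_def)
  interpret iid_law \<mu>
    unfolding iid_law_def iid_law_axioms_def \<mu>_def by (auto intro: M.prob_space_distr)
  have "law_dom = Laplace_dom M (X 0)" unfolding rate_I_distr(2)[OF X] \<mu>_def[symmetric] by (rule law_dom_def)
  then interpret path_functional \<mu> F
    using assms(4-6) by unfold_locales auto
  have "I_D M (X 0) = I_D \<mu> (\<lambda>x. x)"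
    unfolding I_D_def[abs_def] rate_I_distr(1)[OF X] \<mu>_def ..
  then have J: "J_tilde M (X 0) F = Jt" unfolding Jt_def J_tilde_def[abs_def] by (simp only:)
  \<comment> \<open>The whole sequence as one random variable; independence and equal laws make its
    law the product measure \<open>S\<close>.\<close>
  define Xs where "Xs \<omega> = (\<lambda>i. X i \<omega>)" for \<omega>
  have "distr M (Pi\<^sub>M UNIV (\<lambda>_. borel)) (\<lambda>\<omega>. \<lambda>i\<in>UNIV. X i \<omega>) = Pi\<^sub>M UNIV (\<lambda>i. distr M borel (X i))"
    using assms(2) by (subst M.indep_vars_iff_distr_eq_PiM[symmetric]) auto
  also have "\<dots> = S" using assms(3) by (intro PiM_cong) (auto simp: \<mu>_def)
  finally have law: "distr M (Pi\<^sub>M UNIV (\<lambda>_. borel)) Xs = S" by (simp add: Xs_def[abs_def] restrict_def)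
  have Xs_meas: "Xs \<in> measurable M (Pi\<^sub>M UNIV (\<lambda>_. borel))"
    unfolding Xs_def[abs_def] by (rule measurable_PiM_single') (auto simp: PiE_UNIV_domain)
  have transfer: "measure M {\<omega>\<in>space M. Xs \<omega> \<in> B} = Pr B" if "B \<in> sets S" for B
  proof -
    have "Pr B = measure M (Xs -` B \<inter> space M)"
      using that unfolding law[symmetric] by (subst measure_distr[OF Xs_meas]) auto
    moreover have "Xs -` B \<inter> space M = {\<omega>\<in>space M. Xs \<omega> \<in> B}" by auto
    ultimately show ?thesis by simp
  qed
  have main: "LDP M (\<lambda>n \<omega>. F (Q n (Xs \<omega>))) (lsc_reg Jt)" if "walk_path \<mu> F Q" for Q
  proof -
    interpret walk_path \<mu> F Q by (rule that)
    show ?thesis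
      unfolding LDP_def Let_def
    proof (intro conjI ballI tight_rate_function_Jt)
      fix A :: "'y set" assume A: "A \<in> sets borel"
      let ?r = "\<lambda>n. ereal (1 / real n) * log_prob (measure M {\<omega>\<in>space M. F (Q n (Xs \<omega>)) \<in> A})"
      \<comment> \<open>The events are known to be measurable for \<open>n > 0\<close>, so the two
        sequences are compared eventually.\<close>
      have ev: "\<forall>\<^sub>F n in sequentially. ?r n = log_rate A n"
        using eventually_gt_at_top[of 0]
      proof eventually_elim
        case (elim n)
        then show ?case using transfer[OF Q_event[OF elim A]] by simp
      qed
      show "- (INF y\<in>interior A. lsc_reg Jt y) \<le> liminf ?r"
        unfolding Liminf_eq[OF ev] by (rule LDP_lower[OF A])
      show "limsup ?r \<le> - (INF y\<in>closure A. lsc_reg Jt y)"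
        unfolding Limsup_eq[OF ev] by (rule LDP_upper[OF A])
      show "liminf ?r \<le> limsup ?r" by (rule Liminf_le_Limsup) simp
    qed
  qed
  have "poly_walk n (Xs \<omega>) = poly_path X n \<omega>" "step_walk n (Xs \<omega>) = step_path X n \<omega>" for n \<omega>
    by (simp_all add: fun_eq_iff poly_walk_def step_walk_def poly_path_def step_path_def Ssum_def Xs_def)
  then show ?thesis unfolding J using main[OF walk_path_poly] main[OF walk_path_step] by simp
qed

end
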